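(* Let $L$ be a smooth operator field on a smooth manifold of dimension three such that at every point $L$ has only one eigenvalue, and this eigenvalue has geometric multiplicity one (i.e. at every point $p$ the operator $L_p$ is similar to a single $3\times 3$ Jordan block with some real eigenvalue $\lambda(p)$). Then the following are equivalent: (i) in a neighbourhood of each point, there exists a coordinate system in which the matrix of $L$ is upper triangular; (ii) the Haantjes torsion $\mathcal H_L$ of $L$ vanishes identically.
   Context: An operator field $L$ on a manifold is a (real) tensor field of type $(1,1)$, i.e. a field of endomorphisms of the tangent spaces. In local coordinates $x_1,\dots,x_n$ its matrix $(L^i_j)$ is given by $L\,\partial_{x_j}=\sum_i L^i_j\,\partial_{x_i}$. The matrix is upper triangular if $L^i_j=0$ for all $i>j$ at all points of the coordinate neighbourhood. The Nijenhuis torsion of $L$ is the tensor field of type $(1,2)$ defined, for vector fields $\xi,\eta$, by $$\mathcal T_L(\xi,\eta)=L^2[\xi,\eta]+[L\xi,L\eta]-L[L\xi,\eta]-L[\xi,L\eta],$$ where $[\cdot,\cdot]$ is the Lie bracket of vector fields. The Haantjes torsion of $L$ is the tensor field of type $(1,2)$ defined by $$\mathcal H_L(\xi,\eta)=L^2\mathcal T_L(\xi,\eta)+\mathcal T_L(L\xi,L\eta)-L\,\mathcal T_L(L\xi,\eta)-L\,\mathcal T_L(\xi,L\eta).$$ *)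

theory Defs
  imports "HOL-Analysis.Analysis" "HOL-Library.Function_Algebras"
begin

text \<open>
  Meant for open \<open>S\<close> only, since the derivatives are taken at \<open>x\<close> and not within \<open>S\<close>.
\<close>

primrec Ck_on :: "nat \<Rightarrow> 'a::euclidean_space set \<Rightarrow> ('a \<Rightarrow> 'b::real_normed_vector) \<Rightarrow> bool" where
  "Ck_on 0 S f \<longleftrightarrow> continuous_on S f"
| "Ck_on (Suc k) S f \<longleftrightarrow>
     (\<forall>x\<in>S. f differentiable (at x)) \<and>
     (\<forall>v. Ck_on k S (\<lambda>x. frechet_derivative f (at x) v))"

definition smooth_on :: "'a::euclidean_space set \<Rightarrow> ('a \<Rightarrow> 'b::real_normed_vector) \<Rightarrow> bool" where
  "smooth_on S f \<longleftrightarrow> (\<forall>k. Ck_on k S f)"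

text \<open>
  A chart is a pair of its domain and its coordinate map; the values of the coordinate map
  outside the domain are irrelevant. A manifold is given by an atlas on a subset of a Hausdorff,
  second countable space; its underlying set is the union of the chart domains.
\<close>

type_synonym ('a, 'n) chart = "'a set \<times> ('a \<Rightarrow> real ^ 'n)"

abbreviation chart_inv :: "('a, 'n) chart \<Rightarrow> real ^ 'n \<Rightarrow> 'a" where
  "chart_inv c \<equiv> inv_into (fst c) (snd c)"

definition is_chart :: "('a::topological_space, 'n::finite) chart \<Rightarrow> bool" where
  "is_chart c \<longleftrightarrow> open (fst c) \<and> open (snd c ` fst c) \<and>
     homeomorphism (fst c) (snd c ` fst c) (snd c) (chart_inv c)"

definition compatible :: "('a::topological_space, 'n::finite) chart \<Rightarrow> ('a, 'n) chart \<Rightarrow> bool" where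
  "compatible c d \<longleftrightarrow>
     smooth_on (snd c ` (fst c \<inter> fst d)) (snd d \<circ> chart_inv c) \<and>
     smooth_on (snd d ` (fst c \<inter> fst d)) (snd c \<circ> chart_inv d)"

definition smooth_atlas ::
  "('a::{t2_space, second_countable_topology}, 'n::finite) chart set \<Rightarrow> bool" where
  "smooth_atlas A \<longleftrightarrow> (\<forall>c\<in>A. is_chart c) \<and> (\<forall>c\<in>A. \<forall>d\<in>A. compatible c d)"

definition manifold :: "('a, 'n) chart set \<Rightarrow> 'a set" where
  "manifold A = (\<Union>c\<in>A. fst c)"

text \<open>The local coordinate systems of the manifold: the charts of the maximal atlas.\<close>

definition coordinate_systems ::
  "('a::topological_space, 'n::finite) chart set \<Rightarrow> ('a, 'n) chart set" where
  "coordinate_systems A =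
     {c. is_chart c \<and> fst c \<subseteq> manifold A \<and> (\<forall>d\<in>A. compatible c d)}"

definition smooth_fun_on ::
  "('a::topological_space, 'n::finite) chart set \<Rightarrow> 'a set \<Rightarrow> ('a \<Rightarrow> real) \<Rightarrow> bool" where
  "smooth_fun_on A S f \<longleftrightarrow> (\<forall>c\<in>A. smooth_on (snd c ` (fst c \<inter> S)) (f \<circ> chart_inv c))"

definition smooth_near ::
  "('a::topological_space, 'n::finite) chart set \<Rightarrow> 'a \<Rightarrow> ('a \<Rightarrow> real) \<Rightarrow> bool" where
  "smooth_near A p f \<longleftrightarrow> (\<exists>S. open S \<and> p \<in> S \<and> S \<subseteq> manifold A \<and> smooth_fun_on A S f)"

text \<open>
  Tangent vectors at \<open>p\<close> are the derivations at \<open>p\<close> of the functions that are smooth in some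
  neighbourhood of \<open>p\<close>. Such functions are represented by total functions; that a derivation
  depends only on the germ at \<open>p\<close> follows from the Leibniz rule, because the indicator
  function of a neighbourhood of \<open>p\<close> is smooth near \<open>p\<close>. A derivation is set to 0 on all
  remaining functions, so that equality of tangent vectors is equality of functions.
\<close>

type_synonym 'a tvec = "('a \<Rightarrow> real) \<Rightarrow> real"

definition scale :: "real \<Rightarrow> 'a tvec \<Rightarrow> 'a tvec" where
  "scale r v = (\<lambda>f. r * v f)"

definition tangent_space ::
  "('a::topological_space, 'n::finite) chart set \<Rightarrow> 'a \<Rightarrow> 'a tvec set" where
  "tangent_space A p = {v.
     (\<forall>f g. smooth_near A p f \<longrightarrow> smooth_near A p g \<longrightarrow> v (f + g) = v f + v g) \<and>
     (\<forall>r f. smooth_near A p f \<longrightarrow> v (\<lambda>q. r * f q) = r * v f) \<and>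
     (\<forall>f g. smooth_near A p f \<longrightarrow> smooth_near A p g \<longrightarrow> v (f * g) = f p * v g + g p * v f) \<and>
     (\<forall>f. \<not> smooth_near A p f \<longrightarrow> v f = 0)}"

text \<open>The coordinate vector \<open>\<partial>\<close>/\<open>\<partial>x\<^sub>j\<close> at \<open>p\<close> of the chart \<open>c\<close>.\<close>

definition coord_vector ::
  "('a::topological_space, 'n::finite) chart set \<Rightarrow> ('a, 'n) chart \<Rightarrow> 'a \<Rightarrow> 'n \<Rightarrow> 'a tvec" where
  "coord_vector A c p j = (\<lambda>f. if smooth_near A p f
     then frechet_derivative (f \<circ> chart_inv c) (at (snd c p)) (axis j 1) else 0)"

type_synonym 'a vfield = "'a \<Rightarrow> 'a tvec"

definition vector_field_on ::
  "('a::topological_space, 'n::finite) chart set \<Rightarrow> 'a set \<Rightarrow> 'a vfield \<Rightarrow> bool" where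
  "vector_field_on A U X \<longleftrightarrow>
     (\<forall>p\<in>U. X p \<in> tangent_space A p) \<and>
     (\<forall>S f. open S \<longrightarrow> S \<subseteq> U \<longrightarrow> smooth_fun_on A S f \<longrightarrow> smooth_fun_on A S (\<lambda>p. X p f))"

definition lie_bracket ::
  "('a::topological_space, 'n::finite) chart set \<Rightarrow> 'a vfield \<Rightarrow> 'a vfield \<Rightarrow> 'a vfield" where
  "lie_bracket A X Y = (\<lambda>p f. if smooth_near A p f
     then X p (\<lambda>q. Y q f) - Y p (\<lambda>q. X q f) else 0)"

type_synonym 'a opfield = "'a \<Rightarrow> 'a tvec \<Rightarrow> 'a tvec"

definition tangent_endomorphism ::
  "('a::topological_space, 'n::finite) chart set \<Rightarrow> 'a \<Rightarrow> ('a tvec \<Rightarrow> 'a tvec) \<Rightarrow> bool" where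
  "tangent_endomorphism A p T \<longleftrightarrow>
     (\<forall>v\<in>tangent_space A p. T v \<in> tangent_space A p) \<and>
     (\<forall>v\<in>tangent_space A p. \<forall>w\<in>tangent_space A p. T (v + w) = T v + T w) \<and>
     (\<forall>r. \<forall>v\<in>tangent_space A p. T (scale r v) = scale r (T v))"

definition represents :: "('n::finite \<Rightarrow> 'a tvec) \<Rightarrow> ('a tvec \<Rightarrow> 'a tvec) \<Rightarrow> real ^ 'n ^ 'n \<Rightarrow> bool" where
  "represents e T M \<longleftrightarrow> (\<forall>j. T (e j) = (\<Sum>i\<in>UNIV. scale (M $ i $ j) (e i)))"

definition operator_matrix ::
  "('a::topological_space, 'n::finite) chart set \<Rightarrow> 'a opfield \<Rightarrow> ('a, 'n) chart \<Rightarrow> 'a \<Rightarrow> real ^ 'n ^ 'n"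
  where "operator_matrix A L c p = (THE M. represents (coord_vector A c p) (L p) M)"

definition smooth_operator_field ::
  "('a::topological_space, 'n::finite) chart set \<Rightarrow> 'a opfield \<Rightarrow> bool" where
  "smooth_operator_field A L \<longleftrightarrow>
     (\<forall>p\<in>manifold A. tangent_endomorphism A p (L p)) \<and>
     (\<forall>c\<in>A. \<forall>i j. smooth_fun_on A (fst c) (\<lambda>p. operator_matrix A L c p $ i $ j))"

definition op_app :: "'a opfield \<Rightarrow> 'a vfield \<Rightarrow> 'a vfield" where
  "op_app L X = (\<lambda>p. L p (X p))"

definition nijenhuis_torsion ::
  "('a::topological_space, 'n::finite) chart set \<Rightarrow> 'a opfield \<Rightarrow> 'a vfield \<Rightarrow> 'a vfield \<Rightarrow> 'a vfield"
  where "nijenhuis_torsion A L X Y =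
     op_app L (op_app L (lie_bracket A X Y)) + lie_bracket A (op_app L X) (op_app L Y)
     - op_app L (lie_bracket A (op_app L X) Y) - op_app L (lie_bracket A X (op_app L Y))"

definition haantjes_torsion ::
  "('a::topological_space, 'n::finite) chart set \<Rightarrow> 'a opfield \<Rightarrow> 'a vfield \<Rightarrow> 'a vfield \<Rightarrow> 'a vfield"
  where "haantjes_torsion A L X Y =
     op_app L (op_app L (nijenhuis_torsion A L X Y)) + nijenhuis_torsion A L (op_app L X) (op_app L Y)
     - op_app L (nijenhuis_torsion A L (op_app L X) Y) - op_app L (nijenhuis_torsion A L X (op_app L Y))"

text \<open>
  A tensor field vanishes identically iff it vanishes on all vector fields defined on
  open subsets.
\<close>

definition haantjes_vanishes ::
  "('a::topological_space, 'n::finite) chart set \<Rightarrow> 'a opfield \<Rightarrow> bool" where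
  "haantjes_vanishes A L \<longleftrightarrow>
     (\<forall>U X Y. open U \<longrightarrow> U \<subseteq> manifold A \<longrightarrow> vector_field_on A U X \<longrightarrow> vector_field_on A U Y \<longrightarrow>
        (\<forall>p\<in>U. haantjes_torsion A L X Y p = 0))"

text \<open>
  The indices are spelled out because in the numeral type \<open>3\<close> the index \<open>3\<close> equals \<open>0\<close>, so that
  the library order on this type is not the order of the coordinates.
\<close>

definition upper_triangular3 :: "real ^ 3 ^ 3 \<Rightarrow> bool" where
  "upper_triangular3 M \<longleftrightarrow> M $ 2 $ 1 = 0 \<and> M $ 3 $ 1 = 0 \<and> M $ 3 $ 2 = 0"

definition jordan_block3 :: "real \<Rightarrow> real ^ 3 ^ 3" where
  "jordan_block3 l = vector [vector [l, 1, 0], vector [0, l, 1], vector [0, 0, l]]"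

definition tangent_basis ::
  "('a::topological_space, 'n::finite) chart set \<Rightarrow> 'a \<Rightarrow> ('n \<Rightarrow> 'a tvec) \<Rightarrow> bool" where
  "tangent_basis A p e \<longleftrightarrow>
     (\<forall>i. e i \<in> tangent_space A p) \<and>
     (\<forall>v\<in>tangent_space A p. \<exists>!a :: real ^ 'n. v = (\<Sum>i\<in>UNIV. scale (a $ i) (e i)))"

definition single_jordan_block_at :: "('a::topological_space, 3) chart set \<Rightarrow> 'a opfield \<Rightarrow> 'a \<Rightarrow> bool" where
  "single_jordan_block_at A L p \<longleftrightarrow>
     (\<exists>l e. tangent_basis A p e \<and> represents e (L p) (jordan_block3 l))"

end

theory Submission
  imports Defs
begin

text \<open>
  Let \<open>N = L - \<lambda>\<close> be the nilpotent part of \<open>L\<close>. The Haantjes torsions of \<open>L\<close> and \<open>N\<close> coincide, and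
  \<open>H(\<xi>, N\<xi>)\<close> is up to sign \<open>3 N\<^sup>2[N\<^sup>2\<xi>, N\<xi>]\<close>, while the remaining components in the basis
  \<open>\<xi>, N\<xi>, N\<^sup>2\<xi>\<close> are zero; hence \<open>H = 0\<close> iff the plane field \<open>ker N\<^sup>2\<close> is involutive. In triangular
  coordinates \<open>ker N\<^sup>2\<close> is the kernel of the differential of the last coordinate.
  Conversely, if it is involutive, composing the flows of \<open>N\<^sup>2\<xi>\<close> and \<open>N\<xi>\<close> gives coordinates in which
  \<open>ker N\<close> and \<open>ker N\<^sup>2\<close> are spanned by the first and the first two coordinate vectors.
\<close>

section \<open>Calculus of smooth maps\<close>

text \<open>The eigenvalue enters the hypotheses only pointwise; recovered as a third of the trace
  it is smooth, which makes N a smooth field. For the flows a constant coordinate vector \<xi> is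
  kept. The fields N^2 \<xi> and N \<xi> need not commute even when they span an involutive plane
  field, so in the map \<Psi> composed from their flows only the coordinate vector of the outer flow
  is prescribed everywhere; the other one equals N \<xi> merely on the slice where the outer time is
  zero. Off the slice it is kept in ker N^2 by a scalar linear homogeneous ODE along the outer flow,
  whose coefficient exists because of involutivity. In the other direction, involutivity of the
  kernel of a differential is the symmetry of second derivatives. Inverse maps and solutions of
  fixed point equations are shown smooth by a bootstrap: their derivative is expressed through the
  map itself, so each order of regularity yields the next.\<close>

lemma frechet_derivative_eq:
  "(f has_derivative f') (at x) \<Longrightarrow> frechet_derivative f (at x) = f'"
  by (simp add: frechet_derivative_at[symmetric])

lemma differentiable_frechet:
  "f differentiable (at x) \<Longrightarrow> (f has_derivative frechet_derivative f (at x)) (at x)"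
  by (simp add: frechet_derivative_works[symmetric])

lemma Ck_on_cong:
  assumes "open S" "\<And>x. x \<in> S \<Longrightarrow> f x = g x" "Ck_on k S f"
  shows "Ck_on k S g"
  using assms(2,3)
proof (induction k arbitrary: f g)
  case 0
  then show ?case by (simp cong: continuous_on_cong)
next
  case (Suc k)
  have d: "(g has_derivative frechet_derivative f (at x)) (at x)" if "x \<in> S" for x
    using Suc.prems that differentiable_frechet[of f x] assms(1)
    by (auto intro: has_derivative_transform_within_open)
  have "Ck_on k S (\<lambda>x. frechet_derivative g (at x) v)" for v
    by (rule Suc.IH[of "\<lambda>x. frechet_derivative f (at x) v"])
      (use Suc.prems d frechet_derivative_eq[OF d] in auto)
  then show ?case using d by (auto simp: differentiable_def)
qed

lemma Ck_on_SucI: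
  assumes "open S" "\<And>x. x \<in> S \<Longrightarrow> (f has_derivative f' x) (at x)"
    "\<And>v. Ck_on k S (\<lambda>x. f' x v)"
  shows "Ck_on (Suc k) S f"
proof -
  have "Ck_on k S (\<lambda>x. frechet_derivative f (at x) v)" for v
    by (rule Ck_on_cong[OF assms(1) _ assms(3)[of v]]) (use frechet_derivative_eq[OF assms(2)] in auto)
  then show ?thesis using assms(2) by (auto simp: differentiable_def)
qed

lemma Ck_on_has_derivative:
  "Ck_on (Suc k) S f \<Longrightarrow> x \<in> S \<Longrightarrow> (f has_derivative frechet_derivative f (at x)) (at x)"
  by (auto intro: differentiable_frechet)

lemma Ck_on_continuous: "Ck_on k S f \<Longrightarrow> continuous_on S f"
  by (cases k) (auto intro!: differentiable_imp_continuous_on differentiable_at_imp_differentiable_on)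

lemma Ck_on_SucD: "Ck_on (Suc k) S f \<Longrightarrow> Ck_on k S f"
  by (induction k arbitrary: f)
    (auto intro!: differentiable_imp_continuous_on differentiable_at_imp_differentiable_on)

lemma Ck_on_subset: "Ck_on k S f \<Longrightarrow> T \<subseteq> S \<Longrightarrow> Ck_on k T f"
  by (induction k arbitrary: f) (auto intro: continuous_on_subset)

lemma Ck_on_local:
  assumes "\<And>x. x \<in> S \<Longrightarrow> \<exists>T. open T \<and> x \<in> T \<and> Ck_on k T f"
  shows "Ck_on k S f"
  using assms
proof (induction k arbitrary: f)
  case 0
  have "continuous (at x within S) f" if "x \<in> S" for x :: 'a
  proof -
    obtain T where "open T" "x \<in> T" "continuous_on T f" using 0 \<open>x \<in> S\<close> by auto
    then show ?thesis by (simp add: continuous_on_eq_continuous_at continuous_at_imp_continuous_within)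
  qed
  then show ?case by (simp add: continuous_on_eq_continuous_within)
next
  case (Suc k)
  show ?case
  proof (simp, intro conjI ballI allI)
    fix x assume "x \<in> S" then show "f differentiable at x" using Suc.prems by fastforce
  next
    fix v show "Ck_on k S (\<lambda>x. frechet_derivative f (at x) v)"
      by (rule Suc.IH) (use Suc.prems in fastforce)
  qed
qed

lemma Ck_on_const: "open S \<Longrightarrow> Ck_on k S (\<lambda>x. c)"
proof (induction k arbitrary: c)
  case (Suc k)
  show ?case by (rule Ck_on_SucI[OF Suc.prems, where f' = "\<lambda>_ _. 0"]) (use Suc in auto)
qed simp

lemma Ck_on_bounded_linear_comp:
  assumes "bounded_linear h" "open S" "Ck_on k S f"
  shows "Ck_on k S (\<lambda>x. h (f x))"
  using assms(3)
proof (induction k arbitrary: f)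
  case 0
  then show ?case using assms(1) by (auto intro: bounded_linear.continuous_on)
next
  case (Suc k)
  show ?case
    by (rule Ck_on_SucI[OF assms(2), where f' = "\<lambda>x v. h (frechet_derivative f (at x) v)"])
      (use Suc bounded_linear.has_derivative[OF assms(1) Ck_on_has_derivative[OF Suc.prems]] in auto)
qed

lemma Ck_on_id: "open S \<Longrightarrow> Ck_on k S (\<lambda>x. x)"
proof (cases k)
  case (Suc n)
  assume "open S"
  then show ?thesis unfolding Suc
    by (intro Ck_on_SucI[where f' = "\<lambda>_ v. v"]) (auto intro: Ck_on_const)
qed simp

lemma Ck_on_bounded_linear: "bounded_linear h \<Longrightarrow> open S \<Longrightarrow> Ck_on k S h"
  using Ck_on_bounded_linear_comp[of h S k "\<lambda>x. x"] Ck_on_id by auto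

lemma Ck_on_add:
  assumes "open S" "Ck_on k S f" "Ck_on k S g"
  shows "Ck_on k S (\<lambda>x. f x + g x)"
  using assms(2,3)
proof (induction k arbitrary: f g)
  case 0
  then show ?case by (auto intro: continuous_intros)
next
  case (Suc k)
  show ?case
    by (rule Ck_on_SucI[OF assms(1),
          where f' = "\<lambda>x v. frechet_derivative f (at x) v + frechet_derivative g (at x) v"])
      (use Suc in \<open>auto intro!: has_derivative_add differentiable_frechet\<close>)
qed

lemma Ck_on_sum:
  assumes "open S" "\<And>i. i \<in> I \<Longrightarrow> Ck_on k S (f i)"
  shows "Ck_on k S (\<lambda>x. \<Sum>i\<in>I. f i x)"
  using assms(2)
  by (induction I rule: infinite_finite_induct) (auto intro: Ck_on_const Ck_on_add assms(1))

text \<open>By the product rule the derivative is a sum of two products of the same kind, so the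
  induction runs over both factors. This covers scaling, evaluation and composition of operators at
  once.\<close>

lemma (in bounded_bilinear) Ck_on_bilinear:
  assumes "open S" "Ck_on k S f" "Ck_on k S g"
  shows "Ck_on k S (\<lambda>x. prod (f x) (g x))"
  using assms(2,3)
proof (induction k arbitrary: f g)
  case 0
  then show ?case by (auto intro: continuous_on)
next
  case (Suc k)
  show ?case
  proof (rule Ck_on_SucI[OF assms(1)])
    fix x assume "x \<in> S"
    then show "((\<lambda>x. prod (f x) (g x)) has_derivative
      (\<lambda>v. prod (f x) (frechet_derivative g (at x) v) + prod (frechet_derivative f (at x) v) (g x))) (at x)"
      using Suc.prems by (intro FDERIV Ck_on_has_derivative)
  next
    fix v
    show "Ck_on k S (\<lambda>x. prod (f x) (frechet_derivative g (at x) v) + prod (frechet_derivative f (at x) v) (g x))"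
      by (rule Ck_on_add[OF assms(1)]; rule Suc.IH)
        (use Suc.prems Ck_on_SucD in auto)
  qed
qed

text \<open>\<open>Ck_on\<close> speaks of derivatives in a fixed direction. The expansion turns a
  derivative along a varying direction into a combination of derivatives along fixed ones, with
  coefficients that carry the variation.\<close>

lemma has_derivative_Basis:
  fixes f :: "'a::euclidean_space \<Rightarrow> 'b::real_normed_vector"
  assumes "(f has_derivative f') (at x)"
  shows "f' v = (\<Sum>b\<in>Basis. (v \<bullet> b) *\<^sub>R f' b)"
proof -
  have l: "linear f'" using assms by (simp add: has_derivative_linear)
  have "f' v = f' (\<Sum>b\<in>Basis. (v \<bullet> b) *\<^sub>R b)" by (simp add: euclidean_representation)
  also have "\<dots> = (\<Sum>b\<in>Basis. (v \<bullet> b) *\<^sub>R f' b)" using l by (simp add: linear_sum linear_scale)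
  finally show ?thesis .
qed

text \<open>In the chain rule the direction \<open>frechet_derivative g (at x) v\<close> moves with
  \<open>x\<close>, hence the basis expansion; the induction hypothesis applies to each partial
  derivative of \<open>f\<close>.\<close>

lemma Ck_on_compose:
  fixes f :: "'b::euclidean_space \<Rightarrow> 'c::real_normed_vector"
  assumes "open S" "open T" "\<And>x. x \<in> S \<Longrightarrow> g x \<in> T" "Ck_on k S g" "Ck_on k T f"
  shows "Ck_on k S (\<lambda>x. f (g x))"
  using assms(4,5)
proof (induction k arbitrary: f)
  case 0
  then show ?case using assms(3) by (auto intro: continuous_on_compose2)
next
  case (Suc k)
  let ?D = "\<lambda>f x. frechet_derivative f (at x)"
  show ?case
  proof (rule Ck_on_SucI[OF assms(1)])
    fix x assume x: "x \<in> S"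
    have "((\<lambda>x. f (g x)) has_derivative (\<lambda>v. ?D f (g x) (?D g x v))) (at x)"
      using diff_chain_at[OF Ck_on_has_derivative[OF Suc.prems(1) x] Ck_on_has_derivative[OF Suc.prems(2)]]
        assms(3) x by (auto simp: o_def)
    moreover have "?D f (g x) (?D g x v) = (\<Sum>b\<in>Basis. (?D g x v \<bullet> b) *\<^sub>R ?D f (g x) b)" for v
      using Ck_on_has_derivative[OF Suc.prems(2) assms(3)[OF x]] by (rule has_derivative_Basis)
    ultimately show "((\<lambda>x. f (g x)) has_derivative (\<lambda>v. (\<Sum>b\<in>Basis. (?D g x v \<bullet> b) *\<^sub>R ?D f (g x) b))) (at x)"
      by simp
  next
    fix v
    show "Ck_on k S (\<lambda>x. (\<Sum>b\<in>Basis. (?D g x v \<bullet> b) *\<^sub>R ?D f (g x) b))"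
    proof (intro Ck_on_sum[OF assms(1)] bounded_bilinear.Ck_on_bilinear[OF bounded_bilinear_scaleR assms(1)])
      fix b :: 'b
      show "Ck_on k S (\<lambda>x. ?D g x v \<bullet> b)"
        using Suc.prems(1) by (intro Ck_on_bounded_linear_comp[OF bounded_linear_inner_left assms(1)]) auto
      show "Ck_on k S (\<lambda>x. ?D f (g x) b)"
        by (rule Suc.IH) (use Suc.prems Ck_on_SucD in auto)
    qed
  qed
qed

section \<open>Smooth maps: closure properties and derivatives\<close>

lemma smooth_on_cong:
  "open S \<Longrightarrow> (\<And>x. x \<in> S \<Longrightarrow> f x = g x) \<Longrightarrow> smooth_on S f \<Longrightarrow> smooth_on S g"
  unfolding smooth_on_def by (auto intro: Ck_on_cong)

lemma smooth_on_subset: "smooth_on S f \<Longrightarrow> T \<subseteq> S \<Longrightarrow> smooth_on T f"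
  unfolding smooth_on_def by (auto intro: Ck_on_subset)

lemma smooth_on_local:
  assumes "\<And>x. x \<in> S \<Longrightarrow> \<exists>T. open T \<and> x \<in> T \<and> smooth_on T f"
  shows "smooth_on S f"
  unfolding smooth_on_def
proof (intro allI Ck_on_local)
  fix k x assume "x \<in> S"
  then show "\<exists>T. open T \<and> x \<in> T \<and> Ck_on k T f" using assms unfolding smooth_on_def by meson
qed

lemma smooth_on_const: "open S \<Longrightarrow> smooth_on S (\<lambda>x. c)"
  unfolding smooth_on_def by (auto intro: Ck_on_const)

lemma smooth_on_bounded_linear: "bounded_linear h \<Longrightarrow> open S \<Longrightarrow> smooth_on S h"
  unfolding smooth_on_def by (auto intro: Ck_on_bounded_linear)

lemma smooth_on_bounded_linear_comp:
  "bounded_linear h \<Longrightarrow> open S \<Longrightarrow> smooth_on S f \<Longrightarrow> smooth_on S (\<lambda>x. h (f x))"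
  unfolding smooth_on_def by (auto intro: Ck_on_bounded_linear_comp)

lemma smooth_on_add: "open S \<Longrightarrow> smooth_on S f \<Longrightarrow> smooth_on S g \<Longrightarrow> smooth_on S (\<lambda>x. f x + g x)"
  unfolding smooth_on_def by (auto intro: Ck_on_add)

lemma smooth_on_sum:
  "open S \<Longrightarrow> (\<And>i. i \<in> I \<Longrightarrow> smooth_on S (f i)) \<Longrightarrow> smooth_on S (\<lambda>x. \<Sum>i\<in>I. f i x)"
  unfolding smooth_on_def by (auto intro: Ck_on_sum)

lemma (in bounded_bilinear) smooth_on_bilinear:
  "open S \<Longrightarrow> smooth_on S f \<Longrightarrow> smooth_on S g \<Longrightarrow> smooth_on S (\<lambda>x. prod (f x) (g x))"
  unfolding smooth_on_def by (auto intro: Ck_on_bilinear)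

lemmas smooth_on_scaleR = bounded_bilinear.smooth_on_bilinear[OF bounded_bilinear_scaleR]
lemmas smooth_on_mult = bounded_bilinear.smooth_on_bilinear[OF bounded_bilinear_mult]
lemmas smooth_on_minus = smooth_on_bounded_linear_comp[OF bounded_linear_minus[OF bounded_linear_ident]]

lemma smooth_on_diff:
  "open S \<Longrightarrow> smooth_on S f \<Longrightarrow> smooth_on S g \<Longrightarrow> smooth_on S (\<lambda>x. f x - g x)"
  using smooth_on_add[of S f "\<lambda>x. - g x"] smooth_on_minus[of S g] by simp

lemma smooth_on_compose:
  fixes f :: "'b::euclidean_space \<Rightarrow> 'c::real_normed_vector"
  shows "open S \<Longrightarrow> open T \<Longrightarrow> (\<And>x. x \<in> S \<Longrightarrow> g x \<in> T) \<Longrightarrow> smooth_on S g \<Longrightarrow> smooth_on T f \<Longrightarrow>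
    smooth_on S (\<lambda>x. f (g x))"
  unfolding smooth_on_def by (auto intro: Ck_on_compose)

lemma smooth_on_Pair:
  assumes "open S" "smooth_on S f" "smooth_on S g"
  shows "smooth_on S (\<lambda>x. (f x, g x))"
proof -
  have "smooth_on S (\<lambda>x. (f x, 0) + (0, g x))"
    by (intro smooth_on_add assms(1)
        smooth_on_bounded_linear_comp[OF bounded_linear_Pair[OF bounded_linear_ident bounded_linear_zero] assms(1,2)]
        smooth_on_bounded_linear_comp[OF bounded_linear_Pair[OF bounded_linear_zero bounded_linear_ident] assms(1,3)])
  then show ?thesis by simp
qed

lemma smooth_on_vec:
  assumes "open S" "\<And>i. smooth_on S (\<lambda>x. f x $ i)"
  shows "smooth_on S (f :: _ \<Rightarrow> 'b::euclidean_space ^ 'n)"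
proof -
  have "bounded_linear (\<lambda>y. axis i y :: 'b ^ 'n)" for i
    by (auto simp: linear_conv_bounded_linear[symmetric] linear_iff axis_def vec_eq_iff)
  from smooth_on_bounded_linear_comp[OF this assms(1)] assms(2)
  have "smooth_on S (\<lambda>x. \<Sum>i\<in>UNIV. (axis i (f x $ i) :: 'b ^ 'n))"
    by (intro smooth_on_sum assms(1)) blast
  moreover have "(\<Sum>i\<in>UNIV. (axis i (y $ i) :: 'b ^ 'n)) = y" for y
    by (simp add: vec_eq_iff axis_def if_distrib sum.delta cong: if_cong)
  ultimately show ?thesis by simp
qed

lemma smooth_on_has_derivative:
  "smooth_on S f \<Longrightarrow> x \<in> S \<Longrightarrow> (f has_derivative frechet_derivative f (at x)) (at x)"
  unfolding smooth_on_def by (auto intro: Ck_on_has_derivative)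

lemma smooth_on_derivative: "smooth_on S f \<Longrightarrow> smooth_on S (\<lambda>x. frechet_derivative f (at x) v)"
  unfolding smooth_on_def
proof (intro allI)
  fix k assume "\<forall>k. Ck_on k S f"
  then have "Ck_on (Suc k) S f" by blast
  then show "Ck_on k S (\<lambda>x. frechet_derivative f (at x) v)" by simp
qed

lemma smooth_on_continuous: "smooth_on S f \<Longrightarrow> continuous_on S f"
  unfolding smooth_on_def by (auto intro: Ck_on_continuous)

lemma smooth_on_derivative_along:
  assumes "open S" "smooth_on S f" "smooth_on S g"
  shows "smooth_on S (\<lambda>x. frechet_derivative f (at x) (g x))"
proof -
  have "smooth_on S (\<lambda>x. \<Sum>b\<in>Basis. (g x \<bullet> b) *\<^sub>R frechet_derivative f (at x) b)"
    using smooth_on_derivative[OF assms(2)]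
      smooth_on_bounded_linear_comp[OF bounded_linear_inner_left assms(1,3)]
    by (auto intro!: smooth_on_sum smooth_on_scaleR assms(1))
  then show ?thesis
    by (rule smooth_on_cong[OF assms(1), rotated])
      (rule has_derivative_Basis[OF smooth_on_has_derivative[OF assms(2)], symmetric])
qed

text \<open>The operators have a finite-dimensional domain, so \<open>F x\<close> is a finite sum of
  rank one operators built from the vectors \<open>F x b\<close>, and pointwise regularity becomes
  regularity in the operator norm.\<close>

lemma Ck_on_blinfun:
  fixes F :: "'a::euclidean_space \<Rightarrow> 'b::euclidean_space \<Rightarrow>\<^sub>L 'c::real_normed_vector"
  assumes "open S" "\<And>v. Ck_on k S (\<lambda>x. F x v)"
  shows "Ck_on k S F"
proof -
  have eq: "F x = (\<Sum>b\<in>Basis. blinfun_scaleR_left (F x b) o\<^sub>L blinfun_inner_left b)" for x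
  proof (rule blinfun_eqI)
    fix v
    have "F x v = F x (\<Sum>b\<in>Basis. (v \<bullet> b) *\<^sub>R b)" by (simp add: euclidean_representation)
    also have "\<dots> = (\<Sum>b\<in>Basis. (v \<bullet> b) *\<^sub>R F x b)" by (simp add: blinfun.sum_right blinfun.scaleR_right)
    finally show "F x v = (\<Sum>b\<in>Basis. blinfun_scaleR_left (F x b) o\<^sub>L blinfun_inner_left b) v"
      by (simp add: blinfun.sum_left blinfun_inner_left.rep_eq)
  qed
  have C: "Ck_on k S (\<lambda>x. (\<Sum>b\<in>Basis. blinfun_scaleR_left (F x b) o\<^sub>L blinfun_inner_left b))"
    by (intro Ck_on_sum assms(1) bounded_bilinear.Ck_on_bilinear[OF bounded_bilinear_blinfun_compose]
        Ck_on_const Ck_on_bounded_linear_comp[OF bounded_linear_blinfun_scaleR_left] assms(2))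
  show ?thesis by (rule Ck_on_cong[OF assms(1) eq[symmetric] C])
qed

text \<open>The derivative of an inverse, $M' = - M K' M$, has the regularity of $M$ and $K'$.\<close>

lemma Ck_on_blinfun_inverse:
  fixes K :: "'a::euclidean_space \<Rightarrow> 'b::real_normed_vector \<Rightarrow>\<^sub>L 'c::real_normed_vector"
    and M :: "'a \<Rightarrow> 'c \<Rightarrow>\<^sub>L 'b"
  assumes S: "open S" and K: "Ck_on k S K"
    and MK: "\<And>x. x \<in> S \<Longrightarrow> M x o\<^sub>L K x = id_blinfun"
    and KM: "\<And>x. x \<in> S \<Longrightarrow> K x o\<^sub>L M x = id_blinfun"
  shows "Ck_on k S M"
proof -
  \<comment> \<open>The resolvent identity, which reduces every estimate of \<open>M\<close> to one
    of \<open>K\<close>.\<close>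
  have id1: "M y - M x = - (M y o\<^sub>L (K y - K x) o\<^sub>L M x)" if "x \<in> S" "y \<in> S" for x y
  proof (rule blinfun_eqI)
    fix v
    have 1: "M y (K y w) = w" for w using MK[OF that(2)] by (metis blinfun_apply_blinfun_compose blinfun_apply_id_blinfun)
    have 2: "K x (M x w) = w" for w using KM[OF that(1)] by (metis blinfun_apply_blinfun_compose blinfun_apply_id_blinfun)
    show "(M y - M x) v = (- (M y o\<^sub>L (K y - K x) o\<^sub>L M x)) v"
      by (simp add: blinfun.bilinear_simps 1 2)
  qed
  \<comment> \<open>No bound for \<open>M\<close> near \<open>x\<close> is given in advance. The
    identity estimates \<open>norm (M y)\<close> by \<open>norm (M x)\<close> plus at most half of
    \<open>norm (M y)\<close>, which is absorbed.\<close>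
  have bd: "norm (M y) \<le> 2 * norm (M x)"
    if "x \<in> S" "y \<in> S" "norm (K y - K x) * norm (M x) \<le> 1/2" for x y
  proof -
    have "norm (M y) \<le> norm (M x) + norm (M y - M x)" by (metis add.commute diff_add_cancel norm_triangle_ineq)
    also have "norm (M y - M x) \<le> norm (M y) * norm (K y - K x) * norm (M x)"
      unfolding id1[OF that(1,2)] norm_minus_cancel
      by (meson mult_right_mono norm_blinfun_compose norm_ge_zero order_trans)
    also have "\<dots> \<le> norm (M y) * (1/2)"
      using mult_left_mono[OF that(3), of "norm (M y)"] by (simp add: mult.assoc)
    finally show ?thesis by simp
  qed
  have cont: "continuous_on S M" if contK: "continuous_on S K"
  proof -
    have "(M \<longlongrightarrow> M x) (at x)" if x: "x \<in> S" for x
    proof -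
      have t0: "((\<lambda>y. norm (K y - K x) * norm (M x)) \<longlongrightarrow> 0) (at x)"
        using contK S x by (auto intro!: tendsto_mult_left_zero tendsto_norm_zero
            simp: continuous_on_eq_continuous_at continuous_at LIM_zero)
      have "eventually (\<lambda>y. norm (K y - K x) * norm (M x) < 1/2) (at x)"
        using order_tendstoD(2)[OF t0, of "1/2"] by simp
      moreover have "eventually (\<lambda>y. y \<in> S) (at x)" using S x by (rule eventually_at_in_open')
      ultimately have "eventually (\<lambda>y. norm (M y - M x) \<le> 2 * norm (M x) * (norm (K y - K x) * norm (M x))) (at x)"
      proof eventually_elim
        case (elim y)
        have "norm (M y - M x) \<le> norm (M y) * norm (K y - K x) * norm (M x)"
          unfolding id1[OF x elim(2)] norm_minus_cancel
          by (meson mult_right_mono norm_blinfun_compose norm_ge_zero order_trans)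
        also have "\<dots> \<le> 2 * norm (M x) * norm (K y - K x) * norm (M x)"
          using bd[OF x elim(2)] elim(1) by (intro mult_right_mono) auto
        finally show ?case by (simp add: mult.assoc)
      qed
      moreover have "((\<lambda>y. 2 * norm (M x) * (norm (K y - K x) * norm (M x))) \<longlongrightarrow> 0) (at x)"
        using tendsto_mult_right_zero[OF t0] .
      ultimately have "((\<lambda>y. M y - M x) \<longlongrightarrow> 0) (at x)"
        by (rule Lim_null_comparison)
      then show ?thesis by (simp add: LIM_zero_iff)
    qed
    then show ?thesis by (simp add: continuous_on_eq_continuous_at S continuous_at)
  qed
  show ?thesis using K
  proof (induction k)
    case 0
    then show ?case using cont by simp
  next
    case (Suc k)
    have contM: "continuous_on S M" using cont Ck_on_continuous[OF Suc.prems] .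
    let ?K' = "\<lambda>x. frechet_derivative K (at x)"
    show ?case
    proof (rule Ck_on_SucI[OF S])
      fix x assume x: "x \<in> S"
      have dK: "(K has_derivative ?K' x) (at x)" using Ck_on_has_derivative[OF Suc.prems x] .
      have tM: "(M \<longlongrightarrow> M x) (at x)" using contM S x by (simp add: continuous_on_eq_continuous_at continuous_at)
      have "bounded_linear (\<lambda>v. M x o\<^sub>L ?K' x v o\<^sub>L M x)"
        by (intro bounded_linear_intros has_derivative_bounded_linear[OF dK])
      then have bl: "bounded_linear (\<lambda>v. - (M x o\<^sub>L ?K' x v o\<^sub>L M x))" by (rule bounded_linear_minus)
      \<comment> \<open>The difference quotient of \<open>K\<close> is split into \<open>?R\<close>,
        which tends to zero, and \<open>?Q\<close>, which is merely bounded. In the remainder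
        \<open>?Q\<close> is multiplied by \<open>M y - M x\<close>, which tends to zero by
        continuity.\<close>
      let ?R = "\<lambda>y. (K y - K x - ?K' x (y - x)) /\<^sub>R norm (y - x)"
      let ?Q = "\<lambda>y. ?K' x (y - x) /\<^sub>R norm (y - x)"
      have R: "(?R \<longlongrightarrow> 0) (at x)" using dK by (simp add: has_derivative_at_within)
      obtain B where B: "\<And>v. norm (?K' x v) \<le> norm v * B" using bounded_linear.bounded[OF has_derivative_bounded_linear[OF dK]] by blast
      have QB: "norm (?Q y) \<le> \<bar>B\<bar>" for y
      proof (cases "y = x")
        case False
        then show ?thesis using order_trans[OF B[of "y - x"] mult_left_mono[OF abs_ge_self[of B] norm_ge_zero]] by (simp add: field_simps)
      qed simp
      have "((\<lambda>y. (M y - M x) o\<^sub>L ?Q y) \<longlongrightarrow> 0) (at x)"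
      proof (rule Lim_null_comparison)
        show "((\<lambda>y. norm (M y - M x) * \<bar>B\<bar>) \<longlongrightarrow> 0) (at x)"
          using tM by (intro tendsto_mult_left_zero tendsto_norm_zero) (simp add: LIM_zero)
        show "\<forall>\<^sub>F y in at x. norm ((M y - M x) o\<^sub>L ?Q y) \<le> norm (M y - M x) * \<bar>B\<bar>"
          using QB by (intro always_eventually allI order_trans[OF norm_blinfun_compose] mult_left_mono) auto
      qed
      moreover have "((\<lambda>y. M y o\<^sub>L ?R y) \<longlongrightarrow> M x o\<^sub>L 0) (at x)"
        by (intro tendsto_intros tM R)
      ultimately have sum: "((\<lambda>y. (M y o\<^sub>L ?R y) + ((M y - M x) o\<^sub>L ?Q y)) \<longlongrightarrow> (M x o\<^sub>L 0) + 0) (at x)"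
        by (rule tendsto_add[rotated])
      then have "((\<lambda>y. - (((M y o\<^sub>L ?R y) + ((M y - M x) o\<^sub>L ?Q y)) o\<^sub>L M x)) \<longlongrightarrow> - (((M x o\<^sub>L 0) + 0) o\<^sub>L M x)) (at x)"
        by (intro tendsto_minus bounded_bilinear.tendsto[OF bounded_bilinear_blinfun_compose sum tendsto_const])
      then have lim: "((\<lambda>y. - (((M y o\<^sub>L ?R y) + ((M y - M x) o\<^sub>L ?Q y)) o\<^sub>L M x)) \<longlongrightarrow> 0) (at x)"
        by (simp add: blinfun_compose_zero)
      have "((\<lambda>y. (M y - M x - (- (M x o\<^sub>L ?K' x (y - x) o\<^sub>L M x))) /\<^sub>R norm (y - x)) \<longlongrightarrow> 0) (at x)"
      proof (rule Lim_transform_within_open[OF lim S x])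
        fix y assume "y \<in> S" "y \<noteq> x"
        show "- (((M y o\<^sub>L ?R y) + ((M y - M x) o\<^sub>L ?Q y)) o\<^sub>L M x)
          = (M y - M x - (- (M x o\<^sub>L ?K' x (y - x) o\<^sub>L M x))) /\<^sub>R norm (y - x)"
          by (subst (2) id1[OF x \<open>y \<in> S\<close>]) (auto intro!: blinfun_eqI simp: blinfun.bilinear_simps algebra_simps)
      qed
      then show "(M has_derivative (\<lambda>v. - (M x o\<^sub>L ?K' x v o\<^sub>L M x))) (at x)"
        using bl by (simp add: has_derivative_at_within)
    next
      fix v
      have M: "Ck_on k S M" using Suc.IH Ck_on_SucD[OF Suc.prems] .
      show "Ck_on k S (\<lambda>x. - (M x o\<^sub>L ?K' x v o\<^sub>L M x))"
        by (intro Ck_on_bounded_linear_comp[OF bounded_linear_minus[OF bounded_linear_ident] S]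
            bounded_bilinear.Ck_on_bilinear[OF bounded_bilinear_blinfun_compose S] M)
          (use Suc.prems in simp)
    qed
  qed
qed

text \<open>The inverse function theorem provides \<open>g\<close> with derivative the inverse of
  \<open>f' (g y)\<close>. If \<open>g\<close> is of class \<open>k\<close>, so is \<open>f'\<close>
  composed with \<open>g\<close>, hence its pointwise inverse, hence the derivative of
  \<open>g\<close>.\<close>

theorem smooth_inverse_function:
  fixes f :: "'a::euclidean_space \<Rightarrow> 'a"
  assumes U: "open U" "x0 \<in> U" and f: "smooth_on U f" and inj: "inj (frechet_derivative f (at x0))"
  obtains U' V g where "open U'" "U' \<subseteq> U" "x0 \<in> U'" "open V" "f x0 \<in> V" "homeomorphism U' V f g"
    "smooth_on V g"
proof -
  define f' where "f' x = Blinfun (frechet_derivative f (at x))" for x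
  have f': "blinfun_apply (f' x) = frechet_derivative f (at x)" if "x \<in> U" for x
    unfolding f'_def using smooth_on_has_derivative[OF f that]
    by (simp add: bounded_linear_Blinfun_apply has_derivative_bounded_linear)
  have Ckf': "Ck_on k U f'" for k
  proof (rule Ck_on_blinfun[OF U(1)])
    fix v show "Ck_on k U (\<lambda>x. blinfun_apply (f' x) v)"
      by (rule Ck_on_cong[OF U(1), of "\<lambda>x. frechet_derivative f (at x) v"])
        (use f' smooth_on_derivative[OF f] in \<open>auto simp: smooth_on_def\<close>)
  qed
  have lin: "linear (f' x0)" by (simp add: bounded_linear.linear blinfun.bounded_linear_right)
  moreover have "inj (f' x0)" using inj f'[OF U(2)] by simp
  ultimately obtain h where h: "linear h" "h \<circ> f' x0 = id"
    using linear_injective_left_inverse by metis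
  have "Blinfun h o\<^sub>L f' x0 = id_blinfun"
    using h(2) by (intro blinfun_eqI)
      (simp add: bounded_linear_Blinfun_apply linear_conv_bounded_linear[symmetric] h(1) fun_eq_iff)
  then obtain U' V g g' where g: "open U'" "U' \<subseteq> U" "x0 \<in> U'" "open V" "f x0 \<in> V" "homeomorphism U' V f g"
    and dg: "\<And>y. y \<in> V \<Longrightarrow> (g has_derivative (g' y)) (at y)"
    and g': "\<And>y. y \<in> V \<Longrightarrow> g' y = inv (blinfun_apply (f' (g y)))"
    and bij: "\<And>y. y \<in> V \<Longrightarrow> bij (blinfun_apply (f' (g y)))"
    using inverse_function_theorem[OF U(1), of f f' x0 "Blinfun h"] f' U(2) smooth_on_has_derivative[OF f]
      Ck_on_continuous[OF Ckf'] by metis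
  have gU: "g y \<in> U" if "y \<in> V" for y using g(2,6) that by (auto simp: homeomorphism_def)
  define M where "M y = Blinfun (g' y)" for y
  have M: "blinfun_apply (M y) = g' y" if "y \<in> V" for y
    unfolding M_def using dg[OF that] by (simp add: bounded_linear_Blinfun_apply has_derivative_bounded_linear)
  have "Ck_on k V g" for k
  proof (induction k)
    case 0
    then show ?case using g(6) by (simp add: homeomorphism_def)
  next
    case (Suc k)
    have "Ck_on k V (\<lambda>y. f' (g y))"
      by (rule Ck_on_compose[OF g(4) U(1) gU Suc Ckf'])
    then have CM: "Ck_on k V M"
    proof (rule Ck_on_blinfun_inverse[OF g(4)])
      fix y assume y: "y \<in> V"
      show "M y o\<^sub>L f' (g y) = id_blinfun"
        by (rule blinfun_eqI) (simp add: M[OF y] g'[OF y] inv_f_f bij_is_inj[OF bij[OF y]])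
      show "f' (g y) o\<^sub>L M y = id_blinfun"
        by (rule blinfun_eqI) (simp add: M[OF y] g'[OF y] surj_f_inv_f bij_is_surj[OF bij[OF y]])
    qed
    show ?case
    proof (rule Ck_on_SucI[OF g(4)])
      show "(g has_derivative blinfun_apply (M y)) (at y)" if "y \<in> V" for y using dg[OF that] M[OF that] by simp
      show "Ck_on k V (\<lambda>y. blinfun_apply (M y) v)" for v
        by (rule Ck_on_bounded_linear_comp[OF _ g(4) CM]) auto
    qed
  qed
  then show ?thesis using that g unfolding smooth_on_def by blast
qed

section \<open>Symmetry of second derivatives\<close>

text \<open>Both mixed derivatives are approximated by the same second difference quotient.\<close>

lemma second_difference_bound:
  fixes f :: "'a::euclidean_space \<Rightarrow> 'b::real_normed_vector"
  assumes f: "\<And>y. y \<in> ball x d \<Longrightarrow> (f has_derivative f' y) (at y)"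
    and f': "\<And>y. y \<in> ball x d \<Longrightarrow> ((\<lambda>y. f' y w) has_derivative f'' y) (at y)"
    and c: "\<And>y. y \<in> ball x d \<Longrightarrow> norm (f'' y v - f'' x v) \<le> e"
    and s: "0 \<le> s" "s * (norm v + norm w) < d"
  shows "norm (f (x + s *\<^sub>R v + s *\<^sub>R w) - f (x + s *\<^sub>R v) - f (x + s *\<^sub>R w) + f x
    - (s * s) *\<^sub>R f'' x v) \<le> s * s * e"
proof -
  have inb: "x + \<sigma> *\<^sub>R v + t *\<^sub>R w \<in> ball x d" if "\<sigma> \<in> {0..s}" "t \<in> {0..s}" for \<sigma> t
  proof -
    have "norm (\<sigma> *\<^sub>R v + t *\<^sub>R w) \<le> \<sigma> * norm v + t * norm w"
      using that norm_triangle_ineq[of "\<sigma> *\<^sub>R v" "t *\<^sub>R w"] by simp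
    also have "\<dots> \<le> s * norm v + s * norm w"
      using that by (intro add_mono mult_right_mono) auto
    finally show ?thesis using s by (simp add: dist_norm norm_minus_commute algebra_simps)
  qed
  have inner: "norm (f' (x + s *\<^sub>R v + t *\<^sub>R w) w - f' (x + t *\<^sub>R w) w - s *\<^sub>R f'' x v) \<le> s * e" if t: "t \<in> {0..s}" for t
  proof -
    \<comment> \<open>The mean value estimate is used twice, each time after subtracting the
      expected linear part: here along \<open>v\<close> for the first derivative, and below along
      \<open>w\<close> for \<open>?h\<close>.\<close>
    let ?g = "\<lambda>\<sigma>. f' (x + \<sigma> *\<^sub>R v + t *\<^sub>R w) w - \<sigma> *\<^sub>R f'' x v"
    have "norm (?g s - ?g 0) \<le> e * norm (s - 0)"
    proof (rule differentiable_bound[of "{0..s}"])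
      fix \<sigma> assume \<sigma>: "\<sigma> \<in> {0..s}"
      let ?y = "x + \<sigma> *\<^sub>R v + t *\<^sub>R w"
      have l: "linear (f'' ?y)" using f'[OF inb[OF \<sigma> t]] has_derivative_linear by blast
      have "((\<lambda>\<sigma>. x + \<sigma> *\<^sub>R v + t *\<^sub>R w) has_derivative (\<lambda>r. r *\<^sub>R v)) (at \<sigma>)"
        by (auto intro!: derivative_eq_intros)
      from diff_chain_at[OF this f'[OF inb[OF \<sigma> t]]]
      have "((\<lambda>\<sigma>. f' (x + \<sigma> *\<^sub>R v + t *\<^sub>R w) w) has_derivative (\<lambda>r. r *\<^sub>R f'' ?y v)) (at \<sigma>)"
        using l by (simp add: o_def linear_scale)
      then have "(?g has_derivative (\<lambda>r. r *\<^sub>R (f'' ?y v - f'' x v))) (at \<sigma>)"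
        by (auto intro!: derivative_eq_intros simp: algebra_simps)
      then show "(?g has_derivative (\<lambda>r. r *\<^sub>R (f'' ?y v - f'' x v))) (at \<sigma> within {0..s})"
        by (rule has_derivative_at_withinI)
      show "onorm (\<lambda>r. r *\<^sub>R (f'' ?y v - f'' x v)) \<le> e"
        using c[OF inb[OF \<sigma> t]] by (intro onorm_le) (auto simp: mult.commute[of e] mult.commute[of "s * e"] intro!: mult_left_mono)
    qed (use s in auto)
    then show ?thesis using s by (simp add: algebra_simps)
  qed
  let ?h = "\<lambda>t. f (x + s *\<^sub>R v + t *\<^sub>R w) - f (x + t *\<^sub>R w) - t *\<^sub>R s *\<^sub>R f'' x v"
  have "norm (?h s - ?h 0) \<le> (s * e) * norm (s - 0)"
  proof (rule differentiable_bound[of "{0..s}"])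
    fix t assume t: "t \<in> {0..s}"
    have 1: "((\<lambda>t. f (x + \<sigma> *\<^sub>R v + t *\<^sub>R w)) has_derivative (\<lambda>r. r *\<^sub>R f' (x + \<sigma> *\<^sub>R v + t *\<^sub>R w) w)) (at t)"
      if \<sigma>: "\<sigma> \<in> {0..s}" for \<sigma>
    proof -
      have d: "((\<lambda>t. x + \<sigma> *\<^sub>R v + t *\<^sub>R w) has_derivative (\<lambda>r. r *\<^sub>R w)) (at t)"
        by (auto intro!: derivative_eq_intros)
      show ?thesis using diff_chain_at[OF d f[OF inb[OF \<sigma> t]]] has_derivative_linear[OF f[OF inb[OF \<sigma> t]]]
        by (simp add: o_def linear_scale)
    qed
    have "(?h has_derivative (\<lambda>r. r *\<^sub>R (f' (x + s *\<^sub>R v + t *\<^sub>R w) w - f' (x + t *\<^sub>R w) w - s *\<^sub>R f'' x v))) (at t)"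
      using 1[of s] 1[of 0] s by (auto intro!: derivative_eq_intros simp: algebra_simps)
    then show "(?h has_derivative (\<lambda>r. r *\<^sub>R (f' (x + s *\<^sub>R v + t *\<^sub>R w) w - f' (x + t *\<^sub>R w) w - s *\<^sub>R f'' x v))) (at t within {0..s})"
      by (rule has_derivative_at_withinI)
    show "onorm (\<lambda>r. r *\<^sub>R (f' (x + s *\<^sub>R v + t *\<^sub>R w) w - f' (x + t *\<^sub>R w) w - s *\<^sub>R f'' x v)) \<le> s * e"
      using inner[OF t] by (intro onorm_le) (auto simp: mult.commute[of e] mult.commute[of "s * e"] intro!: mult_left_mono)
  qed (use s in auto)
  moreover have "?h s - ?h 0 = f (x + s *\<^sub>R v + s *\<^sub>R w) - f (x + s *\<^sub>R v) - f (x + s *\<^sub>R w) + f x - (s * s) *\<^sub>R f'' x v"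
    by simp
  ultimately show ?thesis using s by (simp add: algebra_simps)
qed

lemma symmetric_second_derivative:
  fixes f :: "'a::euclidean_space \<Rightarrow> 'b::real_normed_vector"
  assumes S: "open S" "x \<in> S" and f: "Ck_on 2 S f"
  shows "frechet_derivative (\<lambda>y. frechet_derivative f (at y) w) (at x) v =
    frechet_derivative (\<lambda>y. frechet_derivative f (at y) v) (at x) w"
proof -
  let ?D = "\<lambda>w y. frechet_derivative (\<lambda>y. frechet_derivative f (at y) w) (at y)"
  have f: "Ck_on (Suc (Suc 0)) S f" using f by (simp only: numeral_2_eq_2)
  have fd: "(f has_derivative frechet_derivative f (at y)) (at y)" if "y \<in> S" for y
    using Ck_on_has_derivative[OF f that] .
  have f1: "Ck_on (Suc 0) S (\<lambda>y. frechet_derivative f (at y) w)" for w using f by (metis Ck_on.simps(2))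
  have f2: "((\<lambda>y. frechet_derivative f (at y) w) has_derivative ?D w y) (at y)" if "y \<in> S" for w y
    using Ck_on_has_derivative[OF f1 that] .
  have cont: "continuous_on S (\<lambda>y. ?D w y v)" for v w using f1[of w] by simp
  have "norm (?D w x v - ?D v x w) \<le> 0"
  proof (rule field_le_epsilon)
    fix e :: real assume e: "0 < e"
    have "\<exists>d>0. ball x d \<subseteq> S \<and> (\<forall>y\<in>ball x d. norm (?D w y v - ?D w x v) \<le> e/2)" for v w
    proof -
      obtain d1 where d1: "d1 > 0" "ball x d1 \<subseteq> S" using S open_contains_ball by blast
      obtain d2 where d2: "d2 > 0" "\<And>y. y \<in> S \<Longrightarrow> dist y x < d2 \<Longrightarrow> dist (?D w y v) (?D w x v) < e/2"
        using cont[of w v] S(2) e unfolding continuous_on_iff by (metis half_gt_zero)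
      show ?thesis
        by (rule exI[of _ "min d1 d2"]) (use d1 d2 in \<open>force simp: dist_norm norm_minus_commute less_imp_le subset_iff\<close>)
    qed
    then obtain d1 d2 where d1: "d1 > 0" "ball x d1 \<subseteq> S" "\<forall>y\<in>ball x d1. norm (?D w y v - ?D w x v) \<le> e/2"
      and d2: "d2 > 0" "ball x d2 \<subseteq> S" "\<forall>y\<in>ball x d2. norm (?D v y w - ?D v x w) \<le> e/2" by metis
    \<comment> \<open>Small enough that the parallelogram spanned by \<open>s *\<^sub>R v\<close>
      and \<open>s *\<^sub>R w\<close> lies in both balls; the summand 1 covers the case of two zero
      vectors.\<close>
    define s where "s = min d1 d2 / (2 * (norm v + norm w + 1))"
    have pos: "norm v + norm w + 1 > 0" by (smt (verit) norm_ge_zero)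
    have s: "s > 0" using d1(1) d2(1) pos by (simp add: s_def)
    have "s * (norm v + norm w) \<le> s * (norm v + norm w + 1)" using s by (intro mult_left_mono) auto
    also have "\<dots> = min d1 d2 / 2" using pos by (simp add: s_def field_simps)
    also have "\<dots> < min d1 d2" using d1(1) d2(1) by auto
    finally have sd: "s * (norm v + norm w) < d1" "s * (norm w + norm v) < d2" by (auto simp: add.commute)
    let ?\<Delta> = "f (x + s *\<^sub>R v + s *\<^sub>R w) - f (x + s *\<^sub>R v) - f (x + s *\<^sub>R w) + f x"
    have A: "norm (?\<Delta> - (s * s) *\<^sub>R ?D w x v) \<le> s * s * (e/2)"
      by (rule second_difference_bound[of x d1 f "\<lambda>y. frechet_derivative f (at y)"])
        (use d1 fd f2 s sd in auto)
    have B: "norm (f (x + s *\<^sub>R w + s *\<^sub>R v) - f (x + s *\<^sub>R w) - f (x + s *\<^sub>R v) + f x - (s * s) *\<^sub>R ?D v x w) \<le> s * s * (e/2)"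
      by (rule second_difference_bound[of x d2 f "\<lambda>y. frechet_derivative f (at y)"])
        (use d2 fd f2 s sd in auto)
    have B': "f (x + s *\<^sub>R w + s *\<^sub>R v) - f (x + s *\<^sub>R w) - f (x + s *\<^sub>R v) + f x = ?\<Delta>"
      by (simp add: algebra_simps)
    have "(s * s) *\<^sub>R (?D w x v - ?D v x w) = (?\<Delta> - (s * s) *\<^sub>R ?D v x w) - (?\<Delta> - (s * s) *\<^sub>R ?D w x v)"
      by (simp add: algebra_simps)
    then have "norm ((s * s) *\<^sub>R (?D w x v - ?D v x w)) \<le> s * s * (e/2) + s * s * (e/2)"
      using A B norm_triangle_ineq4 unfolding B' by (smt (verit))
    then have "(s * s) * norm (?D w x v - ?D v x w) \<le> (s * s) * e" by (simp add: mult.commute)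
    moreover have "s * s > 0" using s by simp
    ultimately show "norm (?D w x v - ?D v x w) \<le> 0 + e" by (simp only: mult_le_cancel_left_pos add_0)
  qed
  then show ?thesis by simp
qed

section \<open>Smooth flows\<close>

lemma apply_Bcontfun:
  "continuous_on UNIV f \<Longrightarrow> (\<And>x. norm (f x) \<le> b) \<Longrightarrow> apply_bcontfun (Bcontfun f) = f"
  by (rule Bcontfun_inverse) (rule bcontfun_normI)

lemma bounded_linear_apply_bcontfun: "bounded_linear (\<lambda>f. apply_bcontfun f s)"
  by (rule bounded_linear_intro[where K = 1]) (auto intro: norm_bounded)

lemma apply_bcontfun_sum: "apply_bcontfun (\<Sum>i\<in>I. f i) s = (\<Sum>i\<in>I. apply_bcontfun (f i) s)"
  using linear_sum[OF bounded_linear.linear[OF bounded_linear_apply_bcontfun]] by blast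

lemma bounded_linear_const_bcontfun: "bounded_linear const_bcontfun"
  by (rule bounded_linear_intro[where K = 1]) (auto intro: norm_bound intro!: bcontfun_eqI)

definition pointwise :: "('b \<Rightarrow> 'c \<Rightarrow> 'd) \<Rightarrow> ('a::topological_space \<Rightarrow>\<^sub>C 'b::real_normed_vector)
    \<Rightarrow> ('a \<Rightarrow>\<^sub>C 'c::real_normed_vector) \<Rightarrow> ('a \<Rightarrow>\<^sub>C 'd::real_normed_vector)" where
  "pointwise p f g = Bcontfun (\<lambda>x. p (f x) (g x))"

lemma apply_pointwise:
  assumes "bounded_bilinear p"
  shows "pointwise p f g x = p (f x) (g x)"
proof -
  obtain K where K: "0 \<le> K" "\<And>a b. norm (p a b) \<le> norm a * norm b * K"
    using bounded_bilinear.nonneg_bounded[OF assms] by blast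
  have "norm (p (f x) (g x)) \<le> norm f * norm g * K" for x
    by (rule order_trans[OF K(2)]) (intro mult_mono norm_bounded K mult_nonneg_nonneg norm_ge_zero order_refl)
  then show ?thesis unfolding pointwise_def
    by (subst apply_Bcontfun) (auto intro!: bounded_bilinear.continuous_on[OF assms])
qed

lemma bounded_bilinear_pointwise:
  assumes "bounded_bilinear p"
  shows "bounded_bilinear (pointwise p)"
proof -
  interpret bounded_bilinear p by fact
  obtain K where K: "0 \<le> K" "\<And>a b. norm (p a b) \<le> norm a * norm b * K" using nonneg_bounded by blast
  show ?thesis
  proof
    have "norm (pointwise p f g) \<le> norm f * norm g * K" for f :: "'d \<Rightarrow>\<^sub>C 'a" and g
      by (rule norm_bound, subst apply_pointwise[OF assms], rule order_trans[OF K(2)])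
        (intro mult_mono norm_bounded K mult_nonneg_nonneg norm_ge_zero order_refl)
    then show "\<exists>K. \<forall>(f :: 'd \<Rightarrow>\<^sub>C 'a) g. norm (pointwise p f g) \<le> norm f * norm g * K" by blast
  qed (auto intro!: bcontfun_eqI simp: apply_pointwise[OF assms] add_left add_right scaleR_left scaleR_right)
qed

text \<open>The superposition (Nemytskii) operator. \<open>Bcontfun\<close> is meaningful only on
  bounded continuous functions; confining the paths to a compact set on which \<open>f\<close> is
  continuous ensures this.\<close>

definition superpose :: "('b \<Rightarrow> 'c) \<Rightarrow> ('a::topological_space \<Rightarrow>\<^sub>C 'b::metric_space) \<Rightarrow> ('a \<Rightarrow>\<^sub>C 'c::metric_space)" where
  "superpose f \<phi> = Bcontfun (\<lambda>s. f (\<phi> s))"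

lemma apply_superpose:
  assumes "continuous_on K f" "compact K" "\<And>s. apply_bcontfun \<phi> s \<in> K"
  shows "superpose f \<phi> s = f (\<phi> s)"
proof -
  have "(\<lambda>s. f (\<phi> s)) \<in> bcontfun"
    unfolding bcontfun_def
    using continuous_on_compose2[OF assms(1), of UNIV "apply_bcontfun \<phi>"] assms(3)
      bounded_subset[OF compact_imp_bounded[OF compact_continuous_image[OF assms(1,2)]], of "range (\<lambda>s. f (\<phi> s))"]
    by auto
  then show ?thesis by (simp add: superpose_def Bcontfun_inverse)
qed

abbreviation comp_scale :: "'b::euclidean_space \<Rightarrow> 'b \<Rightarrow> 'c::real_normed_vector \<Rightarrow> 'c" where
  "comp_scale b \<equiv> (\<lambda>y z. (y \<bullet> b) *\<^sub>R z)"

lemma bounded_bilinear_comp_scale: "bounded_bilinear (comp_scale b)"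
  using bounded_bilinear.comp[OF bounded_bilinear_scaleR bounded_linear_inner_left bounded_linear_ident] .

text \<open>The derivative of the superposition operator at \<open>\<phi>\<close>. Written in the
  basis, its dependence on \<open>\<phi>\<close> is again by superposition, now with partial
  derivatives of \<open>f\<close>, followed by fixed bilinear maps.\<close>

definition superpose_deriv :: "('b::euclidean_space \<Rightarrow> 'c::real_normed_vector)
    \<Rightarrow> (real \<Rightarrow>\<^sub>C 'b) \<Rightarrow> (real \<Rightarrow>\<^sub>C 'b) \<Rightarrow> (real \<Rightarrow>\<^sub>C 'c)" where
  "superpose_deriv f \<phi> h =
    (\<Sum>b\<in>Basis. pointwise (comp_scale b) h (superpose (\<lambda>y. frechet_derivative f (at y) b) \<phi>))"

lemma bounded_linear_superpose_deriv: "bounded_linear (superpose_deriv f \<phi>)"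
  unfolding superpose_deriv_def
  by (intro bounded_linear_sum bounded_bilinear.bounded_linear_left bounded_bilinear_pointwise bounded_bilinear_comp_scale)

lemma apply_superpose_deriv:
  assumes f: "Ck_on 1 U f" and K: "compact K" "K \<subseteq> U" and \<phi>: "\<And>s. apply_bcontfun \<phi> s \<in> K"
  shows "superpose_deriv f \<phi> h s = frechet_derivative f (at (\<phi> s)) (h s)"
proof -
  have f: "Ck_on (Suc 0) U f" using f by (simp only: One_nat_def)
  have c: "continuous_on K (\<lambda>y. frechet_derivative f (at y) b)" for b
    using f K(2) by (auto intro: continuous_on_subset)
  have "(f has_derivative frechet_derivative f (at (\<phi> s))) (at (\<phi> s))"
    using Ck_on_has_derivative[OF f] \<phi> K(2) by blast
  from has_derivative_Basis[OF this, of "h s"] show ?thesis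
    by (simp add: superpose_deriv_def apply_bcontfun_sum apply_pointwise[OF bounded_bilinear_comp_scale]
        apply_superpose[OF c K(1) \<phi>])
qed

text \<open>The partial derivatives are uniformly continuous on the compact \<open>K\<close>, and
  convexity keeps segments inside. That \<open>d\<close> does not depend on \<open>y\<close> is what
  permits differentiation in the supremum norm.\<close>

lemma uniform_linearization:
  fixes f :: "'b::euclidean_space \<Rightarrow> 'c::real_normed_vector"
  assumes f: "Ck_on 1 U f" and K: "compact K" "convex K" "K \<subseteq> U" and e: "e > 0"
  obtains d where "d > 0"
    "\<And>y z. y \<in> K \<Longrightarrow> z \<in> K \<Longrightarrow> norm (z - y) < d \<Longrightarrow>
      norm (f z - f y - frechet_derivative f (at y) (z - y)) \<le> e * norm (z - y)"
proof -
  have f: "Ck_on (Suc 0) U f" using f by (simp only: One_nat_def)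
  let ?D = "\<lambda>y. frechet_derivative f (at y)"
  have fd: "(f has_derivative ?D y) (at y)" if "y \<in> K" for y
    using Ck_on_has_derivative[OF f] that K(3) by blast
  define e' where "e' = e / (real DIM('b))"
  have e': "e' > 0" using e by (simp add: e'_def)
  have "\<exists>d>0. \<forall>y\<in>K. \<forall>z\<in>K. dist z y < d \<longrightarrow> dist (?D z b) (?D y b) < e'" for b
  proof -
    have "continuous_on K (\<lambda>y. ?D y b)" using f K(3) by (auto intro: continuous_on_subset)
    then show ?thesis using compact_uniformly_continuous[OF _ K(1)] e' unfolding uniformly_continuous_on_def by blast
  qed
  then obtain d where d: "\<And>b. d b > 0"
    "\<And>b y z. y \<in> K \<Longrightarrow> z \<in> K \<Longrightarrow> dist z y < d b \<Longrightarrow> dist (?D z b) (?D y b) < e'" by metis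
  define d0 where "d0 = Min (d ` Basis)"
  have d0: "d0 > 0" unfolding d0_def using d(1) by (subst Min_gr_iff) auto
  have d0b: "d0 \<le> d b" if "b \<in> Basis" for b unfolding d0_def using that by auto
  show ?thesis
  proof (rule that[OF d0])
    fix y z assume yz: "y \<in> K" "z \<in> K" "norm (z - y) < d0"
    have "norm (f z - f y - ?D y (z - y)) \<le> norm (z - y) * e"
    proof (rule differentiable_bound_linearization[where S = "K \<inter> ball y d0"])
      show "y \<in> K \<inter> ball y d0" using yz d0 by simp
      show "y + t *\<^sub>R (z - y) \<in> K \<inter> ball y d0" if "t \<in> {0..1}" for t
      proof -
        have "convex (K \<inter> ball y d0)" using K(2) by (intro convex_Int convex_ball)
        then have "closed_segment y z \<subseteq> K \<inter> ball y d0"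
          using yz d0 by (intro closed_segment_subset) (auto simp: dist_norm norm_minus_commute)
        moreover have "y + t *\<^sub>R (z - y) \<in> closed_segment y z"
          using that by (auto simp: closed_segment_def algebra_simps intro!: exI[of _ t])
        ultimately show ?thesis by blast
      qed
      show "(f has_derivative ?D x) (at x within K \<inter> ball y d0)" if "x \<in> K \<inter> ball y d0" for x
        using fd that by (blast intro: has_derivative_at_withinI)
      show "onorm (?D x - ?D y) \<le> e" if x: "x \<in> K \<inter> ball y d0" for x
      proof (rule onorm_le)
        fix v
        have "(?D x - ?D y) v = (\<Sum>b\<in>Basis. (v \<bullet> b) *\<^sub>R (?D x b - ?D y b))"
          using has_derivative_Basis[OF fd[of x], of v] has_derivative_Basis[OF fd[of y], of v] x yz
          by (simp add: scaleR_diff_right sum_subtractf)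
        also have "norm \<dots> \<le> (\<Sum>b\<in>(Basis::'b set). norm v * e')"
        proof (rule sum_norm_le)
          fix b :: 'b assume b: "b \<in> Basis"
          have "norm (?D x b - ?D y b) \<le> e'"
            using d(2)[of y x b] x yz d0b[OF b] by (auto simp: dist_norm norm_minus_commute less_imp_le)
          then show "norm ((v \<bullet> b) *\<^sub>R (?D x b - ?D y b)) \<le> norm v * e'"
            using Basis_le_norm[OF b, of v] by (auto intro!: mult_mono)
        qed
        also have "\<dots> = e * norm v" by (simp add: e'_def)
        finally show "norm ((?D x - ?D y) v) \<le> e * norm v" .
      qed
    qed
    then show "norm (f z - f y - ?D y (z - y)) \<le> e * norm (z - y)" by (simp add: mult.commute)
  qed
qed

lemma superpose_has_derivative:
  fixes f :: "'b::euclidean_space \<Rightarrow> 'c::real_normed_vector"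
  assumes f: "Ck_on 1 U f" and K: "compact K" "convex K" "K \<subseteq> U" and \<phi>: "\<And>s. apply_bcontfun \<phi> s \<in> K"
  shows "(superpose f has_derivative superpose_deriv f \<phi>) (at \<phi> within {\<psi>. \<forall>s. apply_bcontfun \<psi> s \<in> K})"
  unfolding has_derivative_within_alt
proof (intro conjI allI impI bounded_linear_superpose_deriv)
  fix e :: real assume e: "0 < e"
  have cf: "continuous_on K f" using Ck_on_continuous[OF f] K(3) continuous_on_subset by blast
  obtain d where d: "d > 0" "\<And>y z. y \<in> K \<Longrightarrow> z \<in> K \<Longrightarrow> norm (z - y) < d \<Longrightarrow>
      norm (f z - f y - frechet_derivative f (at y) (z - y)) \<le> e * norm (z - y)"
    using uniform_linearization[OF f K e] by metis
  show "\<exists>d>0. \<forall>\<psi>\<in>{\<psi>. \<forall>s. apply_bcontfun \<psi> s \<in> K}. norm (\<psi> - \<phi>) < d \<longrightarrow>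
      norm (superpose f \<psi> - superpose f \<phi> - superpose_deriv f \<phi> (\<psi> - \<phi>)) \<le> e * norm (\<psi> - \<phi>)"
  proof (intro exI[of _ d] conjI d(1) ballI impI norm_bound)
    fix \<psi> s assume \<psi>: "\<psi> \<in> {\<psi>. \<forall>s. apply_bcontfun \<psi> s \<in> K}" and n: "norm (\<psi> - \<phi>) < d"
    have m: "norm (\<psi> s - \<phi> s) \<le> norm (\<psi> - \<phi>)" using norm_bounded[of "\<psi> - \<phi>" s] by simp
    have "norm (f (\<psi> s) - f (\<phi> s) - frechet_derivative f (at (\<phi> s)) (\<psi> s - \<phi> s)) \<le> e * norm (\<psi> s - \<phi> s)"
      using \<psi> \<phi> m n by (intro d(2)) auto
    also have "\<dots> \<le> e * norm (\<psi> - \<phi>)" using m e by simp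
    finally show "norm ((superpose f \<psi> - superpose f \<phi> - superpose_deriv f \<phi> (\<psi> - \<phi>)) s) \<le> e * norm (\<psi> - \<phi>)"
      using \<psi> by (simp add: apply_superpose[OF cf K(1)] \<phi> apply_superpose_deriv[OF f K(1,3) \<phi>])
  qed
qed

lemma superpose_continuous:
  fixes f :: "'b::metric_space \<Rightarrow> 'c::metric_space"
  assumes "continuous_on K f" "compact K"
  shows "continuous_on {\<psi>. \<forall>s. apply_bcontfun \<psi> s \<in> K} (superpose f)"
  unfolding continuous_on_iff
proof (intro ballI allI impI)
  fix \<phi> :: "'a \<Rightarrow>\<^sub>C 'b" and e :: real assume \<phi>: "\<phi> \<in> {\<psi>. \<forall>s. apply_bcontfun \<psi> s \<in> K}" and e: "e > 0"
  obtain d where d: "d > 0" "\<And>y z. y \<in> K \<Longrightarrow> z \<in> K \<Longrightarrow> dist z y < d \<Longrightarrow> dist (f z) (f y) < e/2"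
    using compact_uniformly_continuous[OF assms] e unfolding uniformly_continuous_on_def
    by (metis half_gt_zero)
  show "\<exists>d>0. \<forall>\<psi>\<in>{\<psi>. \<forall>s. apply_bcontfun \<psi> s \<in> K}. dist \<psi> \<phi> < d \<longrightarrow> dist (superpose f \<psi>) (superpose f \<phi>) < e"
  proof (intro exI[of _ d] conjI d(1) ballI impI)
    fix \<psi> assume \<psi>: "\<psi> \<in> {\<psi>. \<forall>s. apply_bcontfun \<psi> s \<in> K}" and n: "dist \<psi> \<phi> < d"
    have "dist (superpose f \<psi>) (superpose f \<phi>) \<le> e/2"
    proof (rule dist_bound)
      fix s
      have "dist (\<psi> s) (\<phi> s) < d" using dist_fun_lt_imp_dist_val_lt[OF n] .
      then show "dist (superpose f \<psi> s) (superpose f \<phi> s) \<le> e/2"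
        using \<psi> \<phi> d(2)[of "\<phi> s" "\<psi> s"] by (simp add: apply_superpose[OF assms] less_imp_le)
    qed
    then show "dist (superpose f \<psi>) (superpose f \<phi>) < e" using e by simp
  qed
qed

text \<open>The induction needs \<open>f\<close> arbitrary, because the derivative contains
  superpositions with partial derivatives of \<open>f\<close>. The superposition operator is known
  to be differentiable only within the paths with values in \<open>K\<close>, so the chain rule is
  applied within the image of \<open>S\<close>.\<close>

lemma Ck_on_superpose:
  fixes f :: "'b::euclidean_space \<Rightarrow> 'c::real_normed_vector"
  assumes f: "smooth_on U f" and K: "compact K" "convex K" "K \<subseteq> U" and S: "open S"
    and \<phi>: "\<And>x s. x \<in> S \<Longrightarrow> apply_bcontfun (\<phi> x :: real \<Rightarrow>\<^sub>C 'b) s \<in> K"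
    and C: "Ck_on k S \<phi>"
  shows "Ck_on k S (\<lambda>x. superpose f (\<phi> x))"
  using f C
proof (induction k arbitrary: f)
  case 0
  have "continuous_on K f" using smooth_on_continuous[OF 0(1)] K(3) continuous_on_subset by blast
  from superpose_continuous[OF this K(1)] show ?case
    using 0(2) \<phi> by (auto intro: continuous_on_compose2)
next
  case (Suc k)
  have f1: "Ck_on 1 U f" using Suc.prems(1) by (simp only: smooth_on_def)
  have sd: "smooth_on U (\<lambda>y. frechet_derivative f (at y) b)" for b
    using smooth_on_derivative[OF Suc.prems(1)] .
  show ?case
  proof (rule Ck_on_SucI[OF S])
    fix x assume x: "x \<in> S"
    have "(superpose f has_derivative superpose_deriv f (\<phi> x)) (at (\<phi> x) within \<phi> ` S)"
      by (rule has_derivative_subset[OF superpose_has_derivative[OF f1 K]]) (use \<phi> x in auto)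
    moreover have "(\<phi> has_derivative frechet_derivative \<phi> (at x)) (at x within S)"
      using Ck_on_has_derivative[OF Suc.prems(2) x] by (rule has_derivative_at_withinI)
    ultimately have "((superpose f \<circ> \<phi>) has_derivative (superpose_deriv f (\<phi> x) \<circ> frechet_derivative \<phi> (at x))) (at x within S)"
      by (intro diff_chain_within)
    then show "((\<lambda>x. superpose f (\<phi> x)) has_derivative (\<lambda>v. superpose_deriv f (\<phi> x) (frechet_derivative \<phi> (at x) v))) (at x)"
      by (simp add: at_within_open[OF x S] o_def)
  next
    fix v
    show "Ck_on k S (\<lambda>x. superpose_deriv f (\<phi> x) (frechet_derivative \<phi> (at x) v))"
      unfolding superpose_deriv_def
      by (intro Ck_on_sum S bounded_bilinear.Ck_on_bilinear[OF bounded_bilinear_pointwise[OF bounded_bilinear_comp_scale]]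
          Suc.IH[OF sd] Ck_on_SucD[OF Suc.prems(2)]) (use Suc.prems(2) in simp)
  qed
qed

section \<open>Fixed points of contractions depending on a parameter\<close>

lemma contraction_resolvent:
  fixes K :: "'b::{real_normed_vector, complete_space} \<Rightarrow>\<^sub>L 'b"
  assumes "norm K \<le> 1/2"
  shows "\<exists>M. M o\<^sub>L (id_blinfun - K) = id_blinfun \<and> (id_blinfun - K) o\<^sub>L M = id_blinfun"
proof -
  \<comment> \<open>Banach's fixed point theorem takes the place of the Neumann series: the solution
    map \<open>m\<close> is the inverse of \<open>id_blinfun - K\<close>.\<close>
  have "\<exists>!y. a + K y = y" for a
  proof (rule banach_fix_type[of "1/2"])
    show "\<forall>x y. dist (a + K x) (a + K y) \<le> 1/2 * dist x y"
      using order_trans[OF norm_blinfun mult_right_mono[OF assms norm_ge_zero]]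
      by (simp add: dist_norm blinfun.diff_right[symmetric])
  qed auto
  then obtain m where m: "\<And>a. a + K (m a) = m a" and u: "\<And>a y. a + K y = y \<Longrightarrow> y = m a" by metis
  have bd: "norm (m a) \<le> norm a * 2" for a
  proof -
    have "norm (m a) \<le> norm a + norm (K (m a))" by (subst m[symmetric]) (rule norm_triangle_ineq)
    also have "norm (K (m a)) \<le> 1/2 * norm (m a)"
      using order_trans[OF norm_blinfun mult_right_mono[OF assms]] by simp
    finally show ?thesis by simp
  qed
  have bl: "bounded_linear m"
  proof (rule bounded_linear_intro[OF _ _ bd])
    show "m (a + b) = m a + m b" for a b
      by (rule u[symmetric]) (metis (no_types, lifting) m blinfun.add_right add.assoc add.left_commute)
    show "m (r *\<^sub>R a) = r *\<^sub>R m a" for r a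
      by (rule u[symmetric]) (metis m blinfun.scaleR_right scaleR_add_right)
  qed
  show ?thesis
  proof (intro exI[of _ "Blinfun m"] conjI blinfun_eqI)
    show "(Blinfun m o\<^sub>L (id_blinfun - K)) x = id_blinfun x" for x
      using u[of "x - K x" x] by (simp add: bounded_linear_Blinfun_apply[OF bl] blinfun.diff_left)
    show "((id_blinfun - K) o\<^sub>L Blinfun m) x = id_blinfun x" for x
      using m[of x] by (simp add: bounded_linear_Blinfun_apply[OF bl] blinfun.diff_left algebra_simps)
  qed
qed

text \<open>The contraction estimate makes \<open>\<phi>\<close> Lipschitz at \<open>x\<close>, so
  the error in linearizing \<open>T\<close> is small relative to \<open>y - x\<close>. Up to that
  error the increment w of \<open>\<phi>\<close> satisfies w = A (y - x) + K w, and \<open>M\<close>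
  solves for w.\<close>

lemma fixed_point_has_derivative:
  fixes T :: "'a::real_normed_vector \<times> 'b::real_normed_vector \<Rightarrow> 'b"
  assumes fp: "\<And>y. y \<in> S \<Longrightarrow> T (y, \<phi> y) = \<phi> y" and x: "open S" "x \<in> S"
    and con: "\<And>y. y \<in> S \<Longrightarrow> norm (T (y, \<phi> y) - T (y, \<phi> x)) \<le> 1/2 * norm (\<phi> y - \<phi> x)"
    and C: "\<And>y. y \<in> S \<Longrightarrow> \<phi> y \<in> C"
    and dT: "(T has_derivative (\<lambda>h. A (fst h) + blinfun_apply K (snd h))) (at (x, \<phi> x) within S \<times> C)"
    and M: "M o\<^sub>L (id_blinfun - K) = id_blinfun"
  shows "(\<phi> has_derivative (\<lambda>h. blinfun_apply M (A h))) (at x)"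
proof -
  note dT' = dT[unfolded has_derivative_within_alt]
  have A: "bounded_linear A"
  proof -
    have "bounded_linear (\<lambda>h. (\<lambda>h. A (fst h) + K (snd h)) (h, 0))"
      using bounded_linear_compose[OF conjunct1[OF dT'] bounded_linear_Pair[OF bounded_linear_ident bounded_linear_zero]] .
    then show ?thesis by simp
  qed
  obtain B where B: "B > 0" "\<And>h. norm (A h) \<le> norm h * B" using bounded_linear.pos_bounded[OF A] by blast
  have Mi: "M (w - K w) = w" for w
    using M by (metis blinfun.diff_left blinfun_apply_blinfun_compose blinfun_apply_id_blinfun)
  \<comment> \<open>\<open>B + 1\<close> bounds \<open>A\<close> together with a linearization error
    of slope 1; the contraction leaves half of the increment on the left, hence the factor
    2.\<close>
  define D where "D = 2 * (B + 1)"
  obtain d1 where d1: "d1 > 0" "\<And>y. y \<in> S \<times> C \<Longrightarrow> norm (y - (x, \<phi> x)) < d1 \<Longrightarrow>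
      norm (T y - T (x, \<phi> x) - (A (fst (y - (x, \<phi> x))) + K (snd (y - (x, \<phi> x))))) \<le> 1 * norm (y - (x, \<phi> x))"
    using conjunct2[OF dT'] zero_less_one by meson
  have lip: "norm (\<phi> y - \<phi> x) \<le> D * norm (y - x)" if y: "y \<in> S" "norm (y - x) < d1" for y
  proof -
    have "norm (T (y, \<phi> x) - T (x, \<phi> x) - A (y - x)) \<le> norm (y - x)"
      using d1(2)[of "(y, \<phi> x)"] y C[OF x(2)] by (simp add: norm_Pair)
    moreover have "norm (A (y - x)) \<le> B * norm (y - x)" using B(2) by (simp add: mult.commute)
    ultimately have "norm (T (y, \<phi> x) - T (x, \<phi> x)) \<le> (B + 1) * norm (y - x)"
      using norm_triangle_sub[of "T (y, \<phi> x) - T (x, \<phi> x)" "A (y - x)"] by (simp add: algebra_simps)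
    moreover have "norm (\<phi> y - \<phi> x) \<le> norm (T (y, \<phi> y) - T (y, \<phi> x)) + norm (T (y, \<phi> x) - T (x, \<phi> x))"
      using norm_triangle_ineq[of "T (y, \<phi> y) - T (y, \<phi> x)" "T (y, \<phi> x) - T (x, \<phi> x)"] fp y(1) x(2) by simp
    ultimately have "1/2 * norm (\<phi> y - \<phi> x) \<le> (B + 1) * norm (y - x)" using con[OF y(1)] by linarith
    then show ?thesis by (simp add: D_def algebra_simps)
  qed
  have D: "D > 0" using B by (simp add: D_def)
  have "(\<phi> has_derivative (\<lambda>h. M (A h))) (at x within S)"
    unfolding has_derivative_within_alt
  proof (intro conjI allI impI)
    show "bounded_linear (\<lambda>h. M (A h))" using A by (rule bounded_linear_compose[OF blinfun.bounded_linear_right])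
    fix e :: real assume e: "0 < e"
    \<comment> \<open>\<open>1 + D\<close> bounds the increment of the pair in terms of that of the
      parameter, and \<open>norm M\<close> is the loss in solving the linearized equation.\<close>
    define e' where "e' = e / ((1 + D) * (norm M + 1))"
    have pos: "0 < (1 + D) * (norm M + 1)" using D by (intro mult_pos_pos) (auto simp: add_pos_nonneg add_nonneg_pos)
    have e': "e' > 0" using e pos by (simp add: e'_def)
    obtain d2 where d2: "d2 > 0" "\<And>y. y \<in> S \<times> C \<Longrightarrow> norm (y - (x, \<phi> x)) < d2 \<Longrightarrow>
      norm (T y - T (x, \<phi> x) - (A (fst (y - (x, \<phi> x))) + K (snd (y - (x, \<phi> x))))) \<le> e' * norm (y - (x, \<phi> x))"
      using conjunct2[OF dT'] e' by meson
    show "\<exists>d>0. \<forall>y\<in>S. norm (y - x) < d \<longrightarrow> norm (\<phi> y - \<phi> x - M (A (y - x))) \<le> e * norm (y - x)"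
    proof (intro exI[of _ "min d1 (d2 / (1 + D))"] conjI ballI impI)
      show "0 < min d1 (d2 / (1 + D))" using d1(1) d2(1) D by simp
      fix y assume y: "y \<in> S" and n: "norm (y - x) < min d1 (d2 / (1 + D))"
      let ?w = "\<phi> y - \<phi> x"
      have w: "norm ?w \<le> D * norm (y - x)" using lip y n by simp
      have p: "norm ((y, \<phi> y) - (x, \<phi> x)) \<le> (1 + D) * norm (y - x)"
        using norm_Pair_le[of "y - x" ?w] w by (simp add: algebra_simps)
      also have "\<dots> < d2" using n D by (simp add: field_simps)
      finally have "norm (T (y, \<phi> y) - T (x, \<phi> x) - (A (y - x) + K ?w)) \<le> e' * norm ((y, \<phi> y) - (x, \<phi> x))"
        using d2(2)[of "(y, \<phi> y)"] y C by simp
      also have "\<dots> \<le> e' * ((1 + D) * norm (y - x))" using p e' by simp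
      finally have q: "norm (?w - (A (y - x) + K ?w)) \<le> e' * ((1 + D) * norm (y - x))"
        using fp y x by simp
      have "?w - M (A (y - x)) = M (?w - (A (y - x) + K ?w))"
        using Mi[of ?w] by (simp add: blinfun.diff_right blinfun.add_right algebra_simps)
      then have "norm (?w - M (A (y - x))) \<le> norm M * norm (?w - (A (y - x) + K ?w))"
        by (simp add: norm_blinfun)
      also have "\<dots> \<le> (norm M + 1) * (e' * ((1 + D) * norm (y - x)))"
        using q by (intro mult_mono) auto
      also have "\<dots> = e' * ((1 + D) * (norm M + 1)) * norm (y - x)" by (simp add: algebra_simps)
      also have "\<dots> = e * norm (y - x)" 
      proof -
        have "1 + D \<noteq> 0" "norm M + 1 \<noteq> 0" using pos by auto
        then show ?thesis by (simp add: e'_def)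
      qed
      finally show "norm (?w - M (A (y - x))) \<le> e * norm (y - x)" .
    qed
  qed
  then show ?thesis by (simp add: at_within_open[OF x(2,1)])
qed

section \<open>Antiderivatives of paths and the local flow\<close>

definition clamp01 :: "real \<Rightarrow> real" where "clamp01 s = max 0 (min 1 s)"

lemma clamp01: "clamp01 s \<in> {0..1}" "s \<in> {0..1} \<Longrightarrow> clamp01 s = s"
  by (auto simp: clamp01_def)

lemma continuous_clamp01: "continuous_on S clamp01"
  unfolding clamp01_def by (intro continuous_intros)

text \<open>Paths are total on the real line, although only the unit interval matters. Clamping
  continues the antiderivative by constants, which keeps it bounded, with norm at most that of the
  path.\<close>

definition antideriv :: "(real \<Rightarrow>\<^sub>C 'b::euclidean_space) \<Rightarrow> (real \<Rightarrow>\<^sub>C 'b)" where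
  "antideriv \<phi> = Bcontfun (\<lambda>s. integral {0..clamp01 s} \<phi>)"

lemma norm_integral_bcontfun:
  fixes \<phi> :: "real \<Rightarrow>\<^sub>C 'b::euclidean_space"
  shows "norm (integral {0..clamp01 s} \<phi>) \<le> norm \<phi>"
proof -
  have "norm (integral {0..clamp01 s} \<phi>) \<le> norm \<phi> * (clamp01 s - 0)"
    using clamp01(1)[of s] by (intro integral_bound) (auto intro: norm_bounded)
  also have "\<dots> \<le> norm \<phi>" using clamp01(1)[of s] by (auto intro: mult_left_le)
  finally show ?thesis .
qed

lemma apply_antideriv:
  fixes \<phi> :: "real \<Rightarrow>\<^sub>C 'b::euclidean_space"
  shows "antideriv \<phi> s = integral {0..clamp01 s} \<phi>"
proof -
  have "continuous_on {0..1} (\<lambda>s. integral {0..s} \<phi>)"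
    by (intro indefinite_integral_continuous_1 integrable_continuous_real) simp
  then have "continuous_on UNIV (\<lambda>s. integral {0..clamp01 s} \<phi>)"
    using clamp01(1) by (intro continuous_on_compose2[OF _ continuous_clamp01]) auto
  then show ?thesis unfolding antideriv_def
    by (subst apply_Bcontfun[OF _ norm_integral_bcontfun]) auto
qed

lemma norm_antideriv_le: "norm (antideriv \<phi>) \<le> norm \<phi>"
  by (rule norm_bound) (simp add: apply_antideriv norm_integral_bcontfun)

lemma bounded_linear_antideriv:
  "bounded_linear (antideriv :: (real \<Rightarrow>\<^sub>C 'b::euclidean_space) \<Rightarrow> (real \<Rightarrow>\<^sub>C 'b))"
proof (rule bounded_linear_intro[where K = 1])
  have i: "apply_bcontfun \<phi> integrable_on {0..s}" for \<phi> :: "real \<Rightarrow>\<^sub>C 'b" and s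
    by (intro integrable_continuous_real) simp
  show "antideriv (\<phi> + \<psi>) = antideriv \<phi> + antideriv \<psi>" for \<phi> \<psi> :: "real \<Rightarrow>\<^sub>C 'b"
    by (rule bcontfun_eqI) (simp add: apply_antideriv integral_add[OF i i, symmetric])
  show "antideriv (r *\<^sub>R \<phi>) = r *\<^sub>R antideriv \<phi>" for r and \<phi> :: "real \<Rightarrow>\<^sub>C 'b"
    by (rule bcontfun_eqI) (simp add: apply_antideriv)
  show "norm (antideriv \<phi>) \<le> norm \<phi> * 1" for \<phi> :: "real \<Rightarrow>\<^sub>C 'b"
    using norm_antideriv_le by simp
qed

lemma Ck_on_bounded_derivative:
  fixes f :: "'b::euclidean_space \<Rightarrow> 'c::real_normed_vector"
  assumes f: "Ck_on 1 U f" and K: "compact K" "K \<subseteq> U"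
  obtains B where "B > 0" "\<And>y v. y \<in> K \<Longrightarrow> norm (frechet_derivative f (at y) v) \<le> B * norm v"
    "\<And>y. y \<in> K \<Longrightarrow> norm (f y) \<le> B"
proof -
  have f': "Ck_on (Suc 0) U f" using f by (simp only: One_nat_def)
  let ?D = "\<lambda>y. frechet_derivative f (at y)"
  have "continuous_on K (\<lambda>y. norm (f y) + (\<Sum>b\<in>Basis. norm (?D y b)))"
    using f' K(2) Ck_on_continuous[OF f] by (auto intro!: continuous_intros intro: continuous_on_subset)
  from compact_imp_bounded[OF compact_continuous_image[OF this K(1)]]
  obtain B where B: "B > 0" "\<And>y. y \<in> K \<Longrightarrow> norm (f y) + (\<Sum>b\<in>Basis. norm (?D y b)) \<le> B"
    unfolding bounded_pos by (auto simp: add_nonneg_nonneg sum_nonneg)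
  show ?thesis
  proof (rule that[OF B(1)])
    fix y assume y: "y \<in> K"
    show "norm (f y) \<le> B"
      using B(2)[OF y] sum_nonneg[of Basis "\<lambda>b. norm (?D y b)"] by (smt (verit) norm_ge_zero)
    fix v
    have "?D y v = (\<Sum>b\<in>Basis. (v \<bullet> b) *\<^sub>R ?D y b)"
      using has_derivative_Basis[OF Ck_on_has_derivative[OF f']] y K(2) by blast
    also have "norm \<dots> \<le> (\<Sum>b\<in>Basis. norm v * norm (?D y b))"
      by (rule sum_norm_le) (auto intro!: mult_right_mono Basis_le_norm)
    also have "\<dots> = norm v * (\<Sum>b\<in>Basis. norm (?D y b))" by (simp add: sum_distrib_left)
    also have "\<dots> \<le> norm v * B" using B(2)[OF y] by (intro mult_left_mono) (smt (verit) norm_ge_zero, simp)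
    finally show "norm (?D y v) \<le> B * norm v" by (simp add: mult.commute)
  qed
qed

text \<open>
  The solution on the time interval from 0 to \<open>t\<close> that starts at \<open>z\<close> is rescaled to the unit
  interval. It is then the fixed point of a contraction depending smoothly on the parameter
  \<open>(t, z)\<close>. Differentiating the fixed point equation gives
  \<open>\<phi>' = (1 - K)\<^sup>-\<^sup>1 \<circ> A\<close> with \<open>K\<close> and \<open>A\<close> as regular as \<open>\<phi>\<close> itself, hence \<open>\<phi>\<close> is smooth.
\<close>

theorem smooth_local_flow:
  fixes f :: "'b::euclidean_space \<Rightarrow> 'b"
  assumes U: "open U" "p \<in> U" and f: "smooth_on U f"
  obtains d \<Phi> where "d > 0" "smooth_on ({-d<..<d} \<times> ball p d) \<Phi>"
    "\<And>z. z \<in> ball p d \<Longrightarrow> \<Phi> (0, z) = z"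
    "\<And>t z. \<bar>t\<bar> < d \<Longrightarrow> z \<in> ball p d \<Longrightarrow> \<Phi> (t, z) \<in> U"
    "\<And>t z. \<bar>t\<bar> < d \<Longrightarrow> z \<in> ball p d \<Longrightarrow> frechet_derivative \<Phi> (at (t, z)) (1, 0) = f (\<Phi> (t, z))"
proof -
  obtain r where r: "r > 0" "cball p r \<subseteq> U" using U open_contains_cball by blast
  define K where "K = cball p r"
  have K: "compact K" "convex K" "K \<subseteq> U" "closed K" "K \<noteq> {}" using r by (auto simp: K_def)
  have f1: "Ck_on 1 U f" using f by (simp only: smooth_on_def)
  then have f1': "Ck_on (Suc 0) U f" by (simp only: One_nat_def)
  obtain B where B: "B > 0" "\<And>y v. y \<in> K \<Longrightarrow> norm (frechet_derivative f (at y) v) \<le> B * norm v"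
    "\<And>y. y \<in> K \<Longrightarrow> norm (f y) \<le> B"
    using Ck_on_bounded_derivative[OF f1 K(1,3)] by metis
  have cf: "continuous_on K f" using smooth_on_continuous[OF f] K(3) continuous_on_subset by blast
  have lip: "norm (f x - f y) \<le> B * norm (x - y)" if "x \<in> K" "y \<in> K" for x y
  proof (rule differentiable_bound[OF K(2) _ _ that])
    show "(f has_derivative frechet_derivative f (at x)) (at x within K)" if "x \<in> K" for x
      using Ck_on_has_derivative[OF f1'] that K(3) by (blast intro: has_derivative_at_withinI)
    show "onorm (frechet_derivative f (at x)) \<le> B" if "x \<in> K" for x
      using B(2)[OF that] by (rule onorm_le)
  qed
  \<comment> \<open>The nearest point projection onto the ball \<open>K\<close> extends
    \<open>f\<close> to a map on the whole space with bound and Lipschitz constant \<open>B\<close>,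
    so \<open>T\<close> acts as a contraction on all paths. The fixed points turn out to stay in
    \<open>K\<close>, where \<open>F\<close> is \<open>f\<close>; hence only derivatives of
    \<open>f\<close> are ever taken.\<close>
  define F where "F x = f (closest_point K x)" for x
  have cpK: "closest_point K x \<in> K" for x by (rule closest_point_in_set[OF K(4,5)])
  have FB: "norm (F x) \<le> B" for x unfolding F_def by (rule B(3)[OF cpK])
  have Flip: "norm (F x - F y) \<le> B * norm (x - y)" for x y
  proof -
    have "norm (F x - F y) \<le> B * norm (closest_point K x - closest_point K y)"
      unfolding F_def by (rule lip[OF cpK cpK])
    also have "\<dots> \<le> B * norm (x - y)"
      using closest_point_lipschitz[OF K(2,4,5), of x y] B(1) by (simp add: dist_norm)
    finally show ?thesis .
  qed
  have Ff: "F x = f x" if "x \<in> K" for x using that by (simp add: F_def closest_point_self)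
  have contF: "continuous_on UNIV F"
    unfolding F_def using continuous_on_closest_point[OF K(2,4,5)] cpK
    by (intro continuous_on_compose2[OF cf]) auto
  have apF: "superpose F \<phi> s = F (\<phi> s)" for \<phi> :: "real \<Rightarrow>\<^sub>C 'b" and s
    unfolding superpose_def
    by (subst apply_Bcontfun[of _ B]) (auto intro!: continuous_on_compose2[OF contF] FB)
  define T where "T x \<phi> = const_bcontfun (snd x) + fst x *\<^sub>R antideriv (superpose F \<phi>)" for x \<phi>
  \<comment> \<open>The three bounds keep the starting points in the ball of half the radius, make
    the contraction factor \<open>d * B\<close> at most 1/2, and keep each path within
    \<open>r/2\<close> of its starting point.\<close>
  define d where "d = min (r/2) (min (1 / (2 * B)) (r / (2 * (B + 1))))"
  have d: "d > 0" "d \<le> r/2" "d * B \<le> 1/2" "d * B < r/2"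
  proof -
    show "d > 0" using r B by (simp add: d_def)
    show "d \<le> r/2" unfolding d_def by (rule min.cobounded1)
    have "d \<le> 1 / (2 * B)" by (simp add: d_def)
    then show "d * B \<le> 1/2" using B(1) by (simp add: field_simps)
    have "d \<le> r / (2 * (B + 1))" by (simp add: d_def)
    then have "d * (B + 1) \<le> r/2" using B(1) by (simp add: field_simps)
    moreover have "d * (B + 1) = d * B + d" by (simp add: algebra_simps)
    ultimately show "d * B < r/2" using \<open>d > 0\<close> by linarith
  qed
  define P where "P = {-d<..<d} \<times> ball p d"
  have P: "open P" by (simp add: P_def open_Times)
  have con: "norm (T x \<phi> - T x \<psi>) \<le> 1/2 * norm (\<phi> - \<psi>)" if "x \<in> P" for x \<phi> \<psi>
  proof -
    have "T x \<phi> - T x \<psi> = fst x *\<^sub>R antideriv (superpose F \<phi> - superpose F \<psi>)"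
      using linear_diff[OF bounded_linear.linear[OF bounded_linear_antideriv], of "superpose F \<phi>" "superpose F \<psi>"]
      by (simp add: T_def scaleR_diff_right)
    also have "norm \<dots> \<le> \<bar>fst x\<bar> * norm (superpose F \<phi> - superpose F \<psi>)"
      by (simp add: mult_left_mono norm_antideriv_le)
    also have "\<dots> \<le> d * (B * norm (\<phi> - \<psi>))"
    proof (intro mult_mono norm_bound)
      show "\<bar>fst x\<bar> \<le> d" using that by (auto simp: P_def)
      fix s
      have "norm (\<phi> s - \<psi> s) \<le> norm (\<phi> - \<psi>)" using norm_bounded[of "\<phi> - \<psi>" s] by simp
      then show "norm ((superpose F \<phi> - superpose F \<psi>) s) \<le> B * norm (\<phi> - \<psi>)"
        using Flip[of "\<phi> s" "\<psi> s"] B(1) by (simp add: apF) (smt (verit) mult_left_mono)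
    qed (use d in auto)
    also have "\<dots> \<le> 1/2 * norm (\<phi> - \<psi>)" using mult_right_mono[OF d(3) norm_ge_zero[of "\<phi> - \<psi>"]] by (simp add: mult.assoc)
    finally show ?thesis .
  qed
  have "\<exists>\<phi>. x \<in> P \<longrightarrow> T x \<phi> = \<phi>" for x
  proof (cases "x \<in> P")
    case True
    have "\<exists>!\<phi>. T x \<phi> = \<phi>"
      by (rule banach_fix_type[of "1/2"]) (use con[OF True] in \<open>auto simp: dist_norm\<close>)
    then show ?thesis by blast
  qed simp
  then obtain \<phi> where fp: "\<And>x. x \<in> P \<Longrightarrow> T x (\<phi> x) = \<phi> x" by metis
  have eqn: "\<phi> x s = snd x + fst x *\<^sub>R integral {0..clamp01 s} (superpose F (\<phi> x))" if "x \<in> P" for x s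
    by (subst fp[OF that, symmetric]) (simp add: T_def apply_antideriv)
  have inK: "\<phi> x s \<in> K" if x: "x \<in> P" for x s
  proof -
    have "norm (\<phi> x s - snd x) = \<bar>fst x\<bar> * norm (antideriv (superpose F (\<phi> x)) s)"
      by (simp add: eqn[OF x] apply_antideriv)
    also have "\<dots> \<le> d * B"
    proof (rule mult_mono)
      show "norm (antideriv (superpose F (\<phi> x)) s) \<le> B"
        by (rule order_trans[OF norm_bounded order_trans[OF norm_antideriv_le norm_bound]]) (simp add: apF FB)
    qed (use x d in \<open>auto simp: P_def\<close>)
    finally have "norm (\<phi> x s - snd x) < r/2" using d by simp
    moreover have "norm (snd x - p) < r/2" using x d(2) by (auto simp: P_def dist_norm norm_minus_commute)
    ultimately have "norm (\<phi> x s - p) \<le> r" using norm_triangle_ineq[of "\<phi> x s - snd x" "snd x - p"] by simp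
    then show ?thesis by (simp add: K_def dist_norm norm_minus_commute)
  qed
  have spF: "superpose F \<psi> = superpose f \<psi>" if "\<forall>s. apply_bcontfun \<psi> s \<in> K" for \<psi> :: "real \<Rightarrow>\<^sub>C 'b"
    using that by (simp add: superpose_def Ff)
  define C where "C = {\<psi> :: real \<Rightarrow>\<^sub>C 'b. \<forall>s. apply_bcontfun \<psi> s \<in> K}"
  have \<phi>C: "\<phi> x \<in> C" if "x \<in> P" for x using inK[OF that] by (simp add: C_def)
  define J where "J = Blinfun (antideriv :: (real \<Rightarrow>\<^sub>C 'b) \<Rightarrow> _)"
  have J: "blinfun_apply J = antideriv" by (simp add: J_def bounded_linear_Blinfun_apply bounded_linear_antideriv)
  \<comment> \<open>\<open>superpose_deriv\<close> as a bounded operator. The space of paths is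
    infinite-dimensional, so regularity in the operator norm cannot be tested pointwise; it comes
    from the bounded linear map \<open>prod_left\<close>.\<close>
  define N where "N x = (\<Sum>b\<in>Basis. bounded_bilinear.prod_left (pointwise (comp_scale b))
      (superpose (\<lambda>y. frechet_derivative f (at y) b) (\<phi> x)))" for x
  have N: "blinfun_apply (N x) h = superpose_deriv f (\<phi> x) h" for x h
    unfolding N_def superpose_deriv_def
    by (simp add: blinfun.sum_left bounded_bilinear.prod_left.rep_eq[OF bounded_bilinear_pointwise[OF bounded_bilinear_comp_scale]])
  define L where "L x = fst x *\<^sub>R (J o\<^sub>L N x)" for x
  define A where "A x h = const_bcontfun (snd h) + fst h *\<^sub>R antideriv (superpose f (\<phi> x))" for x and h :: "real \<times> 'b"
  have normL: "norm (L x) \<le> 1/2" if x: "x \<in> P" for x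
  proof (rule norm_blinfun_bound)
    fix h :: "real \<Rightarrow>\<^sub>C 'b"
    have "norm (L x h) = \<bar>fst x\<bar> * norm (antideriv (N x h))" by (simp add: L_def J blinfun.scaleR_left)
    also have "\<dots> \<le> d * (B * norm h)"
    proof (rule mult_mono)
      show "norm (antideriv (N x h)) \<le> B * norm h"
      proof (rule order_trans[OF norm_antideriv_le norm_bound])
        fix s
        have "norm (N x h s) \<le> B * norm (h s)"
          using B(2)[OF inK[OF x]] by (simp add: N apply_superpose_deriv[OF f1 K(1,3) inK[OF x]])
        also have "\<dots> \<le> B * norm h" using B(1) norm_bounded[of h s] by simp
        finally show "norm (N x h s) \<le> B * norm h" .
      qed
    qed (use x d in \<open>auto simp: P_def\<close>)
    also have "\<dots> \<le> 1/2 * norm h" using mult_right_mono[OF d(3) norm_ge_zero[of h]] by (simp add: mult.assoc)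
    finally show "norm (L x h) \<le> 1/2 * norm h" .
  qed simp
  define M where "M x = (SOME M. M o\<^sub>L (id_blinfun - L x) = id_blinfun \<and> (id_blinfun - L x) o\<^sub>L M = id_blinfun)" for x
  have M: "M x o\<^sub>L (id_blinfun - L x) = id_blinfun" "(id_blinfun - L x) o\<^sub>L M x = id_blinfun" if "x \<in> P" for x
    using someI_ex[OF contraction_resolvent[OF normL[OF that]], folded M_def] by auto
  have d\<phi>: "(\<phi> has_derivative (\<lambda>h. M x (A x h))) (at x)" if x: "x \<in> P" for x
  proof (rule fixed_point_has_derivative[where T = "\<lambda>y. T (fst y) (snd y)", OF _ P x _ \<phi>C _ M(1)[OF x]])
    show "T (fst (y, \<phi> y)) (snd (y, \<phi> y)) = \<phi> y" if "y \<in> P" for y using fp[OF that] by simp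
    show "norm (T (fst (y, \<phi> y)) (snd (y, \<phi> y)) - T (fst (y, \<phi> x)) (snd (y, \<phi> x))) \<le> 1/2 * norm (\<phi> y - \<phi> x)" if "y \<in> P" for y
      using con[OF that, of "\<phi> y" "\<phi> x"] by simp
    let ?W = "at (x, \<phi> x) within P \<times> C"
    have "(superpose f has_derivative superpose_deriv f (\<phi> x)) (at (\<phi> x) within snd ` (P \<times> C))"
      by (rule has_derivative_subset[OF superpose_has_derivative[OF f1 K(1-3)]]) (use inK[OF x] in \<open>auto simp: C_def\<close>)
    then have "(superpose f has_derivative superpose_deriv f (\<phi> x)) (at (snd (x, \<phi> x)) within snd ` (P \<times> C))"
      by (simp only: snd_conv)
    from diff_chain_within[OF has_derivative_snd[OF has_derivative_ident] this]
    have "((\<lambda>y. superpose f (snd y)) has_derivative (\<lambda>h. superpose_deriv f (\<phi> x) (snd h))) ?W"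
      by (simp add: o_def)
    from bounded_linear.has_derivative[OF bounded_linear_antideriv this]
    have s: "((\<lambda>y. antideriv (superpose f (snd y))) has_derivative (\<lambda>h. antideriv (superpose_deriv f (\<phi> x) (snd h)))) ?W" .
    have "((\<lambda>y. const_bcontfun (snd (fst y)) + fst (fst y) *\<^sub>R antideriv (superpose f (snd y))) has_derivative
        (\<lambda>h. const_bcontfun (snd (fst h)) + (fst x *\<^sub>R antideriv (superpose_deriv f (\<phi> x) (snd h))
          + fst (fst h) *\<^sub>R antideriv (superpose f (\<phi> x))))) ?W"
      using has_derivative_add[OF bounded_linear.has_derivative[OF bounded_linear_const_bcontfun
            has_derivative_snd[OF has_derivative_fst[OF has_derivative_ident]]]
          has_derivative_scaleR[OF has_derivative_fst[OF has_derivative_fst[OF has_derivative_ident]] s]]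
      by simp
    then have "((\<lambda>y. const_bcontfun (snd (fst y)) + fst (fst y) *\<^sub>R antideriv (superpose f (snd y))) has_derivative
        (\<lambda>h. A x (fst h) + L x (snd h))) ?W"
      by (simp add: A_def L_def J N blinfun.scaleR_left algebra_simps)
    then show "((\<lambda>y. T (fst y) (snd y)) has_derivative (\<lambda>h. A x (fst h) + L x (snd h))) ?W"
      by (rule has_derivative_transform[rotated 2]) (use \<phi>C[OF x] x spF in \<open>auto simp: T_def C_def\<close>)
  qed
  have "Ck_on k P \<phi>" for k
  proof (induction k)
    case 0
    show ?case using has_derivative_continuous_on[of P \<phi>, OF has_derivative_at_withinI[OF d\<phi>]] by simp
  next
    case (Suc k)
    have sp: "Ck_on k P (\<lambda>x. superpose g (\<phi> x))" if "smooth_on U g" for g :: "'b \<Rightarrow> 'b"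
      by (rule Ck_on_superpose[OF that K(1-3) P inK Suc])
    have CN: "Ck_on k P N"
      unfolding N_def
      by (intro Ck_on_sum P Ck_on_bounded_linear_comp[OF bounded_bilinear.bounded_linear_prod_left[OF
              bounded_bilinear_pointwise[OF bounded_bilinear_comp_scale]]] sp smooth_on_derivative f)
    have "Ck_on k P L"
      unfolding L_def
      by (rule bounded_bilinear.Ck_on_bilinear[OF bounded_bilinear_scaleR P Ck_on_bounded_linear[OF bounded_linear_fst P]
          bounded_bilinear.Ck_on_bilinear[OF bounded_bilinear_blinfun_compose P Ck_on_const[OF P] CN]])
    then have "Ck_on k P (\<lambda>x. id_blinfun + - L x)"
      by (intro Ck_on_add P Ck_on_const Ck_on_bounded_linear_comp[OF bounded_linear_minus[OF bounded_linear_ident]])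
    then have CM: "Ck_on k P M" by (rule Ck_on_blinfun_inverse[OF P]) (use M in auto)
    show ?case
    proof (rule Ck_on_SucI[OF P d\<phi>])
      fix v
      show "Ck_on k P (\<lambda>x. M x (A x v))"
        unfolding A_def
        by (intro bounded_bilinear.Ck_on_bilinear[OF bounded_bilinear_blinfun_apply P] CM Ck_on_add P Ck_on_const
            bounded_bilinear.Ck_on_bilinear[OF bounded_bilinear_scaleR P]
            Ck_on_bounded_linear_comp[OF bounded_linear_antideriv] sp f)
    qed
  qed
  then have smooth\<phi>: "smooth_on P \<phi>" by (simp add: smooth_on_def)
  define \<Phi> where "\<Phi> x = apply_bcontfun (\<phi> x) 1" for x
  show ?thesis
  proof (rule that[of d \<Phi>])
    show "d > 0" by fact
    show "smooth_on ({-d<..<d} \<times> ball p d) \<Phi>"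
      using smooth_on_bounded_linear_comp[OF bounded_linear_apply_bcontfun P smooth\<phi>] unfolding \<Phi>_def P_def .
    show "\<Phi> (0, z) = z" if "z \<in> ball p d" for z using eqn[of "(0, z)" 1] that d by (simp add: \<Phi>_def P_def)
    fix t z assume "\<bar>t\<bar> < d" "z \<in> ball p d"
    then have x: "(t, z) \<in> P" by (auto simp: P_def)
    show "\<Phi> (t, z) \<in> U" using inK[OF x] K(3) by (auto simp: \<Phi>_def)
    let ?\<phi> = "\<phi> (t, z)"
    have path: "(apply_bcontfun ?\<phi> has_vector_derivative t *\<^sub>R f (?\<phi> s)) (at s within {0..1})" if s: "s \<in> {0..1}" for s
    proof -
      have "((\<lambda>u. integral {0..u} (superpose F ?\<phi>)) has_vector_derivative superpose F ?\<phi> s) (at s within {0..1})"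
        using s by (intro integral_has_vector_derivative) auto
      then have "((\<lambda>u. z + t *\<^sub>R integral {0..u} (superpose F ?\<phi>)) has_vector_derivative t *\<^sub>R f (?\<phi> s)) (at s within {0..1})"
        by (auto intro!: derivative_eq_intros simp: apF Ff inK[OF x])
      then show ?thesis
        by (rule has_vector_derivative_transform[rotated 2]) (use s in \<open>auto simp: eqn[OF x] clamp01(2)\<close>)
    qed
    txt \<open>The function \<open>s \<mapsto> s f(\<phi> s)\<close> solves the fixed point equation of the time derivative.\<close>
    define \<beta> where "\<beta> = Bcontfun (\<lambda>s. clamp01 s *\<^sub>R f (?\<phi> (clamp01 s)))"
    have \<beta>: "\<beta> s = clamp01 s *\<^sub>R f (?\<phi> (clamp01 s))" for s
      unfolding \<beta>_def
    proof (subst apply_Bcontfun[where b = B])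
      show "continuous_on UNIV (\<lambda>s. clamp01 s *\<^sub>R f (?\<phi> (clamp01 s)))"
        using inK[OF x] by (intro continuous_intros continuous_clamp01 continuous_on_compose2[OF cf]
            continuous_on_compose2[OF continuous_on_apply_bcontfun]) auto
      have "norm (clamp01 s *\<^sub>R f (?\<phi> (clamp01 s))) \<le> 1 * B" for s
        unfolding norm_scaleR using clamp01(1)[of s] B(3)[OF inK[OF x]] by (intro mult_mono) auto
      then show "norm (clamp01 s *\<^sub>R f (?\<phi> (clamp01 s))) \<le> B" for s by simp
    qed simp
    \<comment> \<open>After rescaling, the path at \<open>s\<close> is the flow at time
      \<open>s * t\<close>, whose derivative in \<open>t\<close> should be \<open>s\<close> times
      the field; this is the origin of \<open>\<beta>\<close>. The equation is verified by
      integrating the derivative of \<open>\<beta>\<close>, and invertibility of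
      \<open>id_blinfun - L (t, z)\<close> then identifies \<open>\<beta>\<close> with the time
      derivative.\<close>
    have "\<beta> = A (t, z) (1, 0) + L (t, z) \<beta>"
    proof (rule bcontfun_eqI)
      fix s
      have deriv: "((\<lambda>s. s *\<^sub>R f (?\<phi> s)) has_vector_derivative (superpose f ?\<phi> + t *\<^sub>R N (t, z) \<beta>) u) (at u within {0..1})"
        if u: "u \<in> {0..1}" for u
      proof -
        let ?D = "frechet_derivative f (at (?\<phi> u))"
        have fd: "(f has_derivative ?D) (at (?\<phi> u) within apply_bcontfun ?\<phi> ` {0..1})"
          using Ck_on_has_derivative[OF f1', of "?\<phi> u"] inK[OF x] K(3) by (blast intro: has_derivative_at_withinI)
        have "((f \<circ> ?\<phi>) has_vector_derivative ?D (t *\<^sub>R f (?\<phi> u))) (at u within {0..1})"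
          by (rule vector_derivative_diff_chain_within[OF path[OF u] fd])
        then have "((\<lambda>s. s *\<^sub>R f (?\<phi> s)) has_vector_derivative
            (u *\<^sub>R ?D (t *\<^sub>R f (?\<phi> u)) + 1 *\<^sub>R f (?\<phi> u))) (at u within {0..1})"
          using has_vector_derivative_scaleR[of "\<lambda>s. s" 1 u "{0..1}" "\<lambda>s. f (?\<phi> s)"] by (simp add: o_def)
        moreover have "(superpose f ?\<phi> + t *\<^sub>R N (t, z) \<beta>) u = u *\<^sub>R ?D (t *\<^sub>R f (?\<phi> u)) + 1 *\<^sub>R f (?\<phi> u)"
          using linear_scale[OF has_derivative_linear[OF fd]] u
          by (simp add: N apply_superpose_deriv[OF f1 K(1,3) inK[OF x]] apply_superpose[OF cf K(1) inK[OF x]] \<beta> clamp01(2))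
        ultimately show ?thesis by simp
      qed
      have "((superpose f ?\<phi> + t *\<^sub>R N (t, z) \<beta>) has_integral
          (clamp01 s *\<^sub>R f (?\<phi> (clamp01 s)) - 0 *\<^sub>R f (?\<phi> 0))) {0..clamp01 s}"
      proof (rule fundamental_theorem_of_calculus)
        show "0 \<le> clamp01 s" using clamp01(1)[of s] by simp
        fix u assume u: "u \<in> {0..clamp01 s}"
        then have "u \<in> {0..1}" using clamp01(1)[of s] by auto
        from has_vector_derivative_within_subset[OF deriv[OF this]]
        show "((\<lambda>s. s *\<^sub>R f (?\<phi> s)) has_vector_derivative (superpose f ?\<phi> + t *\<^sub>R N (t, z) \<beta>) u) (at u within {0..clamp01 s})"
          using clamp01(1)[of s] by auto
      qed
      then have "\<beta> s = antideriv (superpose f ?\<phi> + t *\<^sub>R N (t, z) \<beta>) s"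
        unfolding apply_antideriv \<beta> by (simp add: integral_unique)
      also have "\<dots> = (A (t, z) (1, 0) + L (t, z) \<beta>) s"
        by (simp add: linear_add[OF bounded_linear.linear[OF bounded_linear_antideriv]]
          linear_scale[OF bounded_linear.linear[OF bounded_linear_antideriv]] A_def L_def J blinfun.scaleR_left)
      finally show "\<beta> s = (A (t, z) (1, 0) + L (t, z) \<beta>) s" .
    qed
    then have "A (t, z) (1, 0) = (id_blinfun - L (t, z)) \<beta>" by (simp add: blinfun.diff_left algebra_simps)
    then have "M (t, z) (A (t, z) (1, 0)) = \<beta>"
      using M(1)[OF x] by (metis blinfun_apply_blinfun_compose blinfun_apply_id_blinfun)
    moreover have "(\<Phi> has_derivative (\<lambda>h. M (t, z) (A (t, z) h) 1)) (at (t, z))"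
      unfolding \<Phi>_def using bounded_linear.has_derivative[OF bounded_linear_apply_bcontfun d\<phi>[OF x]] .
    ultimately show "frechet_derivative \<Phi> (at (t, z)) (1, 0) = f (\<Phi> (t, z))"
      by (simp add: frechet_derivative_eq \<beta> clamp01(2) \<Phi>_def)
  qed
qed

section \<open>The torsions at a point\<close>

text \<open>The torsions of an operator with value \<open>L\<close> and directional derivatives \<open>D v\<close> at a given point.\<close>

definition nij :: "('b::real_normed_vector \<Rightarrow>\<^sub>L 'b) \<Rightarrow> ('b \<Rightarrow> 'b \<Rightarrow>\<^sub>L 'b) \<Rightarrow> 'b \<Rightarrow> 'b \<Rightarrow> 'b" where
  "nij L D x y = D (L x) y - D (L y) x - L (D x y) + L (D y x)"

definition haa :: "('b::real_normed_vector \<Rightarrow>\<^sub>L 'b) \<Rightarrow> ('b \<Rightarrow> 'b \<Rightarrow>\<^sub>L 'b) \<Rightarrow> 'b \<Rightarrow> 'b \<Rightarrow> 'b" where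
  "haa L D x y = L (L (nij L D x y)) + nij L D (L x) (L y) - L (nij L D (L x) y) - L (nij L D x (L y))"

lemma haa_linear_antisym:
  fixes D :: "'b::real_normed_vector \<Rightarrow> 'b \<Rightarrow>\<^sub>L 'b"
  assumes D: "linear D"
  shows "haa L D (x + y) z = haa L D x z + haa L D y z"
    and "haa L D (r *\<^sub>R x) z = r *\<^sub>R haa L D x z"
    and "haa L D x y = - haa L D y x"
  by (simp_all add: haa_def nij_def blinfun.bilinear_simps linear_add[OF D] linear_scale[OF D] algebra_simps)

text \<open>\<open>haa\<close> arises from \<open>nij\<close> by applying (operator on the value
  minus operator on an argument) for each of the two arguments, and in these differences
  \<open>l\<close> cancels. The shift adds \<alpha>(Nx)y - \<alpha>(Ny)x - \<alpha>(x)Ny +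
  \<alpha>(y)Nx to \<open>nij\<close>; each term is a scalar in one argument times a power of N in
  the other, so one of the two differences annihilates it.\<close>

lemma haa_shift:
  fixes D :: "'b::real_normed_vector \<Rightarrow> 'b \<Rightarrow>\<^sub>L 'b"
  assumes D: "linear D" and \<alpha>: "linear \<alpha>"
  shows "haa (N + l *\<^sub>R id_blinfun) (\<lambda>v. D v + \<alpha> v *\<^sub>R id_blinfun) x y = haa N D x y"
  by (simp add: haa_def nij_def blinfun.bilinear_simps linear_add[OF D] linear_scale[OF D]
     linear_add[OF \<alpha>] linear_scale[OF \<alpha>] algebra_simps)

text \<open>\<open>DN\<close> is the derivative of N^3 = 0. For constant \<open>x\<close>, the
  bracket of N^2 x and N x is \<open>D (N (N x)) x - D (N x) (N x)\<close> modulo ker N^2. The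
  coefficient 3: the term with \<open>D (N x) (N x)\<close> occurs once directly and twice through
  \<open>N (D (N x) (N (N x)))\<close>; the term with \<open>D (N (N x)) x\<close> occurs twice
  directly and once more through \<open>DN\<close>.\<close>

lemma haa_nilpotent:
  fixes N :: "'b::real_normed_vector \<Rightarrow>\<^sub>L 'b" and D :: "'b \<Rightarrow> 'b \<Rightarrow>\<^sub>L 'b"
  assumes D: "linear D" and N: "\<And>x. N (N (N x)) = 0"
    and DN: "\<And>v x. D v (N (N x)) + N (D v (N x)) + N (N (D v x)) = 0"
  shows "haa N D x (N x) = 3 *\<^sub>R N (N (D (N x) (N x) - D (N (N x)) x))"
    and "haa N D x (N (N x)) = 0" and "haa N D (N x) (N (N x)) = 0"
proof -
  have 1: "D v (N (N x)) = - N (D v (N x)) - N (N (D v x))" for v x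
    using DN[of v x] by (simp add: algebra_simps eq_neg_iff_add_eq_0)
  have 2: "N (N (D v (N x))) = - N (D v (N (N x)))" for v x
    using arg_cong[OF DN[of v x], of "blinfun_apply N"] by (simp add: blinfun.bilinear_simps N algebra_simps eq_neg_iff_add_eq_0)
  have 3: "N (N (D v (N (N x)))) = 0" for v x
    using arg_cong[OF DN[of v x], of "\<lambda>z. N (N z)"] by (simp add: blinfun.bilinear_simps N)
  have D0: "D 0 = 0" using linear_0[OF D] .
  have *: "r *\<^sub>R (a :: 'b) = a + a + a" if "r = 3" for r a
    using that by (metis (no_types) one_add_one scaleR_add_left scaleR_one add_numeral_special(3) numeral_plus_one semiring_norm(5))
  show "haa N D x (N x) = 3 *\<^sub>R N (N (D (N x) (N x) - D (N (N x)) x))"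
    unfolding *[OF refl]
    by (simp add: haa_def nij_def blinfun.bilinear_simps N D0)
       (use DN[of "N (N x)" x] 2[of "N x" x] in \<open>simp add: blinfun.bilinear_simps N 3 algebra_simps\<close>)
  show "haa N D x (N (N x)) = 0"
    using 2[of "N (N x)" x]
    by (simp add: haa_def nij_def blinfun.bilinear_simps N D0 3)
  show "haa N D (N x) (N (N x)) = 0"
    by (simp add: haa_def nij_def blinfun.bilinear_simps N D0 3)
qed

text \<open>Applying N^2, and after that N, to a vanishing combination isolates one coefficient at a
  time. The basis is ordered along the flag, so that the map will be the derivative of the
  straightening map at the origin.\<close>

lemma nilpotent_basis:
  fixes N :: "(real ^ 3) \<Rightarrow>\<^sub>L (real ^ 3)"
  assumes N: "\<And>x. N (N (N x)) = 0" and \<xi>: "N (N \<xi>) \<noteq> 0"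
  shows "inj (\<lambda>v :: real ^ 3. (v $ 1) *\<^sub>R N (N \<xi>) + (v $ 2) *\<^sub>R N \<xi> + (v $ 3) *\<^sub>R \<xi>)"
    and "\<exists>a b c. x = a *\<^sub>R N (N \<xi>) + b *\<^sub>R N \<xi> + c *\<^sub>R \<xi>"
proof -
  let ?f = "\<lambda>v :: real ^ 3. (v $ 1) *\<^sub>R N (N \<xi>) + (v $ 2) *\<^sub>R N \<xi> + (v $ 3) *\<^sub>R \<xi>"
  have lin: "linear ?f" by (rule linearI) (simp_all add: algebra_simps)
  show inj: "inj ?f"
  proof (rule linear_injective_0[OF lin, THEN iffD2], intro allI impI)
    fix v assume v: "?f v = 0"
    have "N (N (?f v)) = 0" using v by simp
    then have 3: "v $ 3 = 0" using \<xi> by (simp add: blinfun.bilinear_simps N)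
    have "N (?f v) = 0" using v by simp
    then have 2: "v $ 2 = 0" using \<xi> 3 by (simp add: blinfun.bilinear_simps N)
    have 1: "v $ 1 = 0" using v 2 3 \<xi> by simp
    show "v = 0" using 1 2 3 by (simp add: vec_eq_iff forall_3)
  qed
  have "surj ?f" by (rule linear_injective_imp_surjective[OF lin inj]) (rule refl)
  then show "\<exists>a b c. x = a *\<^sub>R N (N \<xi>) + b *\<^sub>R N \<xi> + c *\<^sub>R \<xi>" using surjD[of ?f x] by blast
qed

text \<open>Bilinearity and antisymmetry leave three pairs of basis vectors; two of them vanish by
  nilpotency, and \<open>z\<close> settles the third.\<close>

lemma haa_eq_0:
  fixes N :: "(real ^ 3) \<Rightarrow>\<^sub>L (real ^ 3)" and D :: "real ^ 3 \<Rightarrow> (real ^ 3) \<Rightarrow>\<^sub>L (real ^ 3)"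
  assumes D: "linear D" and N: "\<And>x. N (N (N x)) = 0" and \<xi>: "N (N \<xi>) \<noteq> 0"
    and DN: "\<And>v x. D v (N (N x)) + N (D v (N x)) + N (N (D v x)) = 0"
    and z: "N (N (D (N \<xi>) (N \<xi>) - D (N (N \<xi>)) \<xi>)) = 0"
  shows "haa N D x y = 0"
proof -
  note anti = haa_linear_antisym(3)[OF D, of N] and add = haa_linear_antisym(1,2)[OF D, of N]
  have diag: "haa N D v v = 0" for v
  proof -
    have "2 *\<^sub>R haa N D v v = 0" using anti[of v v] unfolding scaleR_2 by (metis right_minus)
    then show ?thesis by simp
  qed
  have p: "haa N D \<xi> (N \<xi>) = 0" "haa N D \<xi> (N (N \<xi>)) = 0" "haa N D (N \<xi>) (N (N \<xi>)) = 0"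
    using haa_nilpotent[OF D N DN, of \<xi>] z by simp_all
  have m: "haa N D (N \<xi>) \<xi> = 0" "haa N D (N (N \<xi>)) \<xi> = 0" "haa N D (N (N \<xi>)) (N \<xi>) = 0"
    using p by (simp_all add: anti[of "N \<xi>" \<xi>] anti[of "N (N \<xi>)" \<xi>] anti[of "N (N \<xi>)" "N \<xi>"])
  have *: "haa N D x \<zeta> = 0" if "haa N D (N (N \<xi>)) \<zeta> = 0" "haa N D (N \<xi>) \<zeta> = 0" "haa N D \<xi> \<zeta> = 0" for x \<zeta>
  proof -
    obtain a b c where "x = a *\<^sub>R N (N \<xi>) + b *\<^sub>R N \<xi> + c *\<^sub>R \<xi>" using nilpotent_basis(2)[of N, OF N \<xi>] by blast
    then show ?thesis using that by (simp add: add)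
  qed
  have b: "haa N D z (N (N \<xi>)) = 0" "haa N D z (N \<xi>) = 0" "haa N D z \<xi> = 0" for z
    by (rule *[OF diag p(3,2)], rule *[OF m(3) diag p(1)], rule *[OF m(2,1) diag])
  show ?thesis
    by (rule *) (use b[of y] anti[of "N (N \<xi>)" y] anti[of "N \<xi>" y] anti[of \<xi> y] in simp_all)
qed

text \<open>For a single block the image of N is ker N^2. A nonzero covector that vanishes on this
  plane cannot vanish on \<open>\<xi>\<close>, so the plane is its whole kernel.\<close>

lemma nilpotent_square_eq_0_of_covector:
  fixes N :: "(real ^ 3) \<Rightarrow>\<^sub>L (real ^ 3)" and \<omega> :: "real ^ 3 \<Rightarrow> real"
  assumes N: "\<And>x. N (N (N x)) = 0" and \<xi>: "N (N \<xi>) \<noteq> 0"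
    and \<omega>: "linear \<omega>" "\<omega> v \<noteq> 0" "\<And>x. \<omega> (N x) = 0"
    and z: "\<omega> z = 0"
  shows "N (N z) = 0"
proof -
  obtain a b c where z': "z = a *\<^sub>R N (N \<xi>) + b *\<^sub>R N \<xi> + c *\<^sub>R \<xi>" using nilpotent_basis(2)[of N, OF N \<xi>] by blast
  obtain a' b' c' where v': "v = a' *\<^sub>R N (N \<xi>) + b' *\<^sub>R N \<xi> + c' *\<^sub>R \<xi>" using nilpotent_basis(2)[of N, OF N \<xi>] by blast
  have "\<omega> \<xi> \<noteq> 0" using \<omega>(2) by (auto simp: v' linear_add[OF \<omega>(1)] linear_scale[OF \<omega>(1)] \<omega>(3))
  moreover have "c * \<omega> \<xi> = 0" using z by (simp add: z' linear_add[OF \<omega>(1)] linear_scale[OF \<omega>(1)] \<omega>(3))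
  ultimately show ?thesis by (simp add: z' blinfun.bilinear_simps N)
qed

lemma derivative_nilpotent:
  fixes N :: "'a::euclidean_space \<Rightarrow> 'b::real_normed_vector \<Rightarrow>\<^sub>L 'b" and D :: "'a \<Rightarrow> 'b \<Rightarrow>\<^sub>L 'b"
  assumes V: "open V" "q \<in> V" and N: "\<And>q x. q \<in> V \<Longrightarrow> N q (N q (N q x)) = 0"
    and d: "(N has_derivative D) (at q)"
  shows "D v (N q (N q x)) + N q (D v (N q x)) + N q (N q (D v x)) = 0"
proof -
  note b = bounded_bilinear.FDERIV[OF bounded_bilinear_blinfun_apply d]
  have "((\<lambda>q. N q (N q (N q x))) has_derivative
      (\<lambda>v. N q (N q (N q 0 + D v x) + D v (N q x)) + D v (N q (N q x)))) (at q)"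
    by (rule b[OF b[OF b[OF has_derivative_const]]])
  moreover have "((\<lambda>q. N q (N q (N q x))) has_derivative (\<lambda>v. 0)) (at q)"
    by (rule has_derivative_transform_within_open[OF has_derivative_const V]) (simp add: N)
  ultimately have "(\<lambda>v. N q (N q (N q 0 + D v x) + D v (N q x)) + D v (N q (N q x))) = (\<lambda>v. 0)"
    by (rule has_derivative_unique)
  from fun_cong[OF this, of v] show ?thesis by (simp add: blinfun.bilinear_simps algebra_simps)
qed

section \<open>Straightening the flag of a nilpotent operator field\<close>

text \<open>With an antiderivative \<open>C\<close> of \<open>c\<close>, the product of
  \<open>g\<close> and the integrating factor \<open>exp (- C s)\<close> is constant. The zero
  \<open>s0\<close> may be at either end of the interval.\<close>

lemma linear_ode_zero:
  fixes g c :: "real \<Rightarrow> real"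
  assumes g: "\<And>s. s \<in> {a..b} \<Longrightarrow> (g has_real_derivative c s * g s) (at s within {a..b})"
    and c: "continuous_on {a..b} c" and s: "s0 \<in> {a..b}" "g s0 = 0" "s \<in> {a..b}"
  shows "g s = 0"
proof -
  obtain C where C: "\<And>x. x \<in> {a..b} \<Longrightarrow> (C has_vector_derivative c x) (at x within {a..b})"
    using antiderivative_continuous[OF c] by metis
  have "((\<lambda>s. g s * exp (- C s)) has_real_derivative 0) (at x within {a..b})" if "x \<in> {a..b}" for x
  proof -
    have "(C has_real_derivative c x) (at x within {a..b})"
      using C[OF that] by (simp add: has_real_derivative_iff_has_vector_derivative)
    note [derivative_intros] = this g[OF that]
    show ?thesis by (auto intro!: derivative_eq_intros simp: algebra_simps)
  qed
  then obtain k where "\<And>x. x \<in> {a..b} \<Longrightarrow> g x * exp (- C x) = k"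
    using has_field_derivative_zero_constant[of "{a..b}" "\<lambda>s. g s * exp (- C s)"] by auto
  from this[OF s(1)] this[OF s(3)] show ?thesis using s(2) by simp
qed

text \<open>Meant for maps that agree only on a slice: agreement along one line through
  \<open>x\<close> already determines the derivative in its direction.\<close>

lemma directional_derivative_cong:
  assumes f: "(f has_derivative f') (at x)" and g: "(g has_derivative g') (at x)"
    and e: "e > 0" "\<And>s. \<bar>s\<bar> < e \<Longrightarrow> f (x + s *\<^sub>R v) = g (x + s *\<^sub>R v)"
  shows "f' v = g' v"
proof -
  have l: "((\<lambda>s. x + s *\<^sub>R v) has_derivative (\<lambda>s. s *\<^sub>R v)) (at 0)" by (auto intro!: derivative_eq_intros)
  have *: "((\<lambda>s. h (x + s *\<^sub>R v)) has_derivative (\<lambda>s. h' (s *\<^sub>R v))) (at 0)" if "(h has_derivative h') (at x)" for h h'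
    using diff_chain_at[OF l, of h h'] that by (simp add: o_def)
  have "((\<lambda>s. g (x + s *\<^sub>R v)) has_derivative (\<lambda>s. f' (s *\<^sub>R v))) (at 0)"
    by (rule has_derivative_transform_within_open[OF *[OF f], of "{-e<..<e}"]) (use e in auto)
  from has_derivative_unique[OF this *[OF g]] show ?thesis by (metis scaleR_one)
qed

theorem straighten_flag:
  fixes N :: "real ^ 3 \<Rightarrow> (real ^ 3) \<Rightarrow>\<^sub>L (real ^ 3)"
  assumes V: "open V" "p \<in> V" and N: "smooth_on V N"
    and nil: "\<And>q x. q \<in> V \<Longrightarrow> N q (N q (N q x)) = 0" and \<xi>: "N p (N p \<xi>) \<noteq> 0"
    and invol: "\<And>q. q \<in> V \<Longrightarrow>
      N q (N q (frechet_derivative N (at q) (N q \<xi>) (N q \<xi>) - frechet_derivative N (at q) (N q (N q \<xi>)) \<xi>)) = 0"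
  obtains U W and \<Psi> G :: "real ^ 3 \<Rightarrow> real ^ 3" where "open U" "open W" "p \<in> W" "W \<subseteq> V" "homeomorphism U W \<Psi> G"
    "smooth_on U \<Psi>" "smooth_on W G"
    "\<And>t. t \<in> U \<Longrightarrow> N (\<Psi> t) (frechet_derivative \<Psi> (at t) (axis 1 1)) = 0"
    "\<And>t. t \<in> U \<Longrightarrow> N (\<Psi> t) (N (\<Psi> t) (frechet_derivative \<Psi> (at t) (axis 2 1))) = 0"
proof -
  define D where "D q = frechet_derivative N (at q)" for q
  have dN: "(N has_derivative D q) (at q)" if "q \<in> V" for q
    unfolding D_def using smooth_on_has_derivative[OF N that] .
  have linD: "linear (D q)" if "q \<in> V" for q using has_derivative_linear[OF dN[OF that]] .
  have DN: "D q v (N q (N q x)) + N q (D q v (N q x)) + N q (N q (D q v x)) = 0" if "q \<in> V" for q v x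
    by (rule derivative_nilpotent[OF V(1) that nil dN[OF that]])
  \<comment> \<open>A fixed vector for detecting N^2: wherever \<open>\<eta> \<bullet> e1 q\<close>
    is nonzero, N^2 has rank one with image spanned by \<open>e1 q\<close>, so the vanishing of N^2
    w can be tested by its inner product with \<open>\<eta>\<close>.\<close>
  define \<eta> where "\<eta> = N p (N p \<xi>)"
  define e1 where "e1 q = N q (N q \<xi>)" for q
  define e2 where "e2 q = N q \<xi>" for q
  note bl = bounded_bilinear.smooth_on_bilinear[OF bounded_bilinear_blinfun_apply]
  have sm2: "smooth_on V e2" unfolding e2_def by (intro bl V(1) N smooth_on_const)
  have sm1: "smooth_on V e1" unfolding e1_def by (intro bl V(1) N smooth_on_const)
  define V1 where "V1 = {q \<in> V. \<eta> \<bullet> e1 q \<noteq> 0}"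
  have cont1: "continuous_on V (\<lambda>q. \<eta> \<bullet> e1 q)"
    using smooth_on_continuous[OF sm1] by (intro continuous_intros)
  have V1: "open V1"
  proof -
    have "V1 = V \<inter> (\<lambda>q. \<eta> \<bullet> e1 q) -` (- {0})" by (auto simp: V1_def)
    then show ?thesis using continuous_open_preimage[OF cont1 V(1), of "- {0}"] by (simp add: open_Compl)
  qed
  have pV1: "p \<in> V1" using V \<xi> by (simp add: V1_def e1_def \<eta>_def)
  have V1V: "V1 \<subseteq> V" by (auto simp: V1_def)
  obtain d1 \<Phi>1 where d1: "d1 > 0" and s1: "smooth_on ({-d1<..<d1} \<times> ball p d1) \<Phi>1"
    and i1: "\<And>z. z \<in> ball p d1 \<Longrightarrow> \<Phi>1 (0, z) = z"
    and m1: "\<And>t z. \<bar>t\<bar> < d1 \<Longrightarrow> z \<in> ball p d1 \<Longrightarrow> \<Phi>1 (t, z) \<in> V1"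
    and f1: "\<And>t z. \<bar>t\<bar> < d1 \<Longrightarrow> z \<in> ball p d1 \<Longrightarrow> frechet_derivative \<Phi>1 (at (t, z)) (1, 0) = e1 (\<Phi>1 (t, z))"
    using smooth_local_flow[OF V1 pV1 smooth_on_subset[OF sm1 V1V]] by metis
  \<comment> \<open>The flow of \<open>e2\<close> is confined to points from which the flow of
    \<open>e1\<close> may start.\<close>
  define V2 where "V2 = V1 \<inter> ball p d1"
  have V2: "open V2" "p \<in> V2" "V2 \<subseteq> V" using V1 pV1 d1 V1V by (auto simp: V2_def)
  obtain d2 \<Phi>2 where d2: "d2 > 0" and s2: "smooth_on ({-d2<..<d2} \<times> ball p d2) \<Phi>2"
    and i2: "\<And>z. z \<in> ball p d2 \<Longrightarrow> \<Phi>2 (0, z) = z"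
    and m2: "\<And>t z. \<bar>t\<bar> < d2 \<Longrightarrow> z \<in> ball p d2 \<Longrightarrow> \<Phi>2 (t, z) \<in> V2"
    and f2: "\<And>t z. \<bar>t\<bar> < d2 \<Longrightarrow> z \<in> ball p d2 \<Longrightarrow> frechet_derivative \<Phi>2 (at (t, z)) (1, 0) = e2 (\<Phi>2 (t, z))"
    using smooth_local_flow[OF V2(1,2) smooth_on_subset[OF sm2 V2(3)]] by metis
  \<comment> \<open>The quotient by \<open>norm \<xi> + 1\<close> keeps
    \<open>p + (t $ 3) *\<^sub>R \<xi>\<close> in the domain of the second flow.\<close>
  define d where "d = min d1 (min d2 (d2 / (norm \<xi> + 1)))"
  have npos: "norm \<xi> + 1 > 0" by (smt (verit) norm_ge_zero)
  have d: "d > 0" "d \<le> d1" "d \<le> d2" "d * (norm \<xi> + 1) \<le> d2"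
  proof -
    show "d > 0" using d1 d2 npos by (simp add: d_def)
    show "d \<le> d1" "d \<le> d2" by (auto simp: d_def)
    have "d \<le> d2 / (norm \<xi> + 1)" by (auto simp: d_def)
    then show "d * (norm \<xi> + 1) \<le> d2" using npos by (simp add: pos_le_divide_eq)
  qed
  define B where "B = ball (0 :: real ^ 3) d"
  have B: "open B" "0 \<in> B" using d by (auto simp: B_def)
  have Bi: "\<bar>t $ i\<bar> < d" if "t \<in> B" for t i
    using that component_le_norm_cart[of t i] by (simp add: B_def)
  \<comment> \<open>A line along \<open>\<xi>\<close>, followed by the flow of \<open>e2\<close> and
    by the flow of \<open>e1\<close>. The outermost flow gives the first coordinate vector
    everywhere; the second one is known only where \<open>t $ 1 = 0\<close>.\<close>
  define \<sigma> where "\<sigma> t = p + (t $ 3) *\<^sub>R \<xi>" for t :: "real ^ 3"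
  define \<rho> where "\<rho> t = \<Phi>2 (t $ 2, \<sigma> t)" for t :: "real ^ 3"
  define \<Psi> where "\<Psi> t = \<Phi>1 (t $ 1, \<rho> t)" for t :: "real ^ 3"
  have bln: "bounded_linear (\<lambda>t :: real ^ 3. t $ i)" for i by (rule bounded_linear_vec_nth)
  have \<sigma>d: "(\<sigma> has_derivative (\<lambda>v. (v $ 3) *\<^sub>R \<xi>)) (at t)" for t
    unfolding \<sigma>_def by (auto intro!: derivative_eq_intros bounded_linear_imp_has_derivative bln)
  have sm\<sigma>: "smooth_on B \<sigma>"
    unfolding \<sigma>_def by (intro smooth_on_add smooth_on_scaleR smooth_on_const smooth_on_bounded_linear bln B)
  have in\<sigma>: "\<sigma> t \<in> ball p d2" if "t \<in> B" for t
  proof -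
    have "norm ((t $ 3) *\<^sub>R \<xi>) \<le> d * norm \<xi>" using Bi[OF that, of 3] by (simp add: mult_right_mono)
    also have "\<dots> < d2" using d by (simp add: algebra_simps)
    finally show ?thesis by (simp add: \<sigma>_def dist_norm)
  qed
  have in2: "(t $ 2, \<sigma> t) \<in> {-d2<..<d2} \<times> ball p d2" if "t \<in> B" for t
    using in\<sigma>[OF that] Bi[OF that, of 2] d by (auto simp: abs_less_iff)
  have sm\<rho>: "smooth_on B \<rho>"
    unfolding \<rho>_def
    by (rule smooth_on_compose[OF B(1) _ in2 smooth_on_Pair[OF B(1) smooth_on_bounded_linear[OF bln B(1)] sm\<sigma>] s2])
      (intro open_Times open_greaterThanLessThan open_ball)
  have in\<rho>: "\<rho> t \<in> V2" if "t \<in> B" for t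
    unfolding \<rho>_def using m2[OF _ in\<sigma>[OF that]] Bi[OF that, of 2] d by simp
  have in1: "(t $ 1, \<rho> t) \<in> {-d1<..<d1} \<times> ball p d1" if "t \<in> B" for t
    using in\<rho>[OF that] Bi[OF that, of 1] d by (auto simp: V2_def abs_less_iff)
  have sm\<Psi>: "smooth_on B \<Psi>"
    unfolding \<Psi>_def
    by (rule smooth_on_compose[OF B(1) _ in1 smooth_on_Pair[OF B(1) smooth_on_bounded_linear[OF bln B(1)] sm\<rho>] s1])
      (intro open_Times open_greaterThanLessThan open_ball)
  have in\<Psi>: "\<Psi> t \<in> V1" if "t \<in> B" for t
    unfolding \<Psi>_def using m1[of "t $ 1" "\<rho> t"] in\<rho>[OF that] Bi[OF that, of 1] d by (auto simp: V2_def)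
  then have in\<Psi>V: "\<Psi> t \<in> V" if "t \<in> B" for t using that V1V by blast
  have d\<rho>: "(\<rho> has_derivative frechet_derivative \<rho> (at t)) (at t)"
    and d\<Psi>: "(\<Psi> has_derivative frechet_derivative \<Psi> (at t)) (at t)" if "t \<in> B" for t
    using smooth_on_has_derivative[OF sm\<rho> that] smooth_on_has_derivative[OF sm\<Psi> that] by auto
  have ax: "axis i (1::real) $ j = (if i = j then 1 else 0)" for i j :: 3 by (simp add: axis_def)
  have n123: "(1::3) \<noteq> 2" "(1::3) \<noteq> 3" "(2::3) \<noteq> 3" "(2::3) \<noteq> 1" "(3::3) \<noteq> 1" "(3::3) \<noteq> 2" by auto
  have chain\<rho>: "frechet_derivative \<rho> (at t) v =
      frechet_derivative \<Phi>2 (at (t $ 2, \<sigma> t)) (v $ 2, (v $ 3) *\<^sub>R \<xi>)" if "t \<in> B" for t v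
  proof -
    have "((\<lambda>t. (t $ 2, \<sigma> t)) has_derivative (\<lambda>v. (v $ 2, (v $ 3) *\<^sub>R \<xi>))) (at t)"
      by (intro has_derivative_Pair bounded_linear_imp_has_derivative bln \<sigma>d)
    from diff_chain_at[OF this smooth_on_has_derivative[OF s2 in2[OF that]]]
    have "(\<rho> has_derivative (\<lambda>v. frechet_derivative \<Phi>2 (at (t $ 2, \<sigma> t)) (v $ 2, (v $ 3) *\<^sub>R \<xi>))) (at t)"
      by (simp add: o_def \<rho>_def[abs_def])
    from frechet_derivative_eq[OF this] show ?thesis by simp
  qed
  have \<rho>2: "frechet_derivative \<rho> (at t) (axis 2 1) = e2 (\<rho> t)" if "t \<in> B" for t
    using chain\<rho>[OF that] f2[OF _ in\<sigma>[OF that], of "t $ 2"] Bi[OF that, of 2] d by (simp add: ax n123 \<rho>_def)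
  have \<rho>1: "frechet_derivative \<rho> (at t) (axis 1 1) = 0" if "t \<in> B" for t
    using chain\<rho>[OF that, of "axis 1 1"] linear_0[OF has_derivative_linear[OF smooth_on_has_derivative[OF s2 in2[OF that]]]]
    by (simp add: ax n123 zero_prod_def)
  have \<Psi>1: "frechet_derivative \<Psi> (at t) (axis 1 1) = e1 (\<Psi> t)" if "t \<in> B" for t
  proof -
    have "((\<lambda>t. (t $ 1, \<rho> t)) has_derivative (\<lambda>v. (v $ 1, frechet_derivative \<rho> (at t) v))) (at t)"
      by (intro has_derivative_Pair bounded_linear_imp_has_derivative bln d\<rho> that)
    from diff_chain_at[OF this smooth_on_has_derivative[OF s1 in1[OF that]]]
    have "(\<Psi> has_derivative (\<lambda>v. frechet_derivative \<Phi>1 (at (t $ 1, \<rho> t)) (v $ 1, frechet_derivative \<rho> (at t) v))) (at t)"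
      by (simp add: o_def \<Psi>_def[abs_def])
    from fun_cong[OF frechet_derivative_eq[OF this], of "axis 1 1"] \<rho>1[OF that] show ?thesis
      using f1[of "t $ 1" "\<rho> t"] in1[OF that] Bi[OF that, of 1] d by (simp add: ax n123 \<Psi>_def)
  qed
  have near: "\<exists>e>0. \<forall>s. \<bar>s\<bar> < e \<longrightarrow> t + s *\<^sub>R v \<in> B" if "t \<in> B" for t v
  proof -
    have "open ((\<lambda>s. t + s *\<^sub>R v) -` B)" by (intro open_vimage B(1) continuous_intros)
    moreover have "0 \<in> (\<lambda>s. t + s *\<^sub>R v) -` B" using that by simp
    ultimately obtain e where "e > 0" "ball 0 e \<subseteq> (\<lambda>s. t + s *\<^sub>R v) -` B" using open_contains_ball by blast
    then show ?thesis by (intro exI[of _ e]) (auto simp: subset_iff dist_norm)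
  qed
  have \<Psi>\<rho>: "frechet_derivative \<Psi> (at t) v = frechet_derivative \<rho> (at t) v" if t: "t \<in> B" "t $ 1 = 0" "v $ 1 = 0" for t v
  proof -
    obtain e where e: "e > 0" "\<And>s. \<bar>s\<bar> < e \<Longrightarrow> t + s *\<^sub>R v \<in> B" using near[OF t(1)] by blast
    show ?thesis
      by (rule directional_derivative_cong[OF d\<Psi>[OF t(1)] d\<rho>[OF t(1)] e(1)])
        (use e(2) t in\<rho> i1 in \<open>auto simp: \<Psi>_def V2_def\<close>)
  qed
  have \<rho>3: "frechet_derivative \<rho> (at 0) (axis 3 1) = \<xi>"
  proof -
    obtain e where e: "e > 0" "\<And>s. \<bar>s\<bar> < e \<Longrightarrow> 0 + s *\<^sub>R axis 3 1 \<in> B" using near[OF B(2)] by blast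
    have "frechet_derivative \<rho> (at 0) (axis 3 1) = ((axis 3 1 :: real ^ 3) $ 3) *\<^sub>R \<xi>"
      by (rule directional_derivative_cong[OF d\<rho>[OF B(2)] \<sigma>d e(1)])
        (use e(2) in\<sigma> i2 in \<open>auto simp: \<rho>_def ax n123\<close>)
    then show ?thesis by (simp add: ax)
  qed
  have \<Psi>0: "\<Psi> 0 = p" "\<rho> 0 = p" using i1[of "\<rho> 0"] i2[of p] in\<rho>[OF B(2)] d1 d2 by (auto simp: \<Psi>_def \<rho>_def \<sigma>_def V2_def)
  have D\<Psi>0: "frechet_derivative \<Psi> (at 0) v = (v $ 1) *\<^sub>R N p (N p \<xi>) + (v $ 2) *\<^sub>R N p \<xi> + (v $ 3) *\<^sub>R \<xi>" for v
  proof -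
    note l = has_derivative_linear[OF d\<Psi>[OF B(2)]]
    have "v = (v $ 1) *\<^sub>R axis 1 1 + (v $ 2) *\<^sub>R axis 2 1 + (v $ 3) *\<^sub>R axis 3 1"
      by (simp add: vec_eq_iff forall_3 ax n123)
    then have "frechet_derivative \<Psi> (at 0) v = (v $ 1) *\<^sub>R frechet_derivative \<Psi> (at 0) (axis 1 1)
      + (v $ 2) *\<^sub>R frechet_derivative \<Psi> (at 0) (axis 2 1) + (v $ 3) *\<^sub>R frechet_derivative \<Psi> (at 0) (axis 3 1)"
      by (metis linear_add[OF l] linear_scale[OF l])
    then show ?thesis
      using \<Psi>1[OF B(2)] \<Psi>\<rho>[OF B(2), of "axis 2 1"] \<Psi>\<rho>[OF B(2), of "axis 3 1"] \<rho>2[OF B(2)] \<rho>3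
      by (simp add: ax n123 \<Psi>0 e1_def e2_def)
  qed
  have inj: "inj (frechet_derivative \<Psi> (at 0))"
    using nilpotent_basis(1)[of "N p" \<xi>, OF nil[OF V(2)] \<xi>] by (simp add: D\<Psi>0[abs_def])

  define W where "W t = frechet_derivative \<Psi> (at t) (axis 2 1)" for t
  define N2 where "N2 q = N q o\<^sub>L N q" for q
  have dN2: "(N2 has_derivative (\<lambda>v. (N q o\<^sub>L D q v) + (D q v o\<^sub>L N q))) (at q)" if "q \<in> V" for q
    unfolding N2_def by (rule bounded_bilinear.FDERIV[OF bounded_bilinear_blinfun_compose dN[OF that] dN[OF that]])
  define D2 where "D2 q v = (N q o\<^sub>L D q v) + (D q v o\<^sub>L N q)" for q v
  have D2: "blinfun_apply (D2 q v) x = N q (D q v x) + D q v (N q x)" for q v x by (simp add: D2_def blinfun.add_left)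
  have linD2: "linear (D2 q)" if "q \<in> V" for q
    using has_derivative_linear[OF dN2[OF that]] unfolding D2_def .
  have de1: "(e1 has_derivative (\<lambda>v. D2 q v \<xi>)) (at q)" if "q \<in> V" for q
    using bounded_bilinear.FDERIV[OF bounded_bilinear_blinfun_apply dN2[OF that] has_derivative_const, of \<xi>]
    by (simp add: D2_def e1_def[abs_def] N2_def blinfun.bilinear_simps)
  have smW: "smooth_on B W" unfolding W_def using smooth_on_derivative[OF sm\<Psi>] .
  \<comment> \<open>Mixed partial derivatives commute, and the first one is \<open>e1\<close> along
    \<open>\<Psi>\<close>; this yields a linear equation for \<open>W\<close> along the lines of the
    first coordinate.\<close>
  have dW: "frechet_derivative W (at t) (axis 1 1) = D2 (\<Psi> t) (W t) \<xi>" if t: "t \<in> B" for t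
  proof -
    have "frechet_derivative W (at t) (axis 1 1) = frechet_derivative (\<lambda>y. frechet_derivative \<Psi> (at y) (axis 1 1)) (at t) (axis 2 1)"
      unfolding W_def using sm\<Psi> by (intro symmetric_second_derivative[OF B(1) t]) (simp add: smooth_on_def)
    also have "\<dots> = D2 (\<Psi> t) (W t) \<xi>"
    proof -
      have "((e1 \<circ> \<Psi>) has_derivative ((\<lambda>v. D2 (\<Psi> t) v \<xi>) \<circ> frechet_derivative \<Psi> (at t))) (at t)"
        by (rule diff_chain_at[OF d\<Psi>[OF t] de1[OF in\<Psi>V[OF t]]])
      then have "((\<lambda>y. frechet_derivative \<Psi> (at y) (axis 1 1)) has_derivative ((\<lambda>v. D2 (\<Psi> t) v \<xi>) \<circ> frechet_derivative \<Psi> (at t))) (at t)"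
        by (rule has_derivative_transform_within_open[OF _ B(1) t]) (simp add: \<Psi>1)
      from frechet_derivative_eq[OF this] show ?thesis by (simp add: W_def)
    qed
    finally show ?thesis .
  qed
  define h where "h t = \<eta> \<bullet> N2 (\<Psi> t) (W t)" for t
  \<comment> \<open>\<open>F q\<close> is the coordinate expression of the Lie derivative along
    \<open>e1\<close> of the covector sending w to \<open>\<eta> \<bullet> N2 q w\<close>. Evaluated
    on \<open>W\<close> it is the derivative of \<open>h\<close> in the first coordinate.\<close>
  define F where "F q w = \<eta> \<bullet> (D2 q (e1 q) w + N2 q (D2 q w \<xi>))" for q w
  have dh: "(h has_derivative (\<lambda>v. \<eta> \<bullet> (N2 (\<Psi> t) (frechet_derivative W (at t) v)
      + D2 (\<Psi> t) (frechet_derivative \<Psi> (at t) v) (W t)))) (at t)" if t: "t \<in> B" for t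
  proof -
    have "((N2 \<circ> \<Psi>) has_derivative (D2 (\<Psi> t) \<circ> frechet_derivative \<Psi> (at t))) (at t)"
      unfolding D2_def by (rule diff_chain_at[OF d\<Psi>[OF t] dN2[OF in\<Psi>V[OF t]]])
    from bounded_bilinear.FDERIV[OF bounded_bilinear_blinfun_apply this smooth_on_has_derivative[OF smW t]]
    have "((\<lambda>t. N2 (\<Psi> t) (W t)) has_derivative (\<lambda>v. N2 (\<Psi> t) (frechet_derivative W (at t) v)
      + D2 (\<Psi> t) (frechet_derivative \<Psi> (at t) v) (W t))) (at t)"
      by (simp add: o_def)
    from bounded_linear.has_derivative[OF bounded_linear_inner_right this] show ?thesis by (simp add: h_def[abs_def])
  qed
  have dh1: "\<eta> \<bullet> (N2 (\<Psi> t) (frechet_derivative W (at t) (axis 1 1))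
      + D2 (\<Psi> t) (frechet_derivative \<Psi> (at t) (axis 1 1)) (W t)) = F (\<Psi> t) (W t)" if t: "t \<in> B" for t
    by (simp add: dW[OF t] \<Psi>1[OF t] F_def add.commute)
  txt \<open>Involutivity says that the Lie derivative along \<open>e1\<close> of the covector \<open>\<eta> \<bullet> N2\<close> is a multiple of it.\<close>
  have Fh: "F q w * (\<eta> \<bullet> e1 q) = F q \<xi> * (\<eta> \<bullet> N2 q w)" if q: "q \<in> V1" for q w
  proof -
    have qV: "q \<in> V" using q V1V by blast
    note N3 = nil[OF qV] and DN' = DN[OF qV]
    \<comment> \<open>On \<open>e1\<close> the Lie derivative vanishes by nilpotency and its
      derivative alone.\<close>
    have z1: "D2 q (e1 q) (e1 q) + N2 q (D2 q (e1 q) \<xi>) = 0"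
    proof -
      have "N q (N q (D q v (N q (N q \<xi>)))) = 0" for v
        using arg_cong[OF DN'[of v \<xi>], of "\<lambda>z. N q (N q z)"] by (simp add: blinfun.bilinear_simps N3)
      moreover have "N q (D q v (N q (N q \<xi>))) + N q (N q (D q v (N q \<xi>))) = 0" for v
        using arg_cong[OF DN'[of v \<xi>], of "blinfun_apply (N q)"] by (simp add: blinfun.bilinear_simps N3)
      ultimately show ?thesis by (simp add: D2 N2_def e1_def blinfun.bilinear_simps N3)
    qed
    \<comment> \<open>Here involutivity enters: the derivative of N^3 = 0 rewrites the sum into
      exactly the expression in \<open>invol\<close>.\<close>
    have z2: "D2 q (e1 q) (e2 q) + N2 q (D2 q (e2 q) \<xi>) = 0"
    proof -
      have "D2 q (e1 q) (e2 q) + N2 q (D2 q (e2 q) \<xi>)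
        = (D q (e1 q) (N q (N q \<xi>)) + N q (D q (e1 q) (N q \<xi>))) + N q (N q (D q (e2 q) (N q \<xi>)))"
        by (simp add: D2 N2_def e2_def blinfun.bilinear_simps N3)
      also have "D q (e1 q) (N q (N q \<xi>)) + N q (D q (e1 q) (N q \<xi>)) = - N q (N q (D q (e1 q) \<xi>))"
        using DN'[of "e1 q" \<xi>] by (simp add: eq_neg_iff_add_eq_0)
      also have "- N q (N q (D q (e1 q) \<xi>)) + N q (N q (D q (e2 q) (N q \<xi>)))
        = N q (N q (D q (N q \<xi>) (N q \<xi>) - D q (N q (N q \<xi>)) \<xi>))"
        by (simp add: e1_def e2_def blinfun.bilinear_simps)
      also have "\<dots> = 0" using invol[OF qV] unfolding D_def .
      finally show ?thesis .
    qed
    obtain a b c where w: "w = a *\<^sub>R e1 q + b *\<^sub>R e2 q + c *\<^sub>R \<xi>"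
      using nilpotent_basis(2)[of "N q" \<xi> w, OF N3] q unfolding e1_def e2_def V1_def by force
    have "F q w = a * F q (e1 q) + b * F q (e2 q) + c * F q \<xi>"
      unfolding F_def w
      by (simp add: linear_add[OF linD2[OF qV]] linear_scale[OF linD2[OF qV]] blinfun.bilinear_simps inner_simps algebra_simps)
    then have "F q w = c * F q \<xi>" using z1 z2 by (simp add: F_def)
    moreover have "\<eta> \<bullet> N2 q w = c * (\<eta> \<bullet> e1 q)"
      unfolding w by (simp add: N2_def e1_def e2_def blinfun.bilinear_simps N3)
    ultimately show ?thesis by simp
  qed
  define c where "c q = F q \<xi> / (\<eta> \<bullet> e1 q)" for q
  have contF: "continuous_on V (\<lambda>q. F q \<xi>)"
  proof -
    have sD: "smooth_on V (\<lambda>q. D q (g q))" if "smooth_on V g" for g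
      unfolding D_def by (rule smooth_on_derivative_along[OF V(1) N that])
    have "smooth_on V (\<lambda>q. D2 q (e1 q) \<xi>)"
      unfolding D2 by (intro smooth_on_add bl V(1) sD sm1 N smooth_on_const)
    moreover then have "smooth_on V (\<lambda>q. N2 q (D2 q \<xi> \<xi>))"
      unfolding D2 N2_def by (simp add: blinfun.bilinear_simps) (intro smooth_on_add bl V(1) sD sm1 N smooth_on_const)
    ultimately show ?thesis unfolding F_def by (intro continuous_intros smooth_on_continuous)
  qed
  have contc: "continuous_on V1 c"
    unfolding c_def using contF cont1 V1V
    by (intro continuous_on_divide) (auto intro: continuous_on_subset simp: V1_def)
  have h0: "h t = 0" if t: "t \<in> B" for t
  proof -
    define \<gamma> where "\<gamma> s = t + (s - t $ 1) *\<^sub>R axis 1 1" for s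
    \<comment> \<open>The interval between 0 and \<open>t $ 1\<close> for either sign. Moving the
      first coordinate towards zero does not increase the norm, so \<open>\<gamma>\<close> stays in
      the ball.\<close>
    let ?I = "{min 0 (t $ 1)..max 0 (t $ 1)}"
    have \<gamma>B: "\<gamma> s \<in> B" if "s \<in> ?I" for s
    proof -
      have "norm (\<gamma> s) \<le> norm t"
      proof (rule norm_le_componentwise_cart)
        fix i :: 3
        show "norm (\<gamma> s $ i) \<le> norm (t $ i)" using that by (cases "i = 1") (auto simp: \<gamma>_def ax)
      qed
      then show ?thesis using t by (simp add: B_def)
    qed
    have d\<gamma>: "(\<gamma> has_derivative (\<lambda>s. s *\<^sub>R axis 1 1)) (at s)" for s
      unfolding \<gamma>_def by (auto intro!: derivative_eq_intros)
    have "(h \<circ> \<gamma>) (t $ 1) = 0"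
    proof (rule linear_ode_zero[of "min 0 (t $ 1)" "max 0 (t $ 1)" "h \<circ> \<gamma>" "c \<circ> \<Psi> \<circ> \<gamma>" 0])
      fix s assume s: "s \<in> ?I"
      let ?t = "\<gamma> s"
      have tB: "?t \<in> B" using \<gamma>B[OF s] .
      note dd = dh[OF tB]
      have "((h \<circ> \<gamma>) has_derivative (\<lambda>r. r * F (\<Psi> ?t) (W ?t))) (at s)"
      proof -
        have "((h \<circ> \<gamma>) has_derivative ((\<lambda>v. \<eta> \<bullet> (N2 (\<Psi> ?t) (frechet_derivative W (at ?t) v)
      + D2 (\<Psi> ?t) (frechet_derivative \<Psi> (at ?t) v) (W ?t))) \<circ> (\<lambda>r. r *\<^sub>R axis 1 1))) (at s)"
          by (rule diff_chain_at[OF d\<gamma> dd])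
        then show ?thesis
          unfolding dh1[OF tB, symmetric] o_def linear_scale[OF has_derivative_linear[OF dd]] by simp
      qed
      moreover have "F (\<Psi> ?t) (W ?t) = c (\<Psi> ?t) * h ?t"
        using Fh[OF in\<Psi>[OF tB], of "W ?t"] in\<Psi>[OF tB] by (simp add: c_def h_def V1_def field_simps)
      ultimately have "((h \<circ> \<gamma>) has_real_derivative (c (\<Psi> ?t) * h ?t)) (at s)"
        by (simp add: has_field_derivative_def mult.commute[of _ "c (\<Psi> ?t) * h ?t"])
      then show "((h \<circ> \<gamma>) has_real_derivative ((c \<circ> \<Psi> \<circ> \<gamma>) s * (h \<circ> \<gamma>) s)) (at s within ?I)"
        by (simp add: has_field_derivative_at_within)
    next
      have "continuous_on ?I \<gamma>" unfolding \<gamma>_def by (intro continuous_intros)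
      then have "continuous_on ?I (\<lambda>s. \<Psi> (\<gamma> s))"
        using continuous_on_compose2[OF smooth_on_continuous[OF sm\<Psi>]] \<gamma>B by blast
      then show "continuous_on ?I (c \<circ> \<Psi> \<circ> \<gamma>)"
        unfolding o_def using continuous_on_compose2[OF contc] \<gamma>B in\<Psi> by blast
      have \<gamma>0: "\<gamma> 0 \<in> B" "\<gamma> 0 $ 1 = 0" using \<gamma>B[of 0] by (auto simp: \<gamma>_def ax)
      \<comment> \<open>The initial condition: on the slice the second coordinate vector is N \<xi>,
        which N^2 annihilates.\<close>
      have "W (\<gamma> 0) = e2 (\<Psi> (\<gamma> 0))"
        using \<Psi>\<rho>[OF \<gamma>0, of "axis 2 1"] \<rho>2[OF \<gamma>0(1)] i1[of "\<rho> (\<gamma> 0)"] in\<rho>[OF \<gamma>0(1)] \<gamma>0(2)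
        by (simp add: W_def ax n123 \<Psi>_def V2_def)
      then show "(h \<circ> \<gamma>) 0 = 0" using nil[OF in\<Psi>V[OF \<gamma>0(1)]] by (simp add: h_def N2_def e2_def)
    qed auto
    then show ?thesis by (simp add: \<gamma>_def)
  qed
  have N2W: "N (\<Psi> t) (N (\<Psi> t) (W t)) = 0" if t: "t \<in> B" for t
  proof -
    let ?q = "\<Psi> t"
    note N3 = nil[OF in\<Psi>V[OF t]]
    have \<eta>q: "\<eta> \<bullet> e1 ?q \<noteq> 0" using in\<Psi>[OF t] by (simp add: V1_def)
    then obtain a b c where w: "W t = a *\<^sub>R N ?q (N ?q \<xi>) + b *\<^sub>R N ?q \<xi> + c *\<^sub>R \<xi>"
      using nilpotent_basis(2)[of "N ?q" \<xi> "W t", OF N3] unfolding e1_def by force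
    have "N ?q (N ?q (W t)) = c *\<^sub>R e1 ?q"
      unfolding w by (simp add: e1_def blinfun.bilinear_simps N3)
    moreover from this have "c * (\<eta> \<bullet> e1 ?q) = 0" using h0[OF t] by (simp add: h_def N2_def)
    ultimately show ?thesis using \<eta>q by simp
  qed
  obtain U' V' G where G: "open U'" "U' \<subseteq> B" "0 \<in> U'" "open V'" "\<Psi> 0 \<in> V'" "homeomorphism U' V' \<Psi> G" "smooth_on V' G"
    using smooth_inverse_function[OF B sm\<Psi> inj] by metis
  show ?thesis
  proof (rule that[of U' V' \<Psi> G])
    show "V' \<subseteq> V" using G(2,6) in\<Psi>V by (auto simp: homeomorphism_def)
    show "smooth_on U' \<Psi>" using sm\<Psi> G(2) smooth_on_subset by blast
    fix t assume "t \<in> U'"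
    then have t: "t \<in> B" using G(2) by blast
    show "N (\<Psi> t) (frechet_derivative \<Psi> (at t) (axis 1 1)) = 0"
      using \<Psi>1[OF t] nil[OF in\<Psi>V[OF t]] by (simp add: e1_def)
    show "N (\<Psi> t) (N (\<Psi> t) (frechet_derivative \<Psi> (at t) (axis 2 1))) = 0"
      using N2W[OF t] by (simp add: W_def)
  qed (use G \<Psi>0 in auto)
qed

section \<open>The torsions in coordinates\<close>

definition bracket :: "('b::real_normed_vector \<Rightarrow> 'b) \<Rightarrow> ('b \<Rightarrow> 'b) \<Rightarrow> 'b \<Rightarrow> 'b" where
  "bracket x y q = frechet_derivative y (at q) (x q) - frechet_derivative x (at q) (y q)"

text \<open>All terms with derivatives of \<open>x\<close> and \<open>y\<close> cancel. This is the
  tensoriality of the torsion: the values of the fields at \<open>q\<close> remain, and the rest is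
  algebra at a point.\<close>

lemma nij_bracket:
  fixes L :: "'b::real_normed_vector \<Rightarrow> 'b \<Rightarrow>\<^sub>L 'b"
  assumes L: "(L has_derivative D) (at q)" and x: "x differentiable (at q)" and y: "y differentiable (at q)"
  shows "L q (L q (bracket x y q)) + bracket (\<lambda>q. L q (x q)) (\<lambda>q. L q (y q)) q
    - L q (bracket (\<lambda>q. L q (x q)) y q) - L q (bracket x (\<lambda>q. L q (y q)) q) = nij (L q) D (x q) (y q)"
proof -
  have *: "frechet_derivative (\<lambda>q. L q (z q)) (at q) = (\<lambda>v. L q (frechet_derivative z (at q) v) + D v (z q))"
    if "z differentiable (at q)" for z
    by (rule frechet_derivative_eq bounded_bilinear.FDERIV[OF bounded_bilinear_blinfun_apply L])+
      (rule differentiable_frechet[OF that])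
  show ?thesis
    by (simp add: bracket_def *[OF x] *[OF y] nij_def blinfun.bilinear_simps algebra_simps)
qed

text \<open>The situation within one chart. The cyclic vector is only required pointwise; one chosen
  at a point, kept constant, stays cyclic nearby.\<close>

locale nilpotent_shift =
  fixes V :: "(real ^ 3) set" and L :: "real ^ 3 \<Rightarrow> (real ^ 3) \<Rightarrow>\<^sub>L (real ^ 3)" and \<mu> :: "real ^ 3 \<Rightarrow> real"
    and N :: "real ^ 3 \<Rightarrow> (real ^ 3) \<Rightarrow>\<^sub>L (real ^ 3)"
  assumes V: "open V" and L: "smooth_on V L" and \<mu>: "smooth_on V \<mu>"
    and N_def: "\<And>q. N q = L q - \<mu> q *\<^sub>R id_blinfun"
    and nil: "\<And>q x. q \<in> V \<Longrightarrow> N q (N q (N q x)) = 0"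
    and cyc: "\<And>q. q \<in> V \<Longrightarrow> \<exists>\<xi>. N q (N q \<xi>) \<noteq> 0"
begin

lemma N: "smooth_on V N"
  unfolding N_def[abs_def] by (intro smooth_on_diff smooth_on_scaleR smooth_on_const V L \<mu>)

lemma haa_N:
  assumes q: "q \<in> V"
  shows "haa (L q) (frechet_derivative L (at q)) x y = haa (N q) (frechet_derivative N (at q)) x y"
proof -
  note dN = smooth_on_has_derivative[OF N q] and d\<mu> = smooth_on_has_derivative[OF \<mu> q]
  have "((\<lambda>q. N q + \<mu> q *\<^sub>R id_blinfun) has_derivative
    (\<lambda>v. frechet_derivative N (at q) v + frechet_derivative \<mu> (at q) v *\<^sub>R id_blinfun)) (at q)"
    using has_derivative_add[OF dN has_derivative_scaleR_left[OF d\<mu>]] .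
  moreover have "L = (\<lambda>q. N q + \<mu> q *\<^sub>R id_blinfun)" by (simp add: N_def)
  ultimately have "frechet_derivative L (at q) =
    (\<lambda>v. frechet_derivative N (at q) v + frechet_derivative \<mu> (at q) v *\<^sub>R id_blinfun)"
    by (simp add: frechet_derivative_eq)
  moreover have "L q = N q + \<mu> q *\<^sub>R id_blinfun" by (simp add: N_def)
  ultimately show ?thesis
    using haa_shift[OF has_derivative_linear[OF dN] has_derivative_linear[OF d\<mu>]] by simp
qed

lemma derivative_N:
  "q \<in> V \<Longrightarrow> frechet_derivative N (at q) v (N q (N q x)) + N q (frechet_derivative N (at q) v (N q x))
    + N q (N q (frechet_derivative N (at q) v x)) = 0"
  by (rule derivative_nilpotent[OF V _ nil smooth_on_has_derivative[OF N]])

text \<open>By nilpotency the eigenvalue \<open>m\<close> of the covector du equals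
  \<open>\<mu>\<close>, so du vanishes on the image of N. Differentiating du(N w) = 0 expresses du
  on \<open>D v w\<close> by the second derivative of \<open>u\<close> in the directions v and N w;
  by its symmetry du vanishes on the vector representing the bracket. That vector therefore lies in
  ker N^2.\<close>

lemma haa_eq_0_of_invariant_function:
  assumes u: "smooth_on V u"
    and reg: "\<And>q. q \<in> V \<Longrightarrow> \<exists>v. frechet_derivative u (at q) v \<noteq> (0::real)"
    and inv: "\<And>q v. q \<in> V \<Longrightarrow> frechet_derivative u (at q) (L q v) = m q * frechet_derivative u (at q) v"
    and q: "q \<in> V"
  shows "haa (L q) (frechet_derivative L (at q)) x y = 0"
proof -
  let ?du = "\<lambda>q. frechet_derivative u (at q)" and ?D = "frechet_derivative N (at q)"
  have lin: "linear (?du q)" if "q \<in> V" for q using has_derivative_linear[OF smooth_on_has_derivative[OF u that]] .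
  have du: "?du q (N q v) = 0" if q: "q \<in> V" for q v
  proof -
    have s: "?du q (N q v) = (m q - \<mu> q) * ?du q v" for v
      using inv[OF q] by (simp add: N_def blinfun.bilinear_simps linear_diff[OF lin[OF q]] linear_scale[OF lin[OF q]] algebra_simps)
    obtain w where w: "?du q w \<noteq> 0" using reg[OF q] by blast
    have "?du q (N q (N q (N q w))) = 0" by (simp add: nil[OF q] linear_0[OF lin[OF q]])
    then have "m q - \<mu> q = 0" using w by (simp add: s)
    then show ?thesis by (simp add: s)
  qed
  obtain \<xi> where \<xi>: "N q (N q \<xi>) \<noteq> 0" using cyc[OF q] by blast
  let ?B = "\<lambda>v w. frechet_derivative (\<lambda>q. ?du q w) (at q) v"
  have sym: "?B v w = ?B w v" for v w
    using u by (intro symmetric_second_derivative[OF V q]) (simp add: smooth_on_def)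
  \<comment> \<open>The covector and its argument both vary with the point, hence the basis
    expansion before differentiating.\<close>
  have rel: "?du q (?D v w) = - ?B v (N q w)" for v w
  proof -
    have d: "((\<lambda>q. \<Sum>b\<in>Basis. (N q w \<bullet> b) *\<^sub>R ?du q b) has_derivative
        (\<lambda>v. \<Sum>b\<in>Basis. (N q w \<bullet> b) *\<^sub>R ?B v b + (?D v w \<bullet> b) *\<^sub>R ?du q b)) (at q)"
      using bounded_bilinear.FDERIV[OF bounded_bilinear_blinfun_apply smooth_on_has_derivative[OF N q] has_derivative_const, of w]
      by (intro has_derivative_sum has_derivative_scaleR smooth_on_has_derivative[OF smooth_on_derivative[OF u] q]
          bounded_linear.has_derivative[OF bounded_linear_inner_left]) (simp add: blinfun.bilinear_simps)
    have z: "(\<Sum>b\<in>Basis. (N q w \<bullet> b) *\<^sub>R ?du q b) = 0" if "q \<in> V" for q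
      unfolding has_derivative_Basis[OF smooth_on_has_derivative[OF u that], symmetric] by (rule du[OF that])
    have "((\<lambda>q. \<Sum>b\<in>Basis. (N q w \<bullet> b) *\<^sub>R ?du q b) has_derivative (\<lambda>v. 0)) (at q)"
      by (rule has_derivative_transform_within_open[OF has_derivative_const V q]) (rule z[symmetric])
    from fun_cong[OF has_derivative_unique[OF d this], of v]
    have "(\<Sum>b\<in>Basis. (N q w \<bullet> b) *\<^sub>R ?B v b) + (\<Sum>b\<in>Basis. (?D v w \<bullet> b) *\<^sub>R ?du q b) = 0"
      by (simp add: sum.distrib)
    moreover have "(\<Sum>b\<in>Basis. (?D v w \<bullet> b) *\<^sub>R ?du q b) = ?du q (?D v w)"
      by (rule has_derivative_Basis[OF smooth_on_has_derivative[OF u q], symmetric])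
    moreover have "(\<Sum>b\<in>Basis. (N q w \<bullet> b) *\<^sub>R ?B v b) = ?B v (N q w)"
    proof -
      have "(\<Sum>b\<in>Basis. (N q w \<bullet> b) *\<^sub>R ?B v b) = (\<Sum>b\<in>Basis. (N q w \<bullet> b) *\<^sub>R ?B b v)"
        by (rule sum.cong[OF refl]) (rule arg_cong[OF sym])
      also have "\<dots> = ?B (N q w) v"
        by (rule has_derivative_Basis[OF smooth_on_has_derivative[OF smooth_on_derivative[OF u] q], symmetric])
      also have "\<dots> = ?B v (N q w)" by (rule sym)
      finally show ?thesis .
    qed
    ultimately show ?thesis by simp
  qed
  have "?du q (?D (N q \<xi>) (N q \<xi>) - ?D (N q (N q \<xi>)) \<xi>) = 0"
    using sym[of "N q \<xi>" "N q (N q \<xi>)"] by (simp add: linear_diff[OF lin[OF q]] rel)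
  moreover obtain w where "?du q w \<noteq> 0" using reg[OF q] by blast
  ultimately have "N q (N q (?D (N q \<xi>) (N q \<xi>) - ?D (N q (N q \<xi>)) \<xi>)) = 0"
    using nilpotent_square_eq_0_of_covector[of "N q" \<xi> "?du q", OF nil[OF q] \<xi> lin[OF q] _ du[OF q]] by blast
  then show ?thesis
    unfolding haa_N[OF q]
    by (intro haa_eq_0[OF has_derivative_linear[OF smooth_on_has_derivative[OF N q]] nil[OF q] \<xi> derivative_N[OF q]])
qed

text \<open>\<open>L\<close> and \<open>N\<close> differ by a multiple of the identity, so a
  coordinate vector in ker N is an eigenvector. \<open>N\<close> maps the second coordinate vector
  into ker N, which is a line spanned by the first one, as this is nonzero by the differentiable
  inverse of \<open>\<Psi>\<close>.\<close>

lemma triangularize: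
  assumes haa: "\<And>q x y. q \<in> V \<Longrightarrow> haa (L q) (frechet_derivative L (at q)) x y = 0" and p: "p \<in> V"
  obtains U W and \<Psi> G :: "real ^ 3 \<Rightarrow> real ^ 3" where "open U" "open W" "p \<in> W" "W \<subseteq> V" "homeomorphism U W \<Psi> G"
    "smooth_on U \<Psi>" "smooth_on W G"
    "\<And>t. t \<in> U \<Longrightarrow> \<exists>a. L (\<Psi> t) (frechet_derivative \<Psi> (at t) (axis 1 1)) = a *\<^sub>R frechet_derivative \<Psi> (at t) (axis 1 1)"
    "\<And>t. t \<in> U \<Longrightarrow> \<exists>a b. L (\<Psi> t) (frechet_derivative \<Psi> (at t) (axis 2 1)) =
       a *\<^sub>R frechet_derivative \<Psi> (at t) (axis 1 1) + b *\<^sub>R frechet_derivative \<Psi> (at t) (axis 2 1)"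
proof -
  obtain \<xi> where \<xi>: "N p (N p \<xi>) \<noteq> 0" using cyc[OF p] by blast
  have invol: "N q (N q (frechet_derivative N (at q) (N q \<xi>) (N q \<xi>) - frechet_derivative N (at q) (N q (N q \<xi>)) \<xi>)) = 0"
    if q: "q \<in> V" for q
    using haa[OF q, of \<xi> "N q \<xi>"] unfolding haa_N[OF q]
    by (subst (asm) haa_nilpotent(1)[OF has_derivative_linear[OF smooth_on_has_derivative[OF N q]] nil[OF q] derivative_N[OF q]]) simp
  obtain U W and \<Psi> G :: "real ^ 3 \<Rightarrow> real ^ 3" where UW: "open U" "open W" "p \<in> W" "W \<subseteq> V" "homeomorphism U W \<Psi> G"
    "smooth_on U \<Psi>" "smooth_on W G"
    and z1: "\<And>t. t \<in> U \<Longrightarrow> N (\<Psi> t) (frechet_derivative \<Psi> (at t) (axis 1 1)) = 0"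
    and z2: "\<And>t. t \<in> U \<Longrightarrow> N (\<Psi> t) (N (\<Psi> t) (frechet_derivative \<Psi> (at t) (axis 2 1))) = 0"
    using straighten_flag[OF V p N nil \<xi> invol] by metis
  have \<Psi>V: "\<Psi> t \<in> V" if "t \<in> U" for t using that UW(4,5) by (auto simp: homeomorphism_def)
  have LN: "L q x = \<mu> q *\<^sub>R x + N q x" for q x by (simp add: N_def blinfun.bilinear_simps)
  show ?thesis
  proof (rule that[OF UW])
    fix t assume t: "t \<in> U"
    let ?d1 = "frechet_derivative \<Psi> (at t) (axis 1 1)" and ?d2 = "frechet_derivative \<Psi> (at t) (axis 2 1)"
    let ?N = "N (\<Psi> t)"
    show "\<exists>a. L (\<Psi> t) ?d1 = a *\<^sub>R ?d1" using z1[OF t] by (auto simp: LN)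
    have nz: "?d1 \<noteq> 0"
    proof
      assume "?d1 = 0"
      have \<Psi>t: "\<Psi> t \<in> W" using UW(5) t by (auto simp: homeomorphism_def)
      have "((G \<circ> \<Psi>) has_derivative (frechet_derivative G (at (\<Psi> t)) \<circ> frechet_derivative \<Psi> (at t))) (at t)"
        by (rule diff_chain_at[OF smooth_on_has_derivative[OF UW(6) t] smooth_on_has_derivative[OF UW(7) \<Psi>t]])
      moreover have "((G \<circ> \<Psi>) has_derivative (\<lambda>v. v)) (at t)"
        by (rule has_derivative_transform_within_open[OF has_derivative_ident UW(1) t])
          (use UW(5) in \<open>auto simp: homeomorphism_def\<close>)
      ultimately have "frechet_derivative G (at (\<Psi> t)) \<circ> frechet_derivative \<Psi> (at t) = (\<lambda>v. v)"
        by (rule has_derivative_unique)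
      from fun_cong[OF this, of "axis 1 1"] have "frechet_derivative G (at (\<Psi> t)) 0 = (axis 1 1 :: real ^ 3)"
        using \<open>?d1 = 0\<close> by simp
      then show False
        using linear_0[OF has_derivative_linear[OF smooth_on_has_derivative[OF UW(7) \<Psi>t]]] by (metis axis_eq_0_iff zero_neq_one)
    qed
    obtain \<zeta> where \<zeta>: "?N (?N \<zeta>) \<noteq> 0" using cyc[OF \<Psi>V[OF t]] by blast
    have ker: "\<exists>a. w = a *\<^sub>R ?N (?N \<zeta>)" if "?N w = 0" for w
    proof -
      obtain a b c where w: "w = a *\<^sub>R ?N (?N \<zeta>) + b *\<^sub>R ?N \<zeta> + c *\<^sub>R \<zeta>"
        using nilpotent_basis(2)[of ?N \<zeta> w, OF nil[OF \<Psi>V[OF t]] \<zeta>] by blast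
      have e: "b *\<^sub>R ?N (?N \<zeta>) + c *\<^sub>R ?N \<zeta> = 0"
        using that unfolding w by (simp add: blinfun.bilinear_simps nil[OF \<Psi>V[OF t]])
      then have "?N (b *\<^sub>R ?N (?N \<zeta>) + c *\<^sub>R ?N \<zeta>) = 0" by simp
      then have "c = 0" using \<zeta> by (simp add: blinfun.bilinear_simps nil[OF \<Psi>V[OF t]])
      moreover from this e have "b = 0" using \<zeta> by simp
      ultimately show ?thesis using w by auto
    qed
    obtain a b where a: "?d1 = a *\<^sub>R ?N (?N \<zeta>)" and b: "?N ?d2 = b *\<^sub>R ?N (?N \<zeta>)"
      using ker[OF z1[OF t]] ker[OF z2[OF t]] by blast
    have "a \<noteq> 0" using a nz by auto
    then have "?N ?d2 = (b / a) *\<^sub>R ?d1" by (simp add: a b)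
    then show "\<exists>a b. L (\<Psi> t) ?d2 = a *\<^sub>R ?d1 + b *\<^sub>R ?d2" by (auto simp: LN add.commute)
  qed
qed

end

section \<open>Vector fields and operator fields in charts\<close>

lemma chart_inv_apply: "is_chart c \<Longrightarrow> q \<in> fst c \<Longrightarrow> chart_inv c (snd c q) = q"
  unfolding is_chart_def homeomorphism_def by blast

lemma apply_chart_inv: "y \<in> snd c ` fst c \<Longrightarrow> snd c (chart_inv c y) = y \<and> chart_inv c y \<in> fst c"
  using f_inv_into_f inv_into_into by metis

lemma open_chart_image:
  assumes c: "is_chart c" and T: "open T" "T \<subseteq> fst c"
  shows "open (snd c ` T)"
proof -
  have h: "homeomorphism (fst c) (snd c ` fst c) (snd c) (chart_inv c)" and o: "open (fst c)" "open (snd c ` fst c)"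
    using c by (auto simp: is_chart_def)
  have "openin (top_of_set (fst c)) T" using T o by (simp add: openin_open_eq)
  from homeomorphism_imp_open_map[OF h this] show ?thesis using o by (simp add: openin_open_eq)
qed

lemma open_chart_vimage:
  assumes c: "is_chart c" and T: "open T"
  shows "open (fst c \<inter> snd c -` T)"
  using c T unfolding is_chart_def homeomorphism_def by (intro continuous_open_preimage) auto

lemma smooth_on_transition:
  fixes f :: "'a::topological_space \<Rightarrow> 'b::real_normed_vector"
  assumes c: "is_chart c" and d: "is_chart d"
    and t: "smooth_on (snd d ` (fst d \<inter> fst c)) (snd c \<circ> chart_inv d)"
    and S: "open S" "S \<subseteq> fst c" and f: "smooth_on (snd c ` S) (f \<circ> chart_inv c)"
  shows "smooth_on (snd d ` (fst d \<inter> S)) (f \<circ> chart_inv d)"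
proof -
  let ?T = "snd d ` (fst d \<inter> S)"
  have "open (fst d)" using d by (simp add: is_chart_def)
  then have T: "open ?T" using S by (intro open_chart_image[OF d]) auto
  have "smooth_on ?T (\<lambda>y. (f \<circ> chart_inv c) ((snd c \<circ> chart_inv d) y))"
  proof (rule smooth_on_compose[OF T open_chart_image[OF c S] _ _ f])
    show "(snd c \<circ> chart_inv d) y \<in> snd c ` S" if "y \<in> ?T" for y
      using that by (auto simp: chart_inv_apply[OF d])
    show "smooth_on ?T (snd c \<circ> chart_inv d)" using S(2) by (intro smooth_on_subset[OF t]) auto
  qed
  then show ?thesis
    by (rule smooth_on_cong[OF T, rotated]) (use S(2) chart_inv_apply[OF c] chart_inv_apply[OF d] in auto)
qed

lemma smooth_fun_on_subset: "smooth_fun_on A S f \<Longrightarrow> T \<subseteq> S \<Longrightarrow> smooth_fun_on A T f"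
  unfolding smooth_fun_on_def by (auto intro: smooth_on_subset)

lemma sum_fun_apply: "(\<Sum>i\<in>I. f i) x = (\<Sum>i\<in>I. f i x)"
  by (induction I rule: infinite_finite_induct) auto

text \<open>The tangent vector with coordinates \<open>a\<close>, in closed form. The value 0 on
  functions that are not smooth near \<open>p\<close> matches the convention of
  \<open>tangent_space\<close>.\<close>

definition vec_of ::
  "('a::topological_space, 'n::finite) chart set \<Rightarrow> ('a, 'n) chart \<Rightarrow> 'a \<Rightarrow> real ^ 'n \<Rightarrow> 'a tvec" where
  "vec_of A c p a = (\<lambda>f. if smooth_near A p f
     then frechet_derivative (f \<circ> chart_inv c) (at (snd c p)) a else 0)"

text \<open>The coordinate functions serve as test functions: they are smooth near each point of the
  chart domain, whatever their values outside.\<close>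

definition components :: "('a, 'n::finite) chart \<Rightarrow> 'a tvec \<Rightarrow> real ^ 'n" where
  "components c v = (\<chi> i. v (\<lambda>q. snd c q $ i))"

lemma coord_vector_eq: "coord_vector A c p j = vec_of A c p (axis j 1)"
  by (simp add: coord_vector_def vec_of_def)

section \<open>Smooth functions and tangent vectors in the charts of the maximal atlas\<close>

locale atlas =
  fixes A :: "('a::{t2_space, second_countable_topology}, 'n::finite) chart set"
  assumes atlas: "smooth_atlas A"
begin

lemma atlas_coordinate_system: "c \<in> A \<Longrightarrow> c \<in> coordinate_systems A"
  using atlas unfolding smooth_atlas_def coordinate_systems_def manifold_def by auto

lemma
  assumes c: "c \<in> coordinate_systems A"
  shows coordinate_system_chart: "is_chart c"
    and coordinate_system_open: "open (fst c)"
    and coordinate_system_manifold: "fst c \<subseteq> manifold A"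
  using c by (auto simp: coordinate_systems_def is_chart_def)

lemma coordinate_system_compatible:
  assumes "c \<in> coordinate_systems A" "d \<in> A"
  shows "smooth_on (snd c ` (fst c \<inter> fst d)) (snd d \<circ> chart_inv c)"
    "smooth_on (snd d ` (fst d \<inter> fst c)) (snd c \<circ> chart_inv d)"
  using assms by (auto simp: coordinate_systems_def compatible_def Int_commute)

text \<open>\<open>smooth_fun_on\<close> and compatibility refer to the charts in \<open>A\<close>.
  Any other coordinate system is reached locally, through a chart of \<open>A\<close> around each
  point.\<close>

lemma smooth_fun_on_coordinates:
  assumes c: "c \<in> coordinate_systems A" and S: "open S" and f: "smooth_fun_on A S f"
  shows "smooth_on (snd c ` (fst c \<inter> S)) (f \<circ> chart_inv c)"
proof (rule smooth_on_local)
  fix y assume "y \<in> snd c ` (fst c \<inter> S)"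
  then obtain p where p: "p \<in> fst c" "p \<in> S" "y = snd c p" by blast
  obtain d where d: "d \<in> A" "p \<in> fst d"
    using coordinate_system_manifold[OF c] p(1) by (auto simp: manifold_def)
  note dc = atlas_coordinate_system[OF d(1)]
  let ?S = "S \<inter> fst d"
  have oS: "open ?S" using S coordinate_system_open[OF dc] by blast
  have "smooth_on (snd d ` ?S) (f \<circ> chart_inv d)"
    using f d(1) by (simp add: smooth_fun_on_def Int_commute)
  then have "smooth_on (snd c ` (fst c \<inter> ?S)) (f \<circ> chart_inv c)"
    by (intro smooth_on_transition[OF coordinate_system_chart[OF dc] coordinate_system_chart[OF c]
          coordinate_system_compatible(1)[OF c d(1)] oS]) auto
  moreover have "open (snd c ` (fst c \<inter> ?S))"
    using oS coordinate_system_open[OF c] by (intro open_chart_image[OF coordinate_system_chart[OF c]]) auto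
  moreover have "y \<in> snd c ` (fst c \<inter> ?S)" using p d(2) by blast
  ultimately show "\<exists>T. open T \<and> y \<in> T \<and> smooth_on T (f \<circ> chart_inv c)" by blast
qed

lemma smooth_fun_onI:
  assumes c: "c \<in> coordinate_systems A" and S: "open S" "S \<subseteq> fst c"
    and f: "smooth_on (snd c ` S) (f \<circ> chart_inv c)"
  shows "smooth_fun_on A S f"
  unfolding smooth_fun_on_def
proof
  fix d assume d: "d \<in> A"
  show "smooth_on (snd d ` (fst d \<inter> S)) (f \<circ> chart_inv d)"
    by (rule smooth_on_transition[OF coordinate_system_chart[OF c]
          coordinate_system_chart[OF atlas_coordinate_system[OF d]] coordinate_system_compatible(2)[OF c d] S f])
qed

lemma smooth_nearI:
  assumes c: "c \<in> coordinate_systems A" and p: "p \<in> fst c"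
    and T: "open T" "snd c p \<in> T" "T \<subseteq> snd c ` fst c" and f: "smooth_on T (f \<circ> chart_inv c)"
  shows "smooth_near A p f"
proof -
  let ?S = "fst c \<inter> snd c -` T"
  have "smooth_fun_on A ?S f"
    by (rule smooth_fun_onI[OF c open_chart_vimage[OF coordinate_system_chart[OF c] T(1)]])
      (auto intro: smooth_on_subset[OF f])
  then show ?thesis
    unfolding smooth_near_def
    using open_chart_vimage[OF coordinate_system_chart[OF c] T(1)] coordinate_system_manifold[OF c] p T(2) by blast
qed

lemma smooth_nearE:
  assumes c: "c \<in> coordinate_systems A" and p: "p \<in> fst c" and f: "smooth_near A p f"
  obtains T where "open T" "snd c p \<in> T" "T \<subseteq> snd c ` fst c" "smooth_on T (f \<circ> chart_inv c)"
proof -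
  obtain S where S: "open S" "p \<in> S" "smooth_fun_on A S f" using f by (auto simp: smooth_near_def)
  have "open (fst c \<inter> S)" using S coordinate_system_open[OF c] by auto
  from open_chart_image[OF coordinate_system_chart[OF c] this] show ?thesis
    by (rule that[OF _ _ _ smooth_fun_on_coordinates[OF c S(1,3)]]) (use p S in auto)
qed

lemma smooth_near_derivative:
  assumes "c \<in> coordinate_systems A" "p \<in> fst c" "smooth_near A p f"
  shows "((f \<circ> chart_inv c) has_derivative (frechet_derivative (f \<circ> chart_inv c) (at (snd c p)))) (at (snd c p))"
  using smooth_nearE[OF assms] smooth_on_has_derivative by metis

lemma smooth_near_combine:
  assumes c: "c \<in> coordinate_systems A" "p \<in> fst c" and f: "smooth_near A p f" and g: "smooth_near A p g"
  shows "smooth_near A p (f + g)" "smooth_near A p (\<lambda>q. r * f q)" "smooth_near A p (f * g)"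
proof -
  obtain T where T: "open T" "snd c p \<in> T" "T \<subseteq> snd c ` fst c" "smooth_on T (f \<circ> chart_inv c)"
    using smooth_nearE[OF c f] .
  obtain T' where T': "open T'" "snd c p \<in> T'" "T' \<subseteq> snd c ` fst c" "smooth_on T' (g \<circ> chart_inv c)"
    using smooth_nearE[OF c g] .
  let ?T = "T \<inter> T'"
  have o: "open ?T" using T T' by blast
  have f: "smooth_on ?T (\<lambda>y. f (chart_inv c y))" using T(4) by (auto intro: smooth_on_subset simp: o_def)
  have g: "smooth_on ?T (\<lambda>y. g (chart_inv c y))" using T'(4) by (auto intro: smooth_on_subset simp: o_def)
  show "smooth_near A p (f + g)"
    by (rule smooth_nearI[OF c o]) (use T T' smooth_on_add[OF o f g] in \<open>auto simp: o_def\<close>)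
  show "smooth_near A p (\<lambda>q. r * f q)"
    by (rule smooth_nearI[OF c o]) (use T T' smooth_on_mult[OF o smooth_on_const[OF o] f] in \<open>auto simp: o_def\<close>)
  show "smooth_near A p (f * g)"
    by (rule smooth_nearI[OF c o]) (use T T' smooth_on_mult[OF o f g] in \<open>auto simp: o_def\<close>)
qed

lemma smooth_near_coordinate:
  assumes c: "c \<in> coordinate_systems A" "p \<in> fst c"
  shows "smooth_near A p (\<lambda>q. snd c q $ i)"
proof (rule smooth_nearI[OF c])
  show o: "open (snd c ` fst c)" using coordinate_system_chart[OF c(1)] by (simp add: is_chart_def)
  show "smooth_on (snd c ` fst c) ((\<lambda>q. snd c q $ i) \<circ> chart_inv c)"
    by (rule smooth_on_cong[OF o _ smooth_on_bounded_linear[OF bounded_linear_vec_nth o, of i]])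
      (simp add: apply_chart_inv)
qed (use c in auto)

lemma frechet_derivative_coordinate:
  assumes c: "c \<in> coordinate_systems A" "p \<in> fst c"
  shows "frechet_derivative ((\<lambda>q. snd c q $ i) \<circ> chart_inv c) (at (snd c p)) a = a $ i"
proof -
  have o: "open (snd c ` fst c)" using coordinate_system_chart[OF c(1)] by (simp add: is_chart_def)
  have "((\<lambda>q. snd c q $ i) \<circ> chart_inv c has_derivative (\<lambda>a. a $ i)) (at (snd c p))"
    by (rule has_derivative_transform_within_open[OF bounded_linear_imp_has_derivative[OF bounded_linear_vec_nth] o])
      (use c in \<open>auto simp: apply_chart_inv\<close>)
  from frechet_derivative_eq[OF this] show ?thesis by simp
qed

lemma components_vec_of:
  "c \<in> coordinate_systems A \<Longrightarrow> p \<in> fst c \<Longrightarrow> components c (vec_of A c p a) = a"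
  by (simp add: components_def vec_of_def smooth_near_coordinate frechet_derivative_coordinate vec_eq_iff)

lemma vec_of_linear:
  assumes c: "c \<in> coordinate_systems A" "p \<in> fst c"
  shows "vec_of A c p (a + b) = vec_of A c p a + vec_of A c p b"
    and "vec_of A c p (a - b) = vec_of A c p a - vec_of A c p b"
    and "vec_of A c p (r *\<^sub>R a) = scale r (vec_of A c p a)"
    and "vec_of A c p 0 = 0"
  using has_derivative_linear[OF smooth_near_derivative[OF c]]
  by (auto simp: vec_of_def fun_eq_iff scale_def linear_add linear_diff linear_scale linear_0)

lemma vec_of_sum:
  assumes c: "c \<in> coordinate_systems A" "p \<in> fst c"
  shows "vec_of A c p (\<Sum>i\<in>I. f i) = (\<Sum>i\<in>I. vec_of A c p (f i))"
  by (induction I rule: infinite_finite_induct) (simp_all add: vec_of_linear[OF c])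

lemma vec_of_coord_vectors:
  assumes c: "c \<in> coordinate_systems A" "p \<in> fst c"
  shows "(\<Sum>i\<in>UNIV. scale (a $ i) (coord_vector A c p i)) = vec_of A c p a"
proof -
  have "(\<Sum>i\<in>UNIV. scale (a $ i) (coord_vector A c p i)) = vec_of A c p (\<Sum>i\<in>UNIV. (a $ i) *\<^sub>R axis i 1)"
    by (simp add: vec_of_sum[OF c] vec_of_linear[OF c] coord_vector_eq)
  also have "(\<Sum>i\<in>UNIV. (a $ i) *\<^sub>R axis i 1) = a"
    using basis_expansion[of a] by (simp add: scalar_mult_eq_scaleR)
  finally show ?thesis .
qed

lemma vec_of_tangent:
  assumes c: "c \<in> coordinate_systems A" "p \<in> fst c"
  shows "vec_of A c p a \<in> tangent_space A p"
proof -
  let ?i = "chart_inv c" and ?y = "snd c p"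
  note d = smooth_near_derivative[OF c]
  have ip: "?i ?y = p" using chart_inv_apply[OF coordinate_system_chart[OF c(1)] c(2)] .
  have 1: "frechet_derivative ((f + g) \<circ> ?i) (at ?y) a =
      frechet_derivative (f \<circ> ?i) (at ?y) a + frechet_derivative (g \<circ> ?i) (at ?y) a"
    if "smooth_near A p f" "smooth_near A p g" for f g
  proof -
    have "((f + g) \<circ> ?i) = (\<lambda>y. (f \<circ> ?i) y + (g \<circ> ?i) y)" by auto
    with frechet_derivative_eq[OF has_derivative_add[OF d[OF that(1)] d[OF that(2)]]] show ?thesis by simp
  qed
  have 2: "frechet_derivative ((\<lambda>q. r * f q) \<circ> ?i) (at ?y) a = r * frechet_derivative (f \<circ> ?i) (at ?y) a"
    if "smooth_near A p f" for f r
  proof -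
    have "((\<lambda>q. r * f q) \<circ> ?i) = (\<lambda>y. r * (f \<circ> ?i) y)" by auto
    with frechet_derivative_eq[OF has_derivative_mult_right[OF d[OF that], of r]] show ?thesis by simp
  qed
  have 3: "frechet_derivative ((f * g) \<circ> ?i) (at ?y) a =
      f p * frechet_derivative (g \<circ> ?i) (at ?y) a + g p * frechet_derivative (f \<circ> ?i) (at ?y) a"
    if "smooth_near A p f" "smooth_near A p g" for f g
  proof -
    have "((f * g) \<circ> ?i) = (\<lambda>y. (f \<circ> ?i) y * (g \<circ> ?i) y)" by auto
    with frechet_derivative_eq[OF has_derivative_mult[OF d[OF that(1)] d[OF that(2)]]] show ?thesis
      by (simp add: ip)
  qed
  show ?thesis
    unfolding tangent_space_def vec_of_def
    using 1 2 3 smooth_near_combine[OF c] by simp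
qed

text \<open>The chain rule for the transition \<open>\<Psi>\<close> from \<open>d\<close> to
  \<open>c\<close> near \<open>p\<close>.\<close>

lemma vec_of_transfer:
  assumes c: "c \<in> coordinate_systems A" "p \<in> fst c" and d: "d \<in> coordinate_systems A" "p \<in> fst d"
    and T: "open T" "snd d p \<in> T" and \<Psi>: "(\<Psi> has_derivative \<Psi>') (at (snd d p))" "\<Psi> (snd d p) = snd c p"
    and eq: "\<And>y. y \<in> T \<Longrightarrow> chart_inv d y = chart_inv c (\<Psi> y)"
  shows "vec_of A d p a = vec_of A c p (\<Psi>' a)"
proof
  fix f
  show "vec_of A d p a f = vec_of A c p (\<Psi>' a) f"
  proof (cases "smooth_near A p f")
    case True
    let ?D = "frechet_derivative (f \<circ> chart_inv c) (at (snd c p))"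
    have "((f \<circ> chart_inv c) \<circ> \<Psi> has_derivative ?D \<circ> \<Psi>') (at (snd d p))"
      using smooth_near_derivative[OF c True] by (intro diff_chain_at \<Psi>(1)) (simp add: \<Psi>(2))
    then have "(f \<circ> chart_inv d has_derivative ?D \<circ> \<Psi>') (at (snd d p))"
      by (rule has_derivative_transform_within_open[OF _ T]) (simp add: eq)
    from frechet_derivative_eq[OF this] show ?thesis by (simp add: vec_of_def)
  qed (simp add: vec_of_def)
qed

lemma vec_of_field_smooth:
  assumes c: "c \<in> coordinate_systems A" and S: "open S" "S \<subseteq> fst c" and f: "smooth_fun_on A S f"
    and x: "smooth_on (snd c ` S) x"
  shows "smooth_on (snd c ` S) ((\<lambda>q. vec_of A c q (x (snd c q)) f) \<circ> chart_inv c)"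
proof -
  note ch = coordinate_system_chart[OF c]
  have o: "open (snd c ` S)" by (rule open_chart_image[OF ch S])
  have "snd c ` (fst c \<inter> S) = snd c ` S" using S(2) by (simp add: Int_absorb1)
  with smooth_fun_on_coordinates[OF c S(1) f] have sf: "smooth_on (snd c ` S) (f \<circ> chart_inv c)" by simp
  have near: "smooth_near A q f" if "q \<in> S" for q
    unfolding smooth_near_def using S f that coordinate_system_manifold[OF c] by blast
  show ?thesis
    by (rule smooth_on_cong[OF o _ smooth_on_derivative_along[OF o sf x]])
      (use S(2) near in \<open>auto simp: vec_of_def chart_inv_apply[OF ch] subset_iff\<close>)
qed

text \<open>X(Y f) is a second derivative of \<open>f\<close>, symmetric in the two directions, plus
  a first derivative along the derivative of \<open>y\<close>. The symmetric part cancels in the Lie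
  bracket.\<close>

lemma vec_of_field_lie:
  assumes c: "c \<in> coordinate_systems A" and W: "open W" "W \<subseteq> fst c" "p \<in> W"
    and X: "X p = vec_of A c p a" and Y: "\<And>q. q \<in> W \<Longrightarrow> Y q = vec_of A c q (y (snd c q))"
    and y: "smooth_on (snd c ` W) y" and f: "smooth_near A p f"
  shows "X p (\<lambda>q. Y q f) = frechet_derivative (\<lambda>z. frechet_derivative (f \<circ> chart_inv c) (at z) (y (snd c p))) (at (snd c p)) a
    + frechet_derivative (f \<circ> chart_inv c) (at (snd c p)) (frechet_derivative y (at (snd c p)) a)"
proof -
  note ch = coordinate_system_chart[OF c]
  have p: "p \<in> fst c" using W by blast
  let ?\<phi> = "f \<circ> chart_inv c" and ?y0 = "snd c p"
  obtain S where S: "open S" "p \<in> S" "S \<subseteq> manifold A" "smooth_fun_on A S f" using f by (auto simp: smooth_near_def)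
  let ?S = "S \<inter> W" and ?T = "snd c ` (S \<inter> W)"
  have oS: "open ?S" "?S \<subseteq> fst c" using S W by auto
  have T: "open ?T" "?y0 \<in> ?T" using open_chart_image[OF ch oS] S W by auto
  have fS: "smooth_fun_on A ?S f" using smooth_fun_on_subset[OF S(4)] by simp
  have s\<phi>: "smooth_on ?T ?\<phi>"
    using smooth_fun_on_coordinates[OF c oS(1) fS] oS(2) by (simp add: Int_absorb1)
  have yT: "smooth_on ?T y" using y by (rule smooth_on_subset) auto
  have near: "smooth_near A q f" if "q \<in> ?S" for q
    unfolding smooth_near_def using S that by blast
  have g: "((\<lambda>q. Y q f) \<circ> chart_inv c) z = frechet_derivative ?\<phi> (at z) (y z)" if "z \<in> ?T" for z
    using that Y near W(2) by (auto simp: vec_of_def chart_inv_apply[OF ch] subset_iff)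
  have sg: "smooth_on ?T ((\<lambda>q. Y q f) \<circ> chart_inv c)"
    by (rule smooth_on_cong[OF T(1) g[symmetric] smooth_on_derivative_along[OF T(1) s\<phi> yT]])
  have ng: "smooth_near A p (\<lambda>q. Y q f)"
    by (rule smooth_nearI[OF c p T _ sg]) (use oS in auto)
  let ?D = "\<lambda>b. frechet_derivative (\<lambda>z. frechet_derivative ?\<phi> (at z) b) (at ?y0)"
  note dy = smooth_on_has_derivative[OF yT T(2)]
  have d\<phi>: "?\<phi> differentiable (at ?y0)" using smooth_on_has_derivative[OF s\<phi> T(2)] by (auto simp: differentiable_def)
  have "((\<lambda>z. \<Sum>b\<in>Basis. (y z \<bullet> b) *\<^sub>R frechet_derivative ?\<phi> (at z) b) has_derivative
      (\<lambda>v. \<Sum>b\<in>Basis. (y ?y0 \<bullet> b) *\<^sub>R ?D b v + (frechet_derivative y (at ?y0) v \<bullet> b) *\<^sub>R frechet_derivative ?\<phi> (at ?y0) b)) (at ?y0)"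
    by (intro has_derivative_sum has_derivative_scaleR smooth_on_has_derivative[OF smooth_on_derivative[OF s\<phi>] T(2)]
          bounded_linear.has_derivative[OF bounded_linear_inner_left dy])
  then have "((\<lambda>q. Y q f) \<circ> chart_inv c has_derivative
      (\<lambda>v. \<Sum>b\<in>Basis. (y ?y0 \<bullet> b) *\<^sub>R ?D b v + (frechet_derivative y (at ?y0) v \<bullet> b) *\<^sub>R frechet_derivative ?\<phi> (at ?y0) b)) (at ?y0)"
  proof (rule has_derivative_transform_within_open[OF _ T])
    fix z assume z: "z \<in> ?T"
    show "(\<Sum>b\<in>Basis. (y z \<bullet> b) *\<^sub>R frechet_derivative ?\<phi> (at z) b) = ((\<lambda>q. Y q f) \<circ> chart_inv c) z"
      unfolding g[OF z] by (rule has_derivative_Basis[OF smooth_on_has_derivative[OF s\<phi> z], symmetric])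
  qed
  from frechet_derivative_eq[OF this] have "X p (\<lambda>q. Y q f) =
     (\<Sum>b\<in>Basis. (y ?y0 \<bullet> b) *\<^sub>R ?D b a) + (\<Sum>b\<in>Basis. (frechet_derivative y (at ?y0) a \<bullet> b) *\<^sub>R frechet_derivative ?\<phi> (at ?y0) b)"
    using ng by (simp add: X vec_of_def sum.distrib)
  also have "(\<Sum>b\<in>Basis. (frechet_derivative y (at ?y0) a \<bullet> b) *\<^sub>R frechet_derivative ?\<phi> (at ?y0) b)
      = frechet_derivative ?\<phi> (at ?y0) (frechet_derivative y (at ?y0) a)"
    by (rule has_derivative_Basis[OF smooth_on_has_derivative[OF s\<phi> T(2)], symmetric])
  also have "(\<Sum>b\<in>Basis. (y ?y0 \<bullet> b) *\<^sub>R ?D b a) = ?D (y ?y0) a"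
  proof -
    have sym: "?D b v = ?D v b" for b v
      using s\<phi> by (intro symmetric_second_derivative[OF T]) (simp add: smooth_on_def)
    have "(\<Sum>b\<in>Basis. (y ?y0 \<bullet> b) *\<^sub>R ?D b a) = (\<Sum>b\<in>Basis. (y ?y0 \<bullet> b) *\<^sub>R ?D a b)"
      by (rule sum.cong[OF refl]) (rule arg_cong[OF sym])
    also have "\<dots> = ?D a (y ?y0)"
      by (rule has_derivative_Basis[OF smooth_on_has_derivative[OF smooth_on_derivative[OF s\<phi>] T(2)], symmetric])
    also have "\<dots> = ?D (y ?y0) a" by (rule sym)
    finally show ?thesis .
  qed
  finally show ?thesis .
qed

text \<open>Vector fields are total functions, arbitrary outside the region of interest. Comparison
  on \<open>W\<close> alone lets torsions be computed term by term on coordinate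
  representatives.\<close>

definition represented :: "('a, 'n) chart \<Rightarrow> 'a set \<Rightarrow> 'a vfield \<Rightarrow> (real ^ 'n \<Rightarrow> real ^ 'n) \<Rightarrow> bool" where
  "represented c W X x \<longleftrightarrow> (\<forall>q\<in>W. X q = vec_of A c q (x (snd c q)))"

lemma represented_cong:
  "represented c W X x \<Longrightarrow> (\<And>y. y \<in> snd c ` W \<Longrightarrow> x y = x' y) \<Longrightarrow> represented c W X x'"
  by (auto simp: represented_def)

lemma represented_add_diff:
  assumes c: "c \<in> coordinate_systems A" "W \<subseteq> fst c" and X: "represented c W X x" and Y: "represented c W Y y"
  shows "represented c W (X + Y) (\<lambda>q. x q + y q)" "represented c W (X - Y) (\<lambda>q. x q - y q)"
  using X Y c(2) vec_of_linear[OF c(1)] by (auto simp: represented_def subset_iff)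

lemma represented_bracket:
  assumes c: "c \<in> coordinate_systems A" and W: "open W" "W \<subseteq> fst c"
    and X: "represented c W X x" and Y: "represented c W Y y"
    and x: "smooth_on (snd c ` W) x" and y: "smooth_on (snd c ` W) y"
  shows "represented c W (lie_bracket A X Y) (bracket x y)"
  unfolding represented_def
proof (intro ballI ext)
  fix q f assume q: "q \<in> W"
  show "lie_bracket A X Y q f = vec_of A c q (bracket x y (snd c q)) f"
  proof (cases "smooth_near A q f")
    case True
    let ?y = "snd c q" and ?\<phi> = "f \<circ> chart_inv c"
    have qc: "q \<in> fst c" using q W by blast
    note X' = X[unfolded represented_def, rule_format] and Y' = Y[unfolded represented_def, rule_format]
    obtain T where T: "open T" "?y \<in> T" "smooth_on T ?\<phi>" using smooth_nearE[OF c qc True] by metis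
    have sym: "frechet_derivative (\<lambda>z. frechet_derivative ?\<phi> (at z) w) (at ?y) v =
      frechet_derivative (\<lambda>z. frechet_derivative ?\<phi> (at z) v) (at ?y) w" for v w
      using T by (intro symmetric_second_derivative[OF T(1,2)]) (simp add: smooth_on_def)
    have l: "linear (frechet_derivative ?\<phi> (at ?y))"
      using has_derivative_linear[OF smooth_on_has_derivative[OF T(3,2)]] .
    show ?thesis
      using True vec_of_field_lie[where X = X and Y = Y, OF c W q X'[OF q] _ y True, OF Y']
        vec_of_field_lie[where X = Y and Y = X, OF c W q Y'[OF q] _ x True, OF X']
        sym[of "y ?y" "x ?y"]
      by (simp add: lie_bracket_def vec_of_def bracket_def linear_diff[OF l])
  qed (simp add: lie_bracket_def vec_of_def)
qed

end

text \<open>The tangent bases will come from the Jordan bases. Their cardinality fixes the dimension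
  of the space of derivations, which makes its description by coordinates a matter of linear
  algebra.\<close>

locale operator_field = atlas A for A :: "('a::{t2_space, second_countable_topology}, 'n::finite) chart set" +
  fixes L :: "'a opfield"
  assumes dim: "\<And>p. p \<in> manifold A \<Longrightarrow> \<exists>e. tangent_basis A p e"
    and L: "smooth_operator_field A L"
begin

text \<open>Being as many as the vectors of a basis, the coordinate vectors span the space of derivations.\<close>

lemma vec_of_components:
  assumes c: "c \<in> coordinate_systems A" "p \<in> fst c" and v: "v \<in> tangent_space A p"
  shows "vec_of A c p (components c v) = v"
proof -
  obtain e where e: "tangent_basis A p e" using dim coordinate_system_manifold[OF c(1)] c(2) by blast
  then have ex: "\<exists>b :: real ^ 'n. w = (\<Sum>i\<in>UNIV. scale (b $ i) (e i))" if "w \<in> tangent_space A p" for w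
    using that unfolding tangent_basis_def by blast
  have "\<forall>j. \<exists>b :: real ^ 'n. coord_vector A c p j = (\<Sum>i\<in>UNIV. scale (b $ i) (e i))"
    using ex vec_of_tangent[OF c] by (simp add: coord_vector_eq)
  then obtain P :: "'n \<Rightarrow> real ^ 'n" where P: "\<And>j. coord_vector A c p j = (\<Sum>i\<in>UNIV. scale (P j $ i) (e i))" by metis
  \<comment> \<open>The change of coefficients from the coordinate vectors to the basis
    \<open>e\<close>. It is injective since components recover the coefficients, hence
    surjective.\<close>
  define F where "F a = (\<chi> i. \<Sum>j\<in>UNIV. a $ j * P j $ i)" for a :: "real ^ 'n"
  have lin: "linear F"
    by (rule linearI) (simp_all add: F_def vec_eq_iff sum.distrib algebra_simps sum_distrib_left)
  have F: "vec_of A c p a = (\<Sum>i\<in>UNIV. scale (F a $ i) (e i))" for a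
  proof -
    have "vec_of A c p a = (\<Sum>j\<in>UNIV. scale (a $ j) (\<Sum>i\<in>UNIV. scale (P j $ i) (e i)))"
      unfolding vec_of_coord_vectors[OF c, symmetric] P ..
    also have "\<dots> = (\<Sum>i\<in>UNIV. scale (F a $ i) (e i))"
      by (subst fun_eq_iff)
        (auto simp: sum_fun_apply scale_def F_def sum_distrib_left sum_distrib_right mult.assoc intro: sum.swap)
    finally show ?thesis .
  qed
  have "inj F"
  proof (rule linear_injective_0[OF lin, THEN iffD2], intro allI impI)
    fix a assume "F a = 0"
    then have "vec_of A c p a = vec_of A c p 0" by (simp add: F linear_0[OF lin])
    then show "a = 0" using components_vec_of[OF c] by metis
  qed
  then have "surj F" using linear_injective_imp_surjective[OF lin] by blast
  moreover obtain b :: "real ^ 'n" where b: "v = (\<Sum>i\<in>UNIV. scale (b $ i) (e i))" using ex[OF v] by blast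
  ultimately obtain a where "b = F a" by blast
  then have "v = vec_of A c p a" by (simp add: F b)
  then show ?thesis by (simp add: components_vec_of[OF c])
qed

text \<open>\<open>operator_matrix\<close> is a definite description, so a representing matrix is
  exhibited and shown unique by components; linearity extends the formula from coordinate vectors to
  all of them.\<close>

lemma operator_vec_of:
  assumes c: "c \<in> coordinate_systems A" "p \<in> fst c"
  shows "L p (vec_of A c p a) = vec_of A c p (operator_matrix A L c p *v a)"
proof -
  have te: "tangent_endomorphism A p (L p)"
    using L coordinate_system_manifold[OF c(1)] c(2) by (auto simp: smooth_operator_field_def)
  have rep: "represents (coord_vector A c p) (L p) M \<longleftrightarrow> (\<forall>j. L p (vec_of A c p (axis j 1)) = vec_of A c p (column j M))" for M
    using vec_of_coord_vectors[OF c, of "column _ M"]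
    by (simp add: represents_def column_def flip: coord_vector_eq)
  define M0 where "M0 = (\<chi> i j. components c (L p (vec_of A c p (axis j 1))) $ i)"
  have M0: "column j M0 = components c (L p (vec_of A c p (axis j 1)))" for j
    by (simp add: M0_def column_def vec_eq_iff)
  have "represents (coord_vector A c p) (L p) M0"
    unfolding rep M0 using te vec_of_tangent[OF c]
    by (auto simp: tangent_endomorphism_def intro!: vec_of_components[OF c, symmetric])
  moreover have "M = M0" if "represents (coord_vector A c p) (L p) M" for M
  proof -
    have "column j M = column j M0" for j
      using that components_vec_of[OF c, of "column j M"] by (simp add: rep M0)
    then show ?thesis by (simp add: column_def vec_eq_iff)
  qed
  ultimately have "operator_matrix A L c p = M0"
    unfolding operator_matrix_def by (rule the_equality)
  then have M: "L p (vec_of A c p (axis j 1)) = vec_of A c p (column j (operator_matrix A L c p))" for j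
    using \<open>represents (coord_vector A c p) (L p) M0\<close> by (simp add: rep)
  let ?M = "operator_matrix A L c p"
  have add: "L p (vec_of A c p (x + y)) = L p (vec_of A c p x) + L p (vec_of A c p y)"
    and sc: "L p (vec_of A c p (r *\<^sub>R x)) = scale r (L p (vec_of A c p x))" for x y r
    using te vec_of_tangent[OF c] by (auto simp: vec_of_linear[OF c] tangent_endomorphism_def)
  have zero: "L p (vec_of A c p 0) = 0" using sc[of 0 0] by (simp add: scale_def fun_eq_iff)
  have "L p (vec_of A c p (\<Sum>j\<in>J. (a $ j) *\<^sub>R axis j 1)) = vec_of A c p (\<Sum>j\<in>J. (a $ j) *\<^sub>R column j ?M)" if "finite J" for J
    using that
  proof (induction J)
    case empty
    show ?case using zero by (simp only: sum.empty vec_of_linear(4)[OF c])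
  next
    case (insert j J)
    show ?case
      unfolding sum.insert[OF insert.hyps] add insert.IH sc M by (simp only: vec_of_linear[OF c])
  qed
  from this[of UNIV] show ?thesis
    using basis_expansion[of a] by (simp add: matrix_mult_sum scalar_mult_eq_scaleR)
qed

definition matrix_op :: "('a, 'n) chart \<Rightarrow> real ^ 'n \<Rightarrow> (real ^ 'n) \<Rightarrow>\<^sub>L (real ^ 'n)" where
  "matrix_op c y = Blinfun ((*v) (operator_matrix A L c (chart_inv c y)))"

lemma matrix_op_apply: "blinfun_apply (matrix_op c y) x = operator_matrix A L c (chart_inv c y) *v x"
  unfolding matrix_op_def by (simp add: bounded_linear_Blinfun_apply)

lemma operator_vec_of':
  "c \<in> coordinate_systems A \<Longrightarrow> p \<in> fst c \<Longrightarrow> L p (vec_of A c p a) = vec_of A c p (matrix_op c (snd c p) a)"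
  by (simp add: operator_vec_of matrix_op_apply chart_inv_apply[OF coordinate_system_chart])

lemma smooth_operator_matrix:
  assumes c: "c \<in> A"
  shows "smooth_on (snd c ` fst c) (\<lambda>y. operator_matrix A L c (chart_inv c y) $ i $ j)"
  using L c unfolding smooth_operator_field_def smooth_fun_on_def by (force simp: o_def)

text \<open>Smoothness of the matrix is given in charts of \<open>A\<close>, so the torsions are
  computed there; a triangular coordinate system enters through its coordinate functions.\<close>

lemma smooth_matrix_op:
  assumes c: "c \<in> A"
  shows "smooth_on (snd c ` fst c) (matrix_op c)"
proof -
  have o: "open (snd c ` fst c)"
    using coordinate_system_chart[OF atlas_coordinate_system[OF c]] by (simp add: is_chart_def)
  have "smooth_on (snd c ` fst c) (\<lambda>y. matrix_op c y v)" for v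
    unfolding matrix_op_apply
    by (rule smooth_on_vec[OF o])
      (auto simp: matrix_vector_mult_def intro!: smooth_on_sum smooth_on_mult o smooth_on_const smooth_operator_matrix c)
  then show ?thesis unfolding smooth_on_def by (auto intro: Ck_on_blinfun[OF o])
qed

lemma represented_op:
  assumes c: "c \<in> coordinate_systems A" "W \<subseteq> fst c" and X: "represented c W X x"
  shows "represented c W (op_app L X) (\<lambda>q. matrix_op c q (x q))"
  using X c(2) operator_vec_of'[OF c(1)] by (auto simp: represented_def op_app_def)

lemma represented_nijenhuis:
  assumes c: "c \<in> A" and W: "open W" "W \<subseteq> fst c"
    and X: "represented c W X x" and Y: "represented c W Y y"
    and x: "smooth_on (snd c ` W) x" and y: "smooth_on (snd c ` W) y"
  shows "represented c W (nijenhuis_torsion A L X Y)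
    (\<lambda>q. nij (matrix_op c q) (frechet_derivative (matrix_op c) (at q)) (x q) (y q))"
proof -
  note cs = atlas_coordinate_system[OF c]
  have o: "open (snd c ` W)" using open_chart_image[OF coordinate_system_chart[OF cs] W] .
  have sL: "smooth_on (snd c ` W) (matrix_op c)" using W(2) by (intro smooth_on_subset[OF smooth_matrix_op[OF c]]) auto
  note ops = represented_op[OF cs W(2)]
  note sm = bounded_bilinear.smooth_on_bilinear[OF bounded_bilinear_blinfun_apply o sL]
  note br = represented_bracket[OF cs W]
  have "represented c W (nijenhuis_torsion A L X Y) (\<lambda>q. matrix_op c q (matrix_op c q (bracket x y q))
      + bracket (\<lambda>q. matrix_op c q (x q)) (\<lambda>q. matrix_op c q (y q)) q
      - matrix_op c q (bracket (\<lambda>q. matrix_op c q (x q)) y q) - matrix_op c q (bracket x (\<lambda>q. matrix_op c q (y q)) q))"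
    unfolding nijenhuis_torsion_def
    by (intro represented_add_diff[OF cs W(2)] ops br X Y x y sm)
  then show ?thesis
  proof (rule represented_cong)
    fix q assume q: "q \<in> snd c ` W"
    have "x differentiable at q" "y differentiable at q"
      using smooth_on_has_derivative[OF x q] smooth_on_has_derivative[OF y q] by (auto simp: differentiable_def)
    from nij_bracket[OF smooth_on_has_derivative[OF sL q] this]
    show "matrix_op c q (matrix_op c q (bracket x y q))
      + bracket (\<lambda>q. matrix_op c q (x q)) (\<lambda>q. matrix_op c q (y q)) q
      - matrix_op c q (bracket (\<lambda>q. matrix_op c q (x q)) y q) - matrix_op c q (bracket x (\<lambda>q. matrix_op c q (y q)) q)
      = nij (matrix_op c q) (frechet_derivative (matrix_op c) (at q)) (x q) (y q)" .
  qed
qed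

lemma represented_haantjes:
  assumes c: "c \<in> A" and W: "open W" "W \<subseteq> fst c"
    and X: "represented c W X x" and Y: "represented c W Y y"
    and x: "smooth_on (snd c ` W) x" and y: "smooth_on (snd c ` W) y"
  shows "represented c W (haantjes_torsion A L X Y)
    (\<lambda>q. haa (matrix_op c q) (frechet_derivative (matrix_op c) (at q)) (x q) (y q))"
proof -
  note cs = atlas_coordinate_system[OF c]
  have o: "open (snd c ` W)" using open_chart_image[OF coordinate_system_chart[OF cs] W] .
  have sL: "smooth_on (snd c ` W) (matrix_op c)" using W(2) by (intro smooth_on_subset[OF smooth_matrix_op[OF c]]) auto
  note sm = bounded_bilinear.smooth_on_bilinear[OF bounded_bilinear_blinfun_apply o sL]
  show ?thesis
    unfolding haantjes_torsion_def haa_def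
    by (intro represented_add_diff[OF cs W(2)] represented_op[OF cs W(2)] represented_nijenhuis[OF c W] X Y x y sm)
qed

text \<open>The components of a field are its values on the coordinate functions, and a vector field
  sends smooth functions to smooth functions.\<close>

lemma vector_field_represented:
  assumes c: "c \<in> coordinate_systems A" and U: "open U" and X: "vector_field_on A U X"
  defines "x \<equiv> (\<lambda>y. components c (X (chart_inv c y)))"
  shows "represented c (U \<inter> fst c) X x" "smooth_on (snd c ` (U \<inter> fst c)) x"
proof -
  note ch = coordinate_system_chart[OF c]
  let ?W = "U \<inter> fst c"
  have W: "open ?W" using U coordinate_system_open[OF c] by blast
  have o: "open (snd c ` ?W)" using open_chart_image[OF ch W] by simp
  show "represented c ?W X x"
    unfolding represented_def x_def
    using X by (auto simp: vector_field_on_def chart_inv_apply[OF ch] intro!: vec_of_components[OF c, symmetric])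
  show "smooth_on (snd c ` ?W) x"
  proof (rule smooth_on_vec[OF o])
    fix i
    have "smooth_fun_on A ?W (\<lambda>q. snd c q $ i)"
    proof (rule smooth_fun_onI[OF c W])
      show "smooth_on (snd c ` ?W) ((\<lambda>q. snd c q $ i) \<circ> chart_inv c)"
        by (rule smooth_on_cong[OF o _ smooth_on_bounded_linear[OF bounded_linear_vec_nth o, of i]])
          (auto simp: chart_inv_apply[OF ch])
    qed simp
    then have "smooth_fun_on A ?W (\<lambda>q. X q (\<lambda>q. snd c q $ i))"
      using X W unfolding vector_field_on_def by auto
    from smooth_fun_on_coordinates[OF c W this]
    show "smooth_on (snd c ` ?W) (\<lambda>y. x y $ i)"
      by (simp add: x_def components_def o_def Int_absorb1)
  qed
qed

lemma constant_vector_field: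
  assumes c: "c \<in> coordinate_systems A"
  shows "vector_field_on A (fst c) (\<lambda>q. vec_of A c q a)"
  unfolding vector_field_on_def
proof (intro conjI ballI allI impI)
  show "vec_of A c p a \<in> tangent_space A p" if "p \<in> fst c" for p using vec_of_tangent[OF c that] .
  fix S f assume S: "open S" "S \<subseteq> fst c" "smooth_fun_on A S f"
  show "smooth_fun_on A S (\<lambda>p. vec_of A c p a f)"
    by (rule smooth_fun_onI[OF c S(1,2) vec_of_field_smooth[OF c S smooth_on_const[OF
              open_chart_image[OF coordinate_system_chart[OF c] S(1,2)]]]])
qed

end

section \<open>Operator fields with a single Jordan block\<close>

locale jordan_field = operator_field A L
  for A :: "('a::{t2_space, second_countable_topology}, 3) chart set" and L :: "'a opfield" +
  assumes jordan: "\<And>p. p \<in> manifold A \<Longrightarrow> single_jordan_block_at A L p"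
begin

text \<open>The trace of the Jordan block is three times its eigenvalue. In this form smoothness in
  \<open>y\<close> is evident, whereas the hypothesis chooses the eigenvalue separately at each
  point.\<close>

definition eigenvalue :: "('a, 3) chart \<Rightarrow> real ^ 3 \<Rightarrow> real" where
  "eigenvalue c y = trace (operator_matrix A L c (chart_inv c y)) / 3"

definition nil_part :: "('a, 3) chart \<Rightarrow> real ^ 3 \<Rightarrow> (real ^ 3) \<Rightarrow>\<^sub>L (real ^ 3)" where
  "nil_part c y = matrix_op c y - eigenvalue c y *\<^sub>R id_blinfun"

lemma nil_part_nilpotent:
  assumes c: "c \<in> coordinate_systems A" and y: "y \<in> snd c ` fst c"
  shows "nil_part c y (nil_part c y (nil_part c y x)) = 0"
    and "\<exists>\<xi>. nil_part c y (nil_part c y \<xi>) \<noteq> 0"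
proof -
  obtain p where p: "p \<in> fst c" "y = snd c p" using y by blast
  have ip: "chart_inv c y = p" using chart_inv_apply[OF coordinate_system_chart[OF c] p(1)] p(2) by simp
  let ?M = "operator_matrix A L c p"
  have "p \<in> manifold A" using coordinate_system_manifold[OF c] p(1) by blast
  then obtain l e where e: "tangent_basis A p e" "represents e (L p) (jordan_block3 l)"
    using jordan unfolding single_jordan_block_at_def by blast
  define E where "E j = components c (e j)" for j
  have eE: "e j = vec_of A c p (E j)" for j
    unfolding E_def using e(1) by (intro vec_of_components[OF c p(1), symmetric]) (simp add: tangent_basis_def)
  have ME: "?M *v E j = (\<Sum>i\<in>UNIV. (jordan_block3 l $ i $ j) *\<^sub>R E i)" for j
  proof -
    have "vec_of A c p (?M *v E j) = (\<Sum>i\<in>UNIV. scale (jordan_block3 l $ i $ j) (e i))"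
      using e(2) operator_vec_of[OF c p(1), of "E j"] by (simp add: represents_def eE)
    also have "\<dots> = vec_of A c p (\<Sum>i\<in>UNIV. (jordan_block3 l $ i $ j) *\<^sub>R E i)"
      by (simp add: vec_of_sum[OF c p(1)] vec_of_linear[OF c p(1)] eE)
    finally show ?thesis using components_vec_of[OF c p(1)] by metis
  qed
  have M1: "?M *v E 1 = l *\<^sub>R E 1" and M2: "?M *v E 2 = E 1 + l *\<^sub>R E 2" and M3: "?M *v E 3 = E 2 + l *\<^sub>R E 3"
    unfolding ME sum_3 by (simp_all add: jordan_block3_def)
  \<comment> \<open>The Jordan basis in coordinates, as columns. It is a basis, so \<open>P\<close>
    is invertible and conjugates the matrix of the operator to the Jordan block; the trace is
    preserved.\<close>
  define P where "P = (\<chi> i j. E j $ i)"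
  have P: "P *v b = (b $ 1) *\<^sub>R E 1 + (b $ 2) *\<^sub>R E 2 + (b $ 3) *\<^sub>R E 3" for b
    by (simp add: P_def matrix_vector_mult_def sum_3 vec_eq_iff algebra_simps)
  have "surj ((*v) P)"
    unfolding surj_def
  proof
    fix x
    obtain b :: "real ^ 3" where "vec_of A c p x = (\<Sum>i\<in>UNIV. scale (b $ i) (e i))"
      using e(1) vec_of_tangent[OF c p(1)] unfolding tangent_basis_def by blast
    also have "\<dots> = vec_of A c p (P *v b)"
      unfolding P by (simp add: sum_3 eE vec_of_linear[OF c p(1)])
    finally have "x = P *v b" using components_vec_of[OF c p(1)] by metis
    then show "\<exists>b. x = P *v b" by blast
  qed
  then obtain Q where Q: "P ** Q = mat 1" using matrix_right_invertible_surjective by blast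
  then have QP: "Q ** P = mat 1" using matrix_left_right_inverse by blast
  have MP: "?M ** P = P ** jordan_block3 l"
    unfolding matrix_eq
  proof
    fix b
    have "jordan_block3 l *v b = vector [l * b $ 1 + b $ 2, l * b $ 2 + b $ 3, l * b $ 3]"
      by (simp add: jordan_block3_def matrix_vector_mult_def vec_eq_iff forall_3 sum_3)
    then show "(?M ** P) *v b = (P ** jordan_block3 l) *v b"
      by (simp add: matrix_vector_mul_assoc[symmetric] P matrix_vector_right_distrib matrix_vector_mult_scaleR M1 M2 M3 algebra_simps)
  qed
  have "trace ?M = trace (?M ** P ** Q)" by (simp add: Q matrix_mul_assoc[symmetric])
  also have "\<dots> = trace (P ** jordan_block3 l ** Q)" by (simp add: MP)
  also have "\<dots> = trace (Q ** (P ** jordan_block3 l))" by (rule trace_mul_sym)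
  also have "\<dots> = trace (jordan_block3 l)" by (simp add: matrix_mul_assoc QP)
  also have "\<dots> = 3 * l" by (simp add: trace_def sum_3 jordan_block3_def)
  finally have ev: "eigenvalue c y = l" by (simp add: eigenvalue_def ip)
  have N: "nil_part c y x = ?M *v x - l *\<^sub>R x" for x
    by (simp add: nil_part_def blinfun.bilinear_simps matrix_op_apply ip ev)
  have N1: "nil_part c y (E 1) = 0" and N2: "nil_part c y (E 2) = E 1" and N3: "nil_part c y (E 3) = E 2"
    by (simp_all add: N M1 M2 M3)
  have "x = P *v (Q *v x)" by (simp add: matrix_vector_mul_assoc Q)
  then obtain b where "x = P *v b" by blast
  then show "nil_part c y (nil_part c y (nil_part c y x)) = 0"
    by (simp add: P blinfun.bilinear_simps N1 N2 N3)
  have "E 1 \<noteq> 0"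
  proof
    assume "E 1 = 0"
    then have "P *v axis 1 1 = 0" by (simp add: P axis_def)
    then have "Q *v (P *v axis 1 1) = 0" by simp
    then have "(axis 1 1 :: real ^ 3) = 0" by (simp only: matrix_vector_mul_assoc QP matrix_vector_mul_lid)
    then show False by (simp add: axis_eq_0_iff)
  qed
  then show "\<exists>\<xi>. nil_part c y (nil_part c y \<xi>) \<noteq> 0" by (intro exI[of _ "E 3"]) (simp add: N3 N2)
qed

lemma nilpotent_shift_chart:
  assumes c: "c \<in> A" and W: "open W" "W \<subseteq> fst c"
  shows "nilpotent_shift (snd c ` W) (matrix_op c) (eigenvalue c) (nil_part c)"
proof
  note cs = atlas_coordinate_system[OF c]
  have sub: "snd c ` W \<subseteq> snd c ` fst c" using W(2) by blast
  show o: "open (snd c ` W)" using open_chart_image[OF coordinate_system_chart[OF cs] W] .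
  show "smooth_on (snd c ` W) (matrix_op c)" using smooth_on_subset[OF smooth_matrix_op[OF c] sub] .
  have "smooth_on (snd c ` W) (\<lambda>y. (1/3) * (\<Sum>i\<in>UNIV. operator_matrix A L c (chart_inv c y) $ i $ i))"
    by (intro smooth_on_mult smooth_on_const smooth_on_sum o smooth_on_subset[OF smooth_operator_matrix[OF c] sub])
  then show "smooth_on (snd c ` W) (eigenvalue c)" by (simp add: eigenvalue_def[abs_def] trace_def)
  show "nil_part c q = matrix_op c q - eigenvalue c q *\<^sub>R id_blinfun" for q by (rule nil_part_def)
  show "nil_part c q (nil_part c q (nil_part c q x)) = 0" "\<exists>\<xi>. nil_part c q (nil_part c q \<xi>) \<noteq> 0"
    if "q \<in> snd c ` W" for q x
    using nil_part_nilpotent[OF cs subsetD[OF sub that]] .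
qed

text \<open>In triangular coordinates, the differential of the last coordinate is an eigenvector of the dual operator.\<close>

lemma haa_eq_0_of_triangular:
  assumes c: "c \<in> A" and d: "d \<in> coordinate_systems A" and p: "p \<in> fst c" "p \<in> fst d"
    and ut: "\<And>q. q \<in> fst d \<Longrightarrow> upper_triangular3 (operator_matrix A L d q)"
  shows "haa (matrix_op c (snd c p)) (frechet_derivative (matrix_op c) (at (snd c p))) x y = 0"
proof -
  note cs = atlas_coordinate_system[OF c]
  let ?W = "fst c \<inter> fst d"
  have W: "open ?W" "?W \<subseteq> fst c" using coordinate_system_open[OF cs] coordinate_system_open[OF d] by auto
  interpret nilpotent_shift "snd c ` ?W" "matrix_op c" "eigenvalue c" "nil_part c"
    by (rule nilpotent_shift_chart[OF c W])
  define u where "u = (\<lambda>q. snd d q $ 3) \<circ> chart_inv c"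
  \<comment> \<open>The last row of an upper triangular matrix has only its diagonal entry, which is
    thus the eigenvalue of the dual operator on the differential of the last coordinate.\<close>
  define m where "m y = operator_matrix A L d (chart_inv c y) $ 3 $ 3" for y
  have du: "frechet_derivative u (at (snd c q)) a = components d (vec_of A c q a) $ 3" if "q \<in> ?W" for q a
    using smooth_near_coordinate[OF d, of q 3] that by (simp add: u_def components_def vec_of_def)
  show ?thesis
  proof (rule haa_eq_0_of_invariant_function[of u m])
    show "smooth_on (snd c ` ?W) u"
      using smooth_on_bounded_linear_comp[OF bounded_linear_vec_nth[of 3] V coordinate_system_compatible(2)[OF d c]]
      by (simp add: u_def o_def)
    show "snd c p \<in> snd c ` ?W" using p by blast
  next
    fix y assume "y \<in> snd c ` ?W"
    then obtain q where q: "q \<in> ?W" "y = snd c q" by blast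
    then have qc: "q \<in> fst c" and qd: "q \<in> fst d" by auto
    \<comment> \<open>The last coordinate vector of \<open>d\<close>, read in \<open>c\<close>,
      witnesses that the differential of \<open>u\<close> is nonzero.\<close>
    let ?a = "components c (vec_of A d q (axis 3 1))"
    have "vec_of A c q ?a = vec_of A d q (axis 3 1)"
      by (rule vec_of_components[OF cs qc vec_of_tangent[OF d qd]])
    then have "frechet_derivative u (at y) ?a = 1"
      unfolding q(2) du[OF q(1)] by (simp add: components_vec_of[OF d qd] axis_def)
    then show "\<exists>v. frechet_derivative u (at y) v \<noteq> 0" by (metis zero_neq_one)
    fix v
    let ?b = "components d (vec_of A c q v)"
    have "vec_of A c q (matrix_op c y v) = L q (vec_of A c q v)" unfolding q(2) by (simp add: operator_vec_of'[OF cs qc])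
    also have "\<dots> = L q (vec_of A d q ?b)" by (simp add: vec_of_components[OF d qd vec_of_tangent[OF cs qc]])
    also have "\<dots> = vec_of A d q (operator_matrix A L d q *v ?b)" by (rule operator_vec_of[OF d qd])
    finally have "components d (vec_of A c q (matrix_op c y v)) = operator_matrix A L d q *v ?b"
      by (simp add: components_vec_of[OF d qd])
    then show "frechet_derivative u (at y) (matrix_op c y v) = m y * frechet_derivative u (at y) v"
      using ut[OF qd] unfolding q(2) du[OF q(1)]
      by (simp add: m_def chart_inv_apply[OF coordinate_system_chart[OF cs] qc] upper_triangular3_def
          matrix_vector_mult_def sum_3)
  qed
qed

lemma haantjes_vanishes_of_triangular:
  assumes ut: "\<And>p. p \<in> manifold A \<Longrightarrow> \<exists>d\<in>coordinate_systems A. p \<in> fst d \<and>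
    (\<forall>q\<in>fst d. upper_triangular3 (operator_matrix A L d q))"
  shows "haantjes_vanishes A L"
  unfolding haantjes_vanishes_def
proof (intro allI impI ballI)
  fix U X Y p assume U: "open U" "U \<subseteq> manifold A" and X: "vector_field_on A U X" and Y: "vector_field_on A U Y"
    and p: "p \<in> U"
  obtain c where c: "c \<in> A" "p \<in> fst c" using U(2) p by (auto simp: manifold_def)
  obtain d where d: "d \<in> coordinate_systems A" "p \<in> fst d" "\<forall>q\<in>fst d. upper_triangular3 (operator_matrix A L d q)"
    using ut U(2) p by blast
  note cs = atlas_coordinate_system[OF c(1)]
  have W: "open (U \<inter> fst c)" "U \<inter> fst c \<subseteq> fst c" using U coordinate_system_open[OF cs] by auto
  have "p \<in> U \<inter> fst c" using p c by blast
  then have "haantjes_torsion A L X Y p = vec_of A c p 0"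
    using represented_haantjes[OF c(1) W vector_field_represented(1)[OF cs U(1) X] vector_field_represented(1)[OF cs U(1) Y]
        vector_field_represented(2)[OF cs U(1) X] vector_field_represented(2)[OF cs U(1) Y]]
      haa_eq_0_of_triangular[OF c(1) d(1) c(2) d(2)] d(3)
    by (simp add: represented_def)
  then show "haantjes_torsion A L X Y p = 0" using vec_of_linear(4)[OF cs c(2)] by simp
qed

text \<open>Constant coordinate fields take any prescribed pair of values at the point, so the
  vanishing of the torsion on fields gives that of the pointwise expression.\<close>

lemma haa_eq_0_of_haantjes_vanishes:
  assumes h: "haantjes_vanishes A L" and c: "c \<in> A" and y: "y \<in> snd c ` fst c"
  shows "haa (matrix_op c y) (frechet_derivative (matrix_op c) (at y)) a b = 0"
proof -
  note cs = atlas_coordinate_system[OF c]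
  obtain p where p: "p \<in> fst c" "y = snd c p" using y by blast
  have o: "open (snd c ` fst c)" using coordinate_system_chart[OF cs] by (simp add: is_chart_def)
  have r: "represented c (fst c) (\<lambda>q. vec_of A c q a) (\<lambda>_. a)" for a by (simp add: represented_def)
  have "haantjes_torsion A L (\<lambda>q. vec_of A c q a) (\<lambda>q. vec_of A c q b) p = 0"
    using h coordinate_system_open[OF cs] coordinate_system_manifold[OF cs] constant_vector_field[OF cs] p(1)
    unfolding haantjes_vanishes_def by blast
  moreover have "haantjes_torsion A L (\<lambda>q. vec_of A c q a) (\<lambda>q. vec_of A c q b) p
      = vec_of A c p (haa (matrix_op c y) (frechet_derivative (matrix_op c) (at y)) a b)"
    using represented_haantjes[OF c coordinate_system_open[OF cs] order_refl r r smooth_on_const[OF o] smooth_on_const[OF o]] p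
    by (simp add: represented_def)
  ultimately show ?thesis using components_vec_of[OF cs p(1)] vec_of_linear(4)[OF cs p(1)] by metis
qed

lemma triangular_coordinates:
  assumes h: "haantjes_vanishes A L" and p: "p \<in> manifold A"
  shows "\<exists>d\<in>coordinate_systems A. p \<in> fst d \<and> (\<forall>q\<in>fst d. upper_triangular3 (operator_matrix A L d q))"
proof -
  obtain c where c: "c \<in> A" "p \<in> fst c" using p by (auto simp: manifold_def)
  note cs = atlas_coordinate_system[OF c(1)]
  note ch = coordinate_system_chart[OF cs]
  interpret nilpotent_shift "snd c ` fst c" "matrix_op c" "eigenvalue c" "nil_part c"
    by (rule nilpotent_shift_chart[OF c(1) coordinate_system_open[OF cs] order_refl])
  have pV: "snd c p \<in> snd c ` fst c" using c(2) by blast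
  obtain U W and \<Psi> G :: "real ^ 3 \<Rightarrow> real ^ 3" where UW: "open U" "open W" "snd c p \<in> W" "W \<subseteq> snd c ` fst c"
    and hom: "homeomorphism U W \<Psi> G" and s\<Psi>: "smooth_on U \<Psi>" and sG: "smooth_on W G"
    and z1: "\<And>t. t \<in> U \<Longrightarrow> \<exists>a. matrix_op c (\<Psi> t) (frechet_derivative \<Psi> (at t) (axis 1 1)) = a *\<^sub>R frechet_derivative \<Psi> (at t) (axis 1 1)"
    and z2: "\<And>t. t \<in> U \<Longrightarrow> \<exists>a b. matrix_op c (\<Psi> t) (frechet_derivative \<Psi> (at t) (axis 2 1)) =
       a *\<^sub>R frechet_derivative \<Psi> (at t) (axis 1 1) + b *\<^sub>R frechet_derivative \<Psi> (at t) (axis 2 1)"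
    using triangularize[OF haa_eq_0_of_haantjes_vanishes[OF h c(1)] pV] by metis
  have G: "G (\<Psi> t) = t" "\<Psi> t \<in> W" if "t \<in> U" for t using hom that by (auto simp: homeomorphism_def)
  have \<Psi>: "\<Psi> (G y) = y" "G y \<in> U" if "y \<in> W" for y using hom that by (auto simp: homeomorphism_def)
  \<comment> \<open>The new coordinate map is that of \<open>c\<close> followed by \<open>G\<close>,
    on the part of the chart that is sent into \<open>W\<close>.\<close>
  define D where "D = fst c \<inter> snd c -` W"
  define d where "d = (D, \<lambda>q. G (snd c q))"
  have d1 [simp]: "fst d = D" and d2 [simp]: "snd d q = G (snd c q)" for q by (simp_all add: d_def)
  have D: "open D" "D \<subseteq> fst c" using open_chart_vimage[OF ch UW(2)] by (auto simp: D_def)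
  have Dc: "snd c q \<in> W" if "q \<in> D" for q using that by (simp add: D_def)
  have inv\<Psi>: "chart_inv c (\<Psi> t) \<in> D" "snd c (chart_inv c (\<Psi> t)) = \<Psi> t" if "t \<in> U" for t
    using apply_chart_inv[of "\<Psi> t" c] G(2)[OF that] UW(4) by (auto simp: D_def)
  have img: "snd d ` D = U"
  proof
    show "snd d ` D \<subseteq> U" using Dc \<Psi>(2) by auto
    show "U \<subseteq> snd d ` D"
    proof
      fix t assume "t \<in> U"
      then show "t \<in> snd d ` D" using inv\<Psi>[of t] G[of t] by (intro image_eqI[of _ _ "chart_inv c (\<Psi> t)"]) auto
    qed
  qed
  have inj: "inj_on (snd d) D"
  proof (rule inj_onI)
    fix q q' assume q: "q \<in> D" "q' \<in> D" "snd d q = snd d q'"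
    then have "snd c q = snd c q'" using \<Psi>(1)[OF Dc] by (metis d2)
    then show "q = q'" using q D(2) chart_inv_apply[OF ch] by (metis subsetD)
  qed
  have invd: "chart_inv d t = chart_inv c (\<Psi> t)" if "t \<in> U" for t
    using inv_into_f_eq[OF inj inv\<Psi>(1)[OF that], of t] inv\<Psi>(2)[OF that] G(1)[OF that] by simp
  have cinv: "continuous_on (snd c ` fst c) (chart_inv c)" and cc: "continuous_on (fst c) (snd c)"
    using ch by (auto simp: is_chart_def homeomorphism_def)
  have chd: "is_chart d"
    unfolding is_chart_def d1 img
  proof (intro conjI D(1) UW(1) homeomorphismI)
    have "continuous_on D (\<lambda>q. G (snd c q))"
      using Dc by (intro continuous_on_compose2[OF smooth_on_continuous[OF sG] continuous_on_subset[OF cc D(2)]]) auto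
    then show "continuous_on D (snd d)" by simp
    have "continuous_on U (\<lambda>t. chart_inv c (\<Psi> t))"
      using G UW(4) by (intro continuous_on_compose2[OF cinv smooth_on_continuous[OF s\<Psi>]]) auto
    then show "continuous_on U (inv_into D (snd d))"
      using invd by (simp cong: continuous_on_cong)
    show "snd d ` D \<subseteq> U" using img by simp
    show "inv_into D (snd d) ` U \<subseteq> D" using invd inv\<Psi>(1) by auto
    show "inv_into D (snd d) (snd d q) = q" if "q \<in> D" for q
      by (rule inv_into_f_f[OF inj that])
    show "snd d (inv_into D (snd d) t) = t" if "t \<in> U" for t
      by (rule f_inv_into_f) (simp only: img that)
  qed
  have cd: "d \<in> coordinate_systems A"
    unfolding coordinate_systems_def compatible_def
  proof (intro CollectI conjI ballI chd)
    show "fst d \<subseteq> manifold A" using D(2) coordinate_system_manifold[OF cs] by auto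
    fix b assume b: "b \<in> A"
    note bs = atlas_coordinate_system[OF b]
    have o: "open (D \<inter> fst b)" using D(1) coordinate_system_open[OF bs] by blast
    have ob: "open (fst c \<inter> fst b)" using coordinate_system_open[OF cs] coordinate_system_open[OF bs] by blast
    have S: "open (snd d ` (D \<inter> fst b))" using open_chart_image[OF chd o] by simp
    have T: "open (snd c ` (fst c \<inter> fst b))" using open_chart_image[OF ch ob] by simp
    have sub: "snd d ` (D \<inter> fst b) \<subseteq> U" using img by blast
    have "smooth_on (snd d ` (D \<inter> fst b)) (\<lambda>t. (snd b \<circ> chart_inv c) (\<Psi> t))"
    proof (rule smooth_on_compose[OF S T _ smooth_on_subset[OF s\<Psi> sub] coordinate_system_compatible(1)[OF cs b]])
      fix t assume "t \<in> snd d ` (D \<inter> fst b)"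
      then obtain q where "q \<in> D" "q \<in> fst b" "t = G (snd c q)" by auto
      then show "\<Psi> t \<in> snd c ` (fst c \<inter> fst b)" using \<Psi>(1)[OF Dc] D(2) by auto
    qed
    then show "smooth_on (snd d ` (fst d \<inter> fst b)) (snd b \<circ> chart_inv d)"
      unfolding d1 by (rule smooth_on_cong[OF S, rotated]) (use sub invd in auto)
    have Sb: "open (snd b ` (D \<inter> fst b))" using open_chart_image[OF coordinate_system_chart[OF bs] o] by simp
    have sb: "smooth_on (snd b ` (D \<inter> fst b)) (snd c \<circ> chart_inv b)"
      by (rule smooth_on_subset[OF coordinate_system_compatible(1)[OF bs c(1)]]) (use D(2) in auto)
    have "smooth_on (snd b ` (D \<inter> fst b)) (\<lambda>y. G ((snd c \<circ> chart_inv b) y))"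
    proof (rule smooth_on_compose[OF Sb UW(2) _ sb sG])
      show "(snd c \<circ> chart_inv b) y \<in> W" if "y \<in> snd b ` (D \<inter> fst b)" for y
        using that Dc by (auto simp: chart_inv_apply[OF coordinate_system_chart[OF bs]])
    qed
    then show "smooth_on (snd b ` (fst d \<inter> fst b)) (snd d \<circ> chart_inv b)"
      by (simp add: o_def)
  qed
  have "upper_triangular3 (operator_matrix A L d q)" if q: "q \<in> D" for q
  proof -
    let ?t = "G (snd c q)" and ?M = "operator_matrix A L d q"
    have t: "?t \<in> U" "\<Psi> ?t = snd c q" using \<Psi>[OF Dc[OF q]] by auto
    have qc: "q \<in> fst c" and qd: "q \<in> fst d" using q D(2) by auto
    let ?D = "frechet_derivative \<Psi> (at ?t)"
    \<comment> \<open>The coordinate vectors of \<open>d\<close> are the images of the axes under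
      the derivative of \<open>\<Psi>\<close>, so the conditions on these images describe the first
      two columns of the matrix in \<open>d\<close>.\<close>
    have tr: "vec_of A d q a = vec_of A c q (?D a)" for a
      by (rule vec_of_transfer[OF cs qc cd qd UW(1)]) (use t invd smooth_on_has_derivative[OF s\<Psi> t(1)] in auto)
    have op: "vec_of A d q (?M *v a) = vec_of A c q (matrix_op c (\<Psi> ?t) (?D a))" for a
      using operator_vec_of[OF cd qd, of a] operator_vec_of'[OF cs qc, of "?D a"] by (simp add: tr t(2))
    obtain a where a: "matrix_op c (\<Psi> ?t) (?D (axis 1 1)) = a *\<^sub>R ?D (axis 1 1)" using z1[OF t(1)] by blast
    have "vec_of A d q (?M *v axis 1 1) = vec_of A d q (a *\<^sub>R axis 1 1)"
      unfolding op a by (simp only: vec_of_linear[OF cs qc] vec_of_linear[OF cd qd]) (simp only: tr)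
    then have 1: "?M *v axis 1 1 = a *\<^sub>R axis 1 1" using components_vec_of[OF cd qd] by metis
    obtain b1 b2 where b: "matrix_op c (\<Psi> ?t) (?D (axis 2 1)) = b1 *\<^sub>R ?D (axis 1 1) + b2 *\<^sub>R ?D (axis 2 1)"
      using z2[OF t(1)] by blast
    have "vec_of A d q (?M *v axis 2 1) = vec_of A d q (b1 *\<^sub>R axis 1 1 + b2 *\<^sub>R axis 2 1)"
      unfolding op b by (simp only: vec_of_linear[OF cs qc] vec_of_linear[OF cd qd]) (simp only: tr)
    then have 2: "?M *v axis 2 1 = b1 *\<^sub>R axis 1 1 + b2 *\<^sub>R axis 2 1" using components_vec_of[OF cd qd] by metis
    have M: "?M $ i $ j = (?M *v axis j 1) $ i" for i j by (simp add: matrix_vector_mult_basis column_def)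
    show ?thesis
      unfolding upper_triangular3_def M 1 2 by (simp add: axis_def)
  qed
  then show ?thesis using cd c(2) UW(3) by (intro bexI[OF _ cd]) (auto simp: D_def)
qed

end

theorem theorem1:
  fixes A :: "('a::{t2_space, second_countable_topology}, 3) chart set"
    and L :: "'a opfield"
  assumes "smooth_atlas A"
    and "smooth_operator_field A L"
    and "\<forall>p\<in>manifold A. single_jordan_block_at A L p"
  shows "(\<forall>p\<in>manifold A. \<exists>c\<in>coordinate_systems A. p \<in> fst c \<and>
            (\<forall>q\<in>fst c. upper_triangular3 (operator_matrix A L c q)))
         \<longleftrightarrow> haantjes_vanishes A L"
proof -
  \<comment> \<open>The single Jordan block hypothesis also supplies the tangent bases that the
    locale asks for.\<close>
  interpret jordan_field A L
    by unfold_locales (use assms in \<open>auto simp: single_jordan_block_at_def\<close>)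
  show ?thesis using haantjes_vanishes_of_triangular triangular_coordinates by blast
qed

end
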